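(* Let $Q$, $c$, $h$, $V_n$, $r_n$ be as described in the context, and let $R_n(z)=r_n^2\,\mathbf R_n(r_nz)$ be the rescaled one-point functions. Then each subsequence of $\{R_n\}$ has a further subsequence which converges in $L^1_{\mathrm{loc}}(\mathbb C)$ and locally uniformly on $\mathbb C^*=\mathbb C\setminus\{0\}$ to a function $R$.
   Context: Notation: $\partial=\frac12(\partial_x-i\partial_y)$, $\bar\partial=\frac12(\partial_x+i\partial_y)$, $\Delta=\partial\bar\partial$, $dA=dx\,dy/\pi$. Potential. Let $k\ge1$ be an integer and $c>-1$ a real number. $Q$ is a real-valued function on $\mathbb C$, lower semicontinuous, with $\liminf_{\zeta\to\infty}Q(\zeta)/\log|\zeta|>2$. The equilibrium measure $\sigma$ is the unique compactly supported Borel probability measure minimizing $I_Q[\mu]=\iint\log\frac1{|\zeta-\eta|}\,d\mu(\zeta)d\mu(\eta)+\int Q\,d\mu$; its support $S$ is the droplet. $Q$ is $C^2$-smooth in a neighbourhood of $S$, so that $d\sigma=\Delta Q\cdot\chi_S\,dA$. Assume $0\in\operatorname{Int}S$, $Q$ is real-analytic near $0$, and the Taylor expansion of $\Delta Q$ about $0$ is $\Delta Q=P+$ higher order terms, with $P$ positive definite and homogeneous of degree $2k-2$. Canonical decomposition. Let $\tilde Q_0$ be the Taylor polynomial of $Q$ of degree $2k$ at $0$, $Q_1=Q-\tilde Q_0$, $H(\zeta)=Q(0)+\sum_{j=1}^{2k}\frac2{j!}\partial^jQ(0)\zeta^j$, and $Q_0=\tilde Q_0-\operatorname{Re}H$.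 Then $Q=Q_0+\operatorname{Re}H+Q_1$, $Q_0$ is homogeneous of degree $2k$, and $Q_1=O(|\zeta|^{2k+1})$ as $\zeta\to0$. Perturbation. $h(\zeta)=h_0(\zeta)+\sum_{j=1}^s2c_j\log|\zeta-a_j|$ with distinct points $a_j\in\mathbb C\setminus\{0\}$, $c_j>-1$, and $h_0$ a real-valued $C^{1,1}$ function on $\mathbb C$ with $h_0(\zeta)\le C[1+\log(1+|\zeta|^2)]$ and $\Delta h_0(\zeta)\le C(1+|\zeta|^2)^{-2}$ almost everywhere. Put $V_n(\zeta)=Q(\zeta)-\frac{2c}n\log|\zeta|-\frac1nh(\zeta)$. It is assumed that $Q(0)=H(0)=h(0)=0$. One-point function. $d\mu_n=e^{-nV_n}dA$; $\mathcal P_n$ is the space of polynomials of degree at most $n-1$ with the norm of $L^2(\mu_n)$ ($n$ sufficiently large); $\mathbf k_n$ is its reproducing kernel; $\mathbf R_n(\zeta)=\mathbf k_n(\zeta,\zeta)e^{-nV_n(\zeta)}$. Microscopic scale. $r_n=n^{-1/(2k)}$, with the standing normalization of $Q$ (by a multiplicative constant) that $\frac{\Delta^kQ_0(0)}{k[(k-1)!]^2}=1+c$. *)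

theory Defs
  imports "HOL-Probability.Probability_Measure"
begin

definition pdx :: "(complex \<Rightarrow> 'a::real_normed_vector) \<Rightarrow> complex \<Rightarrow> 'a" where
  "pdx f z = vector_derivative (\<lambda>t::real. f (z + of_real t)) (at 0)"

definition pdy :: "(complex \<Rightarrow> 'a::real_normed_vector) \<Rightarrow> complex \<Rightarrow> 'a" where
  "pdy f z = vector_derivative (\<lambda>t::real. f (z + of_real t * \<i>)) (at 0)"

definition wirt :: "(complex \<Rightarrow> complex) \<Rightarrow> complex \<Rightarrow> complex" where
  "wirt f z = (pdx f z - \<i> * pdy f z) / 2"

definition wirt_bar :: "(complex \<Rightarrow> complex) \<Rightarrow> complex \<Rightarrow> complex" where
  "wirt_bar f z = (pdx f z + \<i> * pdy f z) / 2"

text \<open>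
  The Laplacian is the composition of the two Wirtinger derivatives, a quarter of the usual one. For a real function it is
  real wherever the mixed second partial derivatives agree (almost everywhere for a
  \<open>C\<^sup>1\<^sup>,\<^sup>1\<close> function), so taking the real part loses nothing.
\<close>

definition lap :: "(complex \<Rightarrow> real) \<Rightarrow> complex \<Rightarrow> real" where
  "lap f z = Re (wirt (wirt_bar (\<lambda>w. complex_of_real (f w))) z)"

definition C1_on :: "complex set \<Rightarrow> (complex \<Rightarrow> real) \<Rightarrow> bool" where
  "C1_on U f \<longleftrightarrow> f differentiable_on U \<and> continuous_on U (pdx f) \<and> continuous_on U (pdy f)"

definition C2_on :: "complex set \<Rightarrow> (complex \<Rightarrow> real) \<Rightarrow> bool" where
  "C2_on U f \<longleftrightarrow> C1_on U f \<and> C1_on U (pdx f) \<and> C1_on U (pdy f)"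

text \<open>
  \<open>C\<^sup>1\<^sup>,\<^sup>1\<close> on the whole plane is understood locally: the gradient is Lipschitz on every disc,
  with a constant that may depend on the disc.
\<close>

definition C11 :: "(complex \<Rightarrow> real) \<Rightarrow> bool" where
  "C11 f \<longleftrightarrow> f differentiable_on UNIV \<and>
     (\<forall>r. \<exists>L. L-lipschitz_on (cball 0 r) (pdx f) \<and> L-lipschitz_on (cball 0 r) (pdy f))"

definition real_analytic_at :: "(complex \<Rightarrow> real) \<Rightarrow> complex \<Rightarrow> bool" where
  "real_analytic_at f z \<longleftrightarrow> (\<exists>b :: nat \<times> nat \<Rightarrow> real. \<exists>r>0. \<forall>w\<in>ball 0 r.
     ((\<lambda>(i, j). b (i, j) * Re w ^ i * Im w ^ j) has_sum f (z + w)) UNIV)"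

definition taylor0 :: "nat \<Rightarrow> (complex \<Rightarrow> real) \<Rightarrow> complex \<Rightarrow> real" where
  "taylor0 m f w = (\<Sum>i\<le>m. \<Sum>j\<le>m - i.
     (pdx ^^ i) ((pdy ^^ j) f) 0 / (fact i * fact j) * Re w ^ i * Im w ^ j)"

definition homogeneous :: "nat \<Rightarrow> (complex \<Rightarrow> real) \<Rightarrow> bool" where
  "homogeneous d f \<longleftrightarrow> (\<forall>t::real. \<forall>z. f (of_real t * z) = t ^ d * f z)"

definition lower_semicont :: "(complex \<Rightarrow> real) \<Rightarrow> bool" where
  "lower_semicont f \<longleftrightarrow> (\<forall>b. open {z. b < f z})"

definition dA :: "complex measure" where
  "dA = density lborel (\<lambda>_. ennreal (1 / pi))"

text \<open>
  Integral with values in \<open>[-\<infinity>, \<infinity>]\<close>, positive part minus negative part. Below it is only used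
  for integrands bounded below on the support of a finite measure.
\<close>

definition ext_integral :: "'a measure \<Rightarrow> ('a \<Rightarrow> ereal) \<Rightarrow> ereal" where
  "ext_integral M f =
     enn2ereal (\<integral>\<^sup>+ x. e2ennreal (f x) \<partial>M) - enn2ereal (\<integral>\<^sup>+ x. e2ennreal (- f x) \<partial>M)"

definition log_kernel :: "complex \<Rightarrow> complex \<Rightarrow> ereal" where
  "log_kernel z w = (if z = w then \<infinity> else ereal (ln (1 / cmod (z - w))))"

definition energy :: "(complex \<Rightarrow> real) \<Rightarrow> complex measure \<Rightarrow> ereal" where
  "energy Q \<mu> =
     ext_integral (\<mu> \<Otimes>\<^sub>M \<mu>) (\<lambda>(z, w). log_kernel z w) + ext_integral \<mu> (\<lambda>z. ereal (Q z))"

definition compact_prob_measures :: "complex measure set" where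
  "compact_prob_measures =
     {\<mu>. prob_space \<mu> \<and> sets \<mu> = sets borel \<and> (\<exists>K. compact K \<and> emeasure \<mu> (- K) = 0)}"

definition equilibrium_measure :: "(complex \<Rightarrow> real) \<Rightarrow> complex measure \<Rightarrow> bool" where
  "equilibrium_measure Q \<sigma> \<longleftrightarrow>
     \<sigma> \<in> compact_prob_measures \<and> (\<forall>\<mu>\<in>compact_prob_measures. energy Q \<sigma> \<le> energy Q \<mu>)"

definition msupport :: "complex measure \<Rightarrow> complex set" where
  "msupport \<mu> = {z. \<forall>U. open U \<longrightarrow> z \<in> U \<longrightarrow> emeasure \<mu> U > 0}"

definition H_part :: "nat \<Rightarrow> (complex \<Rightarrow> real) \<Rightarrow> complex \<Rightarrow> complex" where
  "H_part k Q z = of_real (Q 0) +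
     (\<Sum>j=1..2*k. 2 / fact j * (wirt ^^ j) (\<lambda>w. complex_of_real (Q w)) 0 * z ^ j)"

definition Q0_part :: "nat \<Rightarrow> (complex \<Rightarrow> real) \<Rightarrow> complex \<Rightarrow> real" where
  "Q0_part k Q z = taylor0 (2*k) Q z - Re (H_part k Q z)"

text \<open>
  Since \<open>ln 0 = 0\<close> here, the next two functions have irrelevant values at the points \<open>a j\<close> and at
  \<open>0\<close>. These form a null set, and in the rescaled picture the points \<open>a j\<close> leave
  every compact set.
\<close>

definition perturbation ::
  "(complex \<Rightarrow> real) \<Rightarrow> nat \<Rightarrow> (nat \<Rightarrow> complex) \<Rightarrow> (nat \<Rightarrow> real) \<Rightarrow> complex \<Rightarrow> real" where
  "perturbation h0 s a cs z = h0 z + (\<Sum>j=1..s. 2 * cs j * ln (cmod (z - a j)))"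

definition V_pot ::
  "(complex \<Rightarrow> real) \<Rightarrow> real \<Rightarrow> (complex \<Rightarrow> real) \<Rightarrow> nat \<Rightarrow> complex \<Rightarrow> real" where
  "V_pot Q c h n z = Q z - 2 * c / real n * ln (cmod z) - 1 / real n * h z"

definition mu_n ::
  "(complex \<Rightarrow> real) \<Rightarrow> real \<Rightarrow> (complex \<Rightarrow> real) \<Rightarrow> nat \<Rightarrow> complex measure" where
  "mu_n Q c h n = density dA (\<lambda>z. ennreal (exp (- real n * V_pot Q c h n z)))"

definition poly_space :: "nat \<Rightarrow> (complex \<Rightarrow> complex) set" where
  "poly_space n = {poly p | p. degree p \<le> n - 1}"

definition is_reproducing_kernel ::
  "complex measure \<Rightarrow> (complex \<Rightarrow> complex) set \<Rightarrow> (complex \<Rightarrow> complex \<Rightarrow> complex) \<Rightarrow> bool" where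
  "is_reproducing_kernel M F K \<longleftrightarrow>
     (\<forall>f\<in>F. integrable M (\<lambda>z. (cmod (f z))\<^sup>2)) \<and>
     (\<forall>w. (\<lambda>z. K z w) \<in> F) \<and>
     (\<forall>f\<in>F. \<forall>w. f w = (\<integral>z. f z * cnj (K z w) \<partial>M))"

definition kernel_n ::
  "(complex \<Rightarrow> real) \<Rightarrow> real \<Rightarrow> (complex \<Rightarrow> real) \<Rightarrow> nat \<Rightarrow> complex \<Rightarrow> complex \<Rightarrow> complex" where
  "kernel_n Q c h n = (THE K. is_reproducing_kernel (mu_n Q c h n) (poly_space n) K)"

definition one_point ::
  "(complex \<Rightarrow> real) \<Rightarrow> real \<Rightarrow> (complex \<Rightarrow> real) \<Rightarrow> nat \<Rightarrow> complex \<Rightarrow> real" where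
  "one_point Q c h n z = Re (kernel_n Q c h n z z) * exp (- real n * V_pot Q c h n z)"

definition r_scale :: "nat \<Rightarrow> nat \<Rightarrow> real" where
  "r_scale k n = real n powr (- 1 / (2 * real k))"

definition rescaled_one_point ::
  "nat \<Rightarrow> (complex \<Rightarrow> real) \<Rightarrow> real \<Rightarrow> (complex \<Rightarrow> real) \<Rightarrow> nat \<Rightarrow> complex \<Rightarrow> real" where
  "rescaled_one_point k Q c h n z =
     (r_scale k n)\<^sup>2 * one_point Q c h n (of_real (r_scale k n) * z)"

definition L1_loc :: "(complex \<Rightarrow> real) \<Rightarrow> bool" where
  "L1_loc f \<longleftrightarrow> (\<forall>K. compact K \<longrightarrow> set_integrable dA K f)"

definition converges_L1_loc :: "(nat \<Rightarrow> complex \<Rightarrow> real) \<Rightarrow> (complex \<Rightarrow> real) \<Rightarrow> bool" where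
  "converges_L1_loc f g \<longleftrightarrow>
     (\<forall>\<^sub>F n in sequentially. L1_loc (f n)) \<and> L1_loc g \<and>
     (\<forall>K. compact K \<longrightarrow> (\<lambda>n. LINT z:K|dA. \<bar>f n z - g z\<bar>) \<longlonglongrightarrow> 0)"

definition converges_loc_unif ::
  "complex set \<Rightarrow> (nat \<Rightarrow> complex \<Rightarrow> real) \<Rightarrow> (complex \<Rightarrow> real) \<Rightarrow> bool" where
  "converges_loc_unif D f g \<longleftrightarrow>
     (\<forall>K. compact K \<longrightarrow> K \<subseteq> D \<longrightarrow> uniform_limit K f g sequentially)"

end

(*
  The real-analytic expansion of Q at 0 has the form Re G + T + O(|z|^(2k+1)) with a polynomial G and a
  form T of degree 2k: the terms of degree below 2k are harmonic because the Taylor polynomial of the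
  Laplacian is homogeneous of degree 2k - 2. At the scale r_n = n^(-1/(2k)) we have n T(r_n z) = T(z),
  while exp(-n G / 2) is holomorphic and can be multiplied into the polynomials. The area mean value
  property and the maximum principle then bound p exp(-n G / 2) at this scale by the L^2 norm of p.
  Applied to p = k_n(., w), this shows that the rescaled kernels L_n(z, w) (with the exponential factors
  included) are locally bounded; they are holomorphic in z and hermitian, so by Cauchy's estimate the
  functions F_n(z) = L_n(z, z) are locally equi-Lipschitz. By Arzela-Ascoli a subsequence converges locally
  uniformly. Finally R_n(z) = F_n(z) exp(U_n(z)) |z|^(2c), where U_n converges locally uniformly to
  -T + h(0) and |z|^(2c) is locally integrable and continuous away from 0.
*)

theory Submission
  imports Defs "HOL-Complex_Analysis.Complex_Analysis" "HOL-Library.Diagonal_Subsequence"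
begin

text \<open>The obstacle is the factor |z|^(2c) of the weight. For c > 0 it vanishes at 0, so an
  unweighted mean over a disc around 0 is not controlled by the weighted norm. For c < 0 it is
  unbounded, so uniform convergence near 0 cannot be expected. The first difficulty is met by
  averaging only where the scaled point stays away from 0, which suffices for entire functions; the
  second by keeping |z|^(2c) as a fixed factor outside the limit: F_n exp(U_n) converges uniformly
  on every disc, the origin included, and only the product with |z|^(2c) is measured in L^1. The
  kernel has to be studied off the diagonal because F_n is real and not holomorphic; Cauchy's
  estimate applies to L_n(z, w) in one variable, and hermitian symmetry transfers it to the other.
  The kernel is a definite description. It denotes a reproducing kernel only once n is so large that
  the growth of Q makes polynomials of degree n - 1 square integrable, so all statements about it
  hold from some n on.\<close>

section \<open>Lebesgue measure on the plane\<close>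

text \<open>Lebesgue measure is moved to \<open>real^2\<close>, where orthogonal transformations act
  on vectors; the two measures agree because they give every box the same value.\<close>

lemma lborel_complex_vec2:
  "distr lborel borel (\<lambda>v::real^2. Complex (vec_nth v 1) (vec_nth v 2)) = lborel"
proof (rule lborel_eqI[symmetric])
  have m: "(\<lambda>v::real^2. Complex (vec_nth v 1) (vec_nth v 2)) \<in> borel_measurable borel"
    by (intro borel_measurable_continuous_onI continuous_intros) 
  fix l u :: complex
  assume le: "\<And>b. b \<in> Basis \<Longrightarrow> l \<bullet> b \<le> u \<bullet> b"
  have pre: "(\<lambda>v::real^2. Complex (vec_nth v 1) (vec_nth v 2)) -` box l u = box (vector [Re l, Im l]) (vector [Re u, Im u])"
    by (auto simp: in_box_complex_iff mem_box_cart forall_2)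
  have le2: "Re l \<le> Re u" "Im l \<le> Im u" using le[of 1] le[of \<i>] by (auto simp: Basis_complex_def inner_complex_def)
  have "emeasure (distr lborel borel (\<lambda>v::real^2. Complex (vec_nth v 1) (vec_nth v 2))) (box l u)
    = emeasure lborel (box (vector [Re l, Im l] :: real^2) (vector [Re u, Im u]))"
    using m pre by (subst emeasure_distr) auto
  also have "\<dots> = ennreal ((Re u - Re l) * (Im u - Im l))"
  proof -
    have "(\<Prod>b\<in>Basis. ((vector [Re u, Im u] - vector [Re l, Im l]) :: real^2) \<bullet> b) 
      = (\<Prod>i\<in>UNIV. vec_nth ((vector [Re u, Im u] - vector [Re l, Im l]) :: real^2) i)"
      by (simp add: Basis_vec_def prod.UNION_disjoint inner_axis UNION_singleton_eq_range)
         (subst prod.reindex; auto simp: inj_on_def axis_eq_axis inner_axis)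
    also have "\<dots> = (Re u - Re l) * (Im u - Im l)"
      by (simp add: UNIV_2)
    finally have prd: "(\<Prod>b\<in>Basis. ((vector [Re u, Im u] - vector [Re l, Im l]) :: real^2) \<bullet> b) 
      = (Re u - Re l) * (Im u - Im l)" .
    show ?thesis unfolding prd[symmetric]
    proof (subst emeasure_lborel_box)
      fix b :: "real^2" assume "b \<in> Basis"
      then obtain i where "b = axis i 1" by (auto simp: Basis_vec_def)
      then show "vector [Re l, Im l] \<bullet> b \<le> vector [Re u, Im u] \<bullet> b"
        using le2 exhaust_2[of i] by (auto simp: inner_axis)
    qed simp
  qed
  finally show "emeasure (distr lborel borel (\<lambda>v::real^2. Complex (vec_nth v 1) (vec_nth v 2))) (box l u) = (\<Prod>b\<in>Basis. (u - l) \<bullet> b)"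
    by (simp add: Basis_complex_def inner_complex_def)
qed simp

text \<open>The preimage of a box under multiplication by \<open>u\<close> is its image under
  \<open>T\<close>, multiplication by \<open>inverse u\<close> read in \<open>real^2\<close>. As
  \<open>T\<close> is orthogonal, this image has the measure of the box, and values on boxes
  determine the measure.\<close>

lemma lborel_rotate:
  fixes u :: complex assumes u: "norm u = 1"
  shows "distr lborel borel (\<lambda>z. u * z) = lborel"
proof (rule lborel_eqI[symmetric])
  let ?\<phi> = "\<lambda>v::real^2. Complex (vec_nth v 1) (vec_nth v 2)"
  let ?\<psi> = "\<lambda>z. vector [Re z, Im z] :: real^2"
  define T where "T = (\<lambda>v. ?\<psi> (inverse u * ?\<phi> v))"
  have m: "?\<phi> \<in> borel_measurable borel"
    by (intro borel_measurable_continuous_onI continuous_intros) 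
  fix a b :: complex
  assume le: "\<And>i. i \<in> Basis \<Longrightarrow> a \<bullet> i \<le> b \<bullet> i"
  have u0: "u \<noteq> 0" using u by auto
  have inv1: "inverse u * (u * z) = z" for z using u0 by simp
  have \<phi>\<psi>: "?\<phi> (?\<psi> z) = z" for z by (simp add: complex_eq_iff)
  have \<psi>\<phi>: "?\<psi> (?\<phi> z) = z" for z by (simp add: vec_eq_iff forall_2)
  have nrm: "norm (?\<phi> v) = norm v" for v by (simp add: cmod_def norm_vec_def L2_set_def UNIV_2)
  have "orthogonal_transformation T"
    unfolding orthogonal_transformation
  proof (intro conjI allI)
    show "linear T"
      unfolding T_def
      by (intro linearI) (auto simp: vec_eq_iff forall_2 algebra_simps add_divide_distrib)
    show "norm (T v) = norm v" for v
    proof -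
      have "norm (T v) = norm (?\<phi> (T v))" by (simp only: nrm)
      also have "\<dots> = norm v" unfolding T_def \<phi>\<psi> using u by (simp only: norm_mult norm_inverse nrm) simp
      finally show ?thesis .
    qed
  qed
  have pre: "?\<phi> -` ((\<lambda>z. u * z) -` box a b) = T ` (?\<phi> -` box a b)"
  proof (intro set_eqI iffI)
    fix v assume "v \<in> ?\<phi> -` ((\<lambda>z. u * z) -` box a b)"
    then have "?\<psi> (u * ?\<phi> v) \<in> ?\<phi> -` box a b" by (simp only: vimage_eq \<phi>\<psi>)
    moreover have "v = T (?\<psi> (u * ?\<phi> v))" unfolding T_def \<phi>\<psi> inv1 by (rule \<psi>\<phi>[symmetric])
    ultimately show "v \<in> T ` (?\<phi> -` box a b)" by blast
  next
    fix v assume "v \<in> T ` (?\<phi> -` box a b)"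
    then obtain w where w: "v = T w" "?\<phi> w \<in> box a b" by blast
    have "u * ?\<phi> (T w) = ?\<phi> w"
      unfolding T_def \<phi>\<psi> using u0 by (simp only: mult.assoc[symmetric]) simp
    then show "v \<in> ?\<phi> -` ((\<lambda>z. u * z) -` box a b)" using w by (simp only: vimage_eq)
  qed
  have box: "?\<phi> -` box a b = box (?\<psi> a) (?\<psi> b)"
    by (auto simp: in_box_complex_iff mem_box_cart forall_2)
  have om: "open ((\<lambda>z. u * z) -` box a b)"
    by (intro open_vimage continuous_intros open_box)
  have om2: "open (?\<phi> -` ((\<lambda>z. u * z) -` box a b))"
    by (rule open_vimage[OF om]) (intro continuous_intros)
  have "emeasure (distr lborel borel (\<lambda>z. u * z)) (box a b) = emeasure lborel ((\<lambda>z. u * z) -` box a b)"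
    by (subst emeasure_distr) auto
  also have "\<dots> = emeasure (distr lborel borel ?\<phi>) ((\<lambda>z. u * z) -` box a b)"
    by (simp only: lborel_complex_vec2)
  also have "\<dots> = emeasure lborel (?\<phi> -` ((\<lambda>z. u * z) -` box a b))"
    using m om by (subst emeasure_distr) auto
  also have "\<dots> = emeasure lebesgue (T ` (?\<phi> -` box a b))"
    unfolding pre[symmetric]
    by (subst emeasure_completion) (use om2 in auto)
  also have "\<dots> = ennreal (measure lebesgue (T ` (?\<phi> -` box a b)))"
    unfolding box
    using measurable_orthogonal_image[OF \<open>orthogonal_transformation T\<close> lmeasurable_box]
    by (intro emeasure_eq_measure2)
  also have "\<dots> = ennreal (measure lebesgue (?\<phi> -` box a b))"
    unfolding box
    by (subst measure_orthogonal_image[OF \<open>orthogonal_transformation T\<close>]) auto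
  also have "\<dots> = emeasure lborel (?\<phi> -` box a b)"
    unfolding box by (simp add: emeasure_eq_measure2 emeasure_lborel_box_finite)
  also have "\<dots> = emeasure (distr lborel borel ?\<phi>) (box a b)"
    using m by (subst emeasure_distr) auto
  also have "\<dots> = emeasure lborel (box a b)"
    by (simp only: lborel_complex_vec2)
  finally show "emeasure (distr lborel borel (\<lambda>z. u * z)) (box a b) = (\<Prod>i\<in>Basis. (b - a) \<bullet> i)"
    using le by simp
qed simp

text \<open>Rotating by \<open>\<pi> / j\<close> changes the sign of \<open>z ^ j\<close>. This replaces integration in polar coordinates
  in the proof of the area mean value property.\<close>

lemma set_lebesgue_integral_ball_power:
  assumes j: "j > 0"
  shows "(LINT z:ball 0 r|lborel. (z::complex) ^ j) = 0"
proof -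
  define u where "u = cis (pi / j)"
  have u: "norm u = 1" "u ^ j = -1"
    using j by (auto simp: u_def Complex.DeMoivre)
  let ?I = "LINT z:ball 0 r|lborel. (z::complex) ^ j"
  have "?I = (LINT z|distr lborel borel (\<lambda>z. u * z). indicator (ball 0 r) z *\<^sub>R z ^ j)"
    unfolding lborel_rotate[OF u(1)] set_lebesgue_integral_def ..
  also have "\<dots> = (LINT z|lborel. indicator (ball 0 r) (u * z) *\<^sub>R (u * z) ^ j)"
    by (subst integral_distr) (auto intro!: borel_measurable_scaleR borel_measurable_indicator borel_measurable_power)
  also have "\<dots> = (LINT z|lborel. - (indicator (ball 0 r) z *\<^sub>R z ^ j))"
    using u by (intro Bochner_Integration.integral_cong) (auto simp: indicator_def norm_mult power_mult_distrib)
  also have "\<dots> = - ?I"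
    by (simp add: set_lebesgue_integral_def)
  finally show ?thesis by simp
qed

section \<open>The area mean value property\<close>

lemma measure_ball_complex: "r \<ge> 0 \<Longrightarrow> measure lborel (ball (z::complex) r) = pi * r\<^sup>2"
  using content_ball[of r z] by (simp add: unit_ball_vol_2)

text \<open>Integrate the Taylor series at \<open>z0\<close> term by term: every power except the
  constant one has integral 0 over the disc.\<close>

lemma holomorphic_area_mean:
  assumes hol: "f holomorphic_on ball z0 R" and r: "0 < r" "r < R"
  shows "(LINT z:ball z0 r|lborel. f z) = of_real (pi * r\<^sup>2) * f z0"
proof -
  define a where "a n = (deriv ^^ n) f z0 / fact n" for n
  have sums: "(\<lambda>n. a n * z ^ n) sums f (z0 + z)" if "norm z < R" for z
    using holomorphic_power_series[OF hol, of "z0 + z"] that by (simp add: a_def dist_norm)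
  have "summable (\<lambda>n. norm (a n * of_real r ^ n))"
  proof -
    \<comment> \<open>Convergence at a radius strictly beyond \<open>r\<close> gives absolute
      convergence at \<open>r\<close>, and this numerical series dominates the Taylor series on the
      whole disc.\<close>
    obtain s where s: "r < s" "s < R" using dense[OF r(2)] by auto
    have "summable (\<lambda>n. a n * of_real s ^ n)"
      using sums[of "of_real s"] s r by (auto simp: sums_iff)
    from powser_insidea[OF this, of "of_real r"] show ?thesis using s r by simp
  qed
  then have summ: "summable (\<lambda>n. norm (a n) * r ^ n)"
    using r by (simp add: norm_mult norm_power)
  define g where "g n z = indicator (ball 0 r) z *\<^sub>R (a n * z ^ n)" for n z
  have int_pow: "integrable lborel (\<lambda>z. indicator (ball 0 r) z *\<^sub>R (z::complex) ^ n)" for n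
  proof -
    have "set_integrable lborel (cball 0 r) (\<lambda>z::complex. z ^ n)"
      unfolding set_integrable_def by (intro borel_integrable_compact) (auto intro!: continuous_intros)
    then have "set_integrable lborel (ball 0 r) (\<lambda>z::complex. z ^ n)"
      by (rule set_integrable_subset) auto
    then show ?thesis unfolding set_integrable_def .
  qed
  have g_alt: "g n = (\<lambda>z. a n * (indicator (ball 0 r) z *\<^sub>R z ^ n))" for n
    by (auto simp: g_def)
  have int_g: "integrable lborel (g n)" for n
    unfolding g_alt by (intro integrable_mult_right int_pow)
  have gi: "(LINT z|lborel. g n z) = (if n = 0 then of_real (pi * r\<^sup>2) * f z0 else 0)" for n
  proof (cases "n = 0")
    case True
    then show ?thesis
      unfolding g_alt using r measure_ball_complex[of r 0]
      by (simp add: a_def scaleR_conv_of_real)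
  next
    case False
    then show ?thesis unfolding g_alt integral_mult_right_zero
      using set_lebesgue_integral_ball_power[of n r]
      by (simp add: set_lebesgue_integral_def)
  qed
  have g_le: "norm (g n z) \<le> (norm (a n) * r ^ n) * indicator (ball 0 r) z" for n z
    by (auto simp: g_def indicator_def norm_mult norm_power intro!: mult_left_mono power_mono)
  have ni: "(LINT z|lborel. norm (g n z)) \<le> (norm (a n) * r ^ n) * (pi * r\<^sup>2)" for n
  proof -
    have "(LINT z|lborel. norm (g n z)) \<le> (LINT z|lborel. (norm (a n) * r ^ n) * indicator (ball (0::complex) r) z)"
      using int_g g_le by (intro integral_mono) (auto intro!: integrable_mult_right integrable_real_indicator emeasure_bounded_finite)
    also have "\<dots> = (norm (a n) * r ^ n) * (pi * r\<^sup>2)"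
      using r by (simp add: measure_ball_complex)
    finally show ?thesis .
  qed
  have "(LINT z:ball z0 r|lborel. f z) = (LINT z|lborel. indicator (ball z0 r) (z0 + z) *\<^sub>R f (z0 + z))"
    unfolding set_lebesgue_integral_def using r
    by (subst lborel_distr_plus[of z0, symmetric], subst integral_distr)
       (auto intro!: borel_measurable_continuous_on_indicator holomorphic_on_imp_continuous_on holomorphic_on_subset[OF hol])
  also have "\<dots> = (LINT z|lborel. (\<Sum>n. g n z))"
  proof (intro Bochner_Integration.integral_cong refl)
    fix z :: complex
    show "indicator (ball z0 r) (z0 + z) *\<^sub>R f (z0 + z) = (\<Sum>n. g n z)"
      using sums[of z] r by (auto simp: g_def indicator_def dist_norm sums_iff)
  qed
  also have "\<dots> = (\<Sum>n. (LINT z|lborel. g n z))"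
  proof (rule integral_suminf[OF int_g])
    show "AE z in lborel. summable (\<lambda>n. norm (g n z))"
    proof (intro AE_I2)
      fix z show "summable (\<lambda>n. norm (g n z))"
        using g_le[of _ z] summ
        by (intro summable_comparison_test'[where N=0, OF summable_mult2[OF summ, of "indicator (ball 0 r) z"]]) auto
    qed
    show "summable (\<lambda>n. (LINT z|lborel. norm (g n z)))"
      using ni by (intro summable_comparison_test'[where N=0, OF summable_mult2[OF summ, of "pi * r\<^sup>2"]]) auto
  qed
  also have "\<dots> = of_real (pi * r\<^sup>2) * f z0"
    unfolding gi by (subst suminf_finite[of "{0}"]) auto
  finally show ?thesis .
qed

text \<open>The square of \<open>f\<close> is again holomorphic, so the mean value property applies
  to it, and the triangle inequality for integrals replaces subharmonicity of the squared
  modulus.\<close>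

lemma holomorphic_area_submean:
  assumes hol: "f holomorphic_on ball z0 R" and r: "0 < r" "r < R"
  shows "pi * r\<^sup>2 * (norm (f z0))\<^sup>2 \<le> (LINT z:ball z0 r|lborel. (norm (f z))\<^sup>2)"
proof -
  have "of_real (pi * r\<^sup>2) * (f z0)\<^sup>2 = (LINT z:ball z0 r|lborel. (f z)\<^sup>2)"
    by (rule holomorphic_area_mean[symmetric, where R=R]) (auto intro!: holomorphic_intros hol r)
  then have "norm (of_real (pi * r\<^sup>2) * (f z0)\<^sup>2) \<le> (LINT z:ball z0 r|lborel. norm ((f z)\<^sup>2))"
    unfolding set_lebesgue_integral_def
    using integral_norm_bound[of lborel "\<lambda>z. indicator (ball z0 r) z *\<^sub>R (f z)\<^sup>2"] by simp
  then show ?thesis by (simp add: norm_mult norm_power)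
qed

section \<open>Integrability of powers of the distance\<close>

text \<open>The series of \<open>c j\<close> times the indicator of \<open>A j\<close> dominates
  \<open>f\<close> on \<open>S\<close>. With dyadic discs for \<open>A j\<close> this settles
  integrability of powers both at a point and at infinity.\<close>

lemma nn_integral_finite_of_cover:
  fixes f :: "'a \<Rightarrow> ennreal"
  assumes A: "\<And>j::nat. A j \<in> sets M" "\<And>j. emeasure M (A j) \<le> ennreal (m j)"
    and m: "\<And>j. 0 \<le> c j" "\<And>j. 0 \<le> m j" and summ: "summable (\<lambda>j. c j * m j)"
    and le: "\<And>x. x \<in> S \<Longrightarrow> \<exists>j. x \<in> A j \<and> f x \<le> ennreal (c j)"
  shows "(\<integral>\<^sup>+x\<in>S. f x \<partial>M) < \<infinity>"
proof -
  have "(\<integral>\<^sup>+x\<in>S. f x \<partial>M) \<le> (\<integral>\<^sup>+x. (\<Sum>j. ennreal (c j) * indicator (A j) x) \<partial>M)"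
  proof (intro nn_integral_mono)
    fix x
    show "f x * indicator S x \<le> (\<Sum>j. ennreal (c j) * indicator (A j) x)"
    proof (cases "x \<in> S")
      case True
      then obtain j where j: "x \<in> A j" "f x \<le> ennreal (c j)" using le by blast
      have "ennreal (c j) * indicator (A j) x \<le> (\<Sum>j. ennreal (c j) * indicator (A j) x)"
        using sum_le_suminf[of "\<lambda>j. ennreal (c j) * indicator (A j) x" "{j}"] by (simp del: sum_mult_indicator)
      then show ?thesis using j True by (auto simp: indicator_def intro: order_trans)
    qed simp
  qed
  also have "\<dots> = (\<Sum>j. ennreal (c j) * emeasure M (A j))"
    using A by (subst nn_integral_suminf) (auto simp: nn_integral_cmult)
  also have "\<dots> \<le> (\<Sum>j. ennreal (c j * m j))"
    using A m by (intro suminf_le) (auto simp: ennreal_mult intro!: mult_left_mono)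
  also have "\<dots> = ennreal (\<Sum>j. c j * m j)"
    using m summ by (intro suminf_ennreal2) auto
  also have "\<dots> < \<infinity>" by simp
  finally show ?thesis .
qed

lemma emeasure_ball_complex: "r \<ge> 0 \<Longrightarrow> emeasure lborel (ball (z::complex) r) = ennreal (pi * r\<^sup>2)"
  by (simp add: emeasure_ball unit_ball_vol_2)

lemma nn_integral_powr_ball:
  fixes x :: complex
  assumes g: "g > -1"
  shows "(\<integral>\<^sup>+z\<in>ball x r - {x}. ennreal (exp (2 * g * ln (norm (z - x)))) \<partial>lborel) < (\<infinity>::ennreal)"
proof (cases "r > 0")
  case False
  then have e: "ball x r - {x} = {}" by auto
  show ?thesis unfolding e by simp
next
  case True
  \<comment> \<open>Halving the radius multiplies its power \<open>2g\<close> by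
    \<open>2^(-2g)\<close> and the area by \<open>1/4\<close>; \<open>q\<close> is the product, and
    it is below 1 exactly because \<open>g > -1\<close>.\<close>
  define q where "q = (2::real) powr (-2 - 2*g)"
  \<comment> \<open>For distances between half the radius and the radius, replacing the distance by
    the radius costs nothing if \<open>g \<ge> 0\<close> and at most the factor
    \<open>2^(-2g)\<close> if \<open>g\<close> is negative.\<close>
  define C where "C = max 1 (2 powr (- 2 * g))"
  have q: "0 < q" "q < 1" using g by (auto simp: q_def powr_less_one)
  define \<rho> where "\<rho> j = r * 2 powr - real j" for j :: nat
  show ?thesis
  proof (rule nn_integral_finite_of_cover[where c = "\<lambda>j. C * (\<rho> j) powr (2*g)" and m = "\<lambda>j. pi * (\<rho> j)\<^sup>2"])
    show "ball x (\<rho> j) \<in> sets lborel" for j by simp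
    show "emeasure lborel (ball x (\<rho> j)) \<le> ennreal (pi * (\<rho> j)\<^sup>2)" for j
      using True by (simp add: emeasure_ball_complex \<rho>_def)
    show "0 \<le> pi * (\<rho> j)\<^sup>2" for j by simp
    show "0 \<le> C * (\<rho> j) powr (2*g)" for j by (simp add: C_def)
    have "C * (\<rho> j) powr (2*g) * (pi * (\<rho> j)\<^sup>2) = (C * pi * r powr (2 * g) * r\<^sup>2) * q ^ j" for j
    proof -
      have "(\<rho> j) powr (2*g) * (\<rho> j)\<^sup>2 = (\<rho> j) powr (2*g + 2)"
        using True by (simp add: \<rho>_def powr_add powr_numeral)
      also have "\<dots> = r powr (2*g + 2) * q ^ j"
        using True by (simp add: \<rho>_def powr_mult powr_powr q_def powr_realpow[symmetric] algebra_simps)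
      also have "r powr (2*g + 2) = r powr (2*g) * r\<^sup>2"
        using True by (simp add: powr_add powr_numeral)
      finally show ?thesis by (simp add: algebra_simps)
    qed
    then show "summable (\<lambda>j. C * (\<rho> j) powr (2*g) * (pi * (\<rho> j)\<^sup>2))"
      using q by (simp only:) (intro summable_mult summable_geometric, auto)
    fix z assume z: "z \<in> ball x r - {x}"
    define d where "d = norm (z - x)"
    have d: "0 < d" "d < r" using z by (auto simp: d_def dist_norm norm_minus_commute)
    define y where "y = log 2 (r / d)"
    have y: "y > 0" using d True by (auto simp: y_def)
    have d_eq: "d = r * 2 powr (- y)" using d True by (simp add: y_def powr_minus field_simps)
    \<comment> \<open>Ceiling minus one rather than floor: \<open>j < y\<close> must be strict for
      \<open>z\<close> to lie in the open disc of radius \<open>\<rho> j\<close>.\<close>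
    define j where "j = nat (\<lceil>y\<rceil> - 1)"
    have j: "real j < y" "y \<le> real j + 1" using y unfolding j_def by linarith+
    have "d < \<rho> j" unfolding d_eq \<rho>_def using j True by (intro mult_strict_left_mono) auto
    moreover have "d powr (2 * g) \<le> C * (\<rho> j) powr (2*g)"
    proof -
      have e: "d powr (2*g) = (\<rho> j) powr (2*g) * 2 powr (2 * g * (real j - y))"
        unfolding d_eq \<rho>_def using True by (simp add: powr_mult powr_powr powr_add[symmetric] algebra_simps)
      have le: "2 powr (2 * g * (real j - y)) \<le> C"
      proof (cases "g \<ge> 0")
        case True
        then have "2 * g * (real j - y) \<le> 0" using j by (simp add: mult_nonneg_nonpos)
        then have "2 powr (2 * g * (real j - y)) \<le> 2 powr 0" by (intro powr_mono) auto
        then show ?thesis by (simp add: C_def)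
      next
        case False
        then have "(-2 * g) * (y - real j) \<le> (-2 * g) * 1" using j by (intro mult_left_mono) auto
        then have "2 * g * (real j - y) \<le> -2 * g" by (simp add: algebra_simps)
        then have "2 powr (2 * g * (real j - y)) \<le> 2 powr (-2 * g)"
          by (intro powr_mono) auto
        then show ?thesis unfolding C_def by (rule max.coboundedI2)
      qed
      show ?thesis unfolding e using mult_left_mono[OF le, of "\<rho> j powr (2*g)"]
        by (simp add: mult.commute)
    qed
    moreover have "exp (2 * g * ln (norm (z - x))) = d powr (2 * g)"
      using d by (simp add: d_def powr_def)
    ultimately show "\<exists>j. z \<in> ball x (\<rho> j) \<and> ennreal (exp (2 * g * ln (norm (z - x)))) \<le> ennreal (C * (\<rho> j) powr (2*g))"
      by (auto intro!: exI[of _ j] simp: d_def dist_norm norm_minus_commute ennreal_leI)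
  qed
qed

text \<open>In the annulus \<open>2^j \<le> norm z < 2^(j+1)\<close> the integrand is at most
  \<open>2^(-4j)\<close> and the area below \<open>4 pi 4^j\<close>, so the terms decay like
  \<open>4^(-j)\<close>.\<close>

lemma nn_integral_norm_power_at_infinity:
  assumes r: "r \<ge> 1"
  shows "(\<integral>\<^sup>+z\<in>{z::complex. r \<le> norm z}. ennreal (1 / norm z ^ 4) \<partial>lborel) < (\<infinity>::ennreal)"
proof (rule nn_integral_finite_of_cover)
  show "ball (0::complex) (2 ^ Suc j) \<in> sets lborel" for j by simp
  show "emeasure lborel (ball (0::complex) (2 ^ Suc j)) \<le> ennreal (pi * (2 ^ Suc j)\<^sup>2)" for j
    using emeasure_ball_complex[of "2 ^ Suc j" 0] by simp
  have "(1 / (2 ^ j) ^ 4) * (pi * (2 ^ Suc j)\<^sup>2) = 4 * pi * (1/4) ^ j" for j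
  proof -
    have "(4::real) ^ j = (2 ^ j)\<^sup>2" by (simp add: power_mult_distrib[symmetric] power2_eq_square)
    then show ?thesis by (simp add: field_simps power_divide power_mult_distrib) 
  qed
  then show "summable (\<lambda>j. (1 / (2 ^ j) ^ 4) * (pi * (2 ^ Suc j)\<^sup>2))"
    by (simp only:) (intro summable_mult summable_geometric, auto)
  fix z :: complex assume "z \<in> {z. r \<le> norm z}"
  then have z: "norm z \<ge> 1" using r by auto
  then have z0: "z \<noteq> 0" by auto
  define j where "j = nat \<lfloor>log 2 (norm z)\<rfloor>"
  have "0 \<le> log 2 (norm z)" using z by (auto simp: log_def)
  then have j: "real j \<le> log 2 (norm z)" "log 2 (norm z) < real (Suc j)" unfolding j_def by linarith+
  have "2 powr real j \<le> norm z" "norm z < 2 powr real (Suc j)"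
    using j z z0 le_log_iff[of 2 "norm z" "real j"] log_less_iff[of 2 "norm z" "real (Suc j)"] by auto
  then have "2 ^ j \<le> norm z" "norm z < 2 ^ Suc j"
    by (simp_all only: powr_realpow zero_less_numeral)
  then show "\<exists>j. z \<in> ball 0 (2 ^ Suc j) \<and> ennreal (1 / norm z ^ 4) \<le> ennreal (1 / (2 ^ j) ^ 4)"
    using z0
    by (intro exI[of _ j] conjI ennreal_leI divide_left_mono power_mono mult_pos_pos zero_less_power) auto
qed auto

section \<open>Reproducing kernels of polynomial spaces\<close>

lemma reproducing_kernelD:
  assumes "is_reproducing_kernel M F K"
  shows "(\<lambda>z. K z w) \<in> F"
    and "f \<in> F \<Longrightarrow> f w = (LINT z|M. f z * cnj (K z w))"
    and "f \<in> F \<Longrightarrow> integrable M (\<lambda>z. (cmod (f z))\<^sup>2)"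
  using assms unfolding is_reproducing_kernel_def by blast+

lemma cnj_LINT_mult_cnj: "cnj (LINT z|M. f z * cnj (g z)) = (LINT z|M. g z * cnj (f z))"
  using Bochner_Integration.integral_cnj[of M "\<lambda>z. f z * cnj (g z)"] by (simp add: mult.commute)

lemma reproducing_kernel_hermitian:
  assumes "is_reproducing_kernel M F K" "is_reproducing_kernel M F L"
  shows "K w v = cnj (L v w)"
proof -
  have "K w v = (LINT z|M. K z v * cnj (L z w))"
    by (rule reproducing_kernelD(2)[OF assms(2) reproducing_kernelD(1)[OF assms(1)]])
  also have "\<dots> = cnj (LINT z|M. L z w * cnj (K z v))"
    by (rule cnj_LINT_mult_cnj[symmetric])
  also have "(LINT z|M. L z w * cnj (K z v)) = L v w"
    by (rule reproducing_kernelD(2)[OF assms(1) reproducing_kernelD(1)[OF assms(2)], symmetric])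
  finally show ?thesis .
qed

lemma reproducing_kernel_unique:
  assumes "is_reproducing_kernel M F K" "is_reproducing_kernel M F L"
  shows "K = L"
  by (intro ext trans[OF reproducing_kernel_hermitian[OF assms]
        reproducing_kernel_hermitian[OF assms(2,2), symmetric]])

lemma reproducing_kernel_diag:
  assumes "is_reproducing_kernel M F K"
  shows "K w w = of_real (LINT z|M. (cmod (K z w))\<^sup>2)"
proof -
  have "K w w = (LINT z|M. K z w * cnj (K z w))"
    by (rule reproducing_kernelD(2)[OF assms reproducing_kernelD(1)[OF assms]])
  also have "\<dots> = (LINT z|M. of_real ((cmod (K z w))\<^sup>2))"
    by (simp only: complex_norm_square)
  finally show ?thesis by (simp only: integral_complex_of_real)
qed

section \<open>Gram-Schmidt orthogonalisation and existence of the kernel\<close>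

text \<open>Here \<open>N\<close> is the top degree, so \<open>poly_space n\<close> corresponds to
  \<open>N = n - 1\<close>. Definiteness is what permits division by the norm in the
  orthogonalisation.\<close>

locale poly_inner =
  fixes M :: "complex measure" and N :: nat
  assumes sets_M [measurable_cong]: "sets M = sets borel"
    and integrable_norm2: "degree p \<le> N \<Longrightarrow> integrable M (\<lambda>z. (cmod (poly p z))\<^sup>2)"
    and definite: "degree p \<le> N \<Longrightarrow> (LINT z|M. (cmod (poly p z))\<^sup>2) = 0 \<Longrightarrow> p = 0"
begin

definition ip :: "complex poly \<Rightarrow> complex poly \<Rightarrow> complex" where
  "ip p q = (LINT z|M. poly p z * cnj (poly q z))"

lemma measurable_poly [measurable]: "poly p \<in> borel_measurable M"
  using borel_measurable_continuous_onI[of "poly p"] continuous_on_poly[OF continuous_on_id, of UNIV p]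
  by (simp add: measurable_cong_sets[OF sets_M refl])

lemma integrable_ip:
  assumes "degree p \<le> N" "degree q \<le> N"
  shows "integrable M (\<lambda>z. poly p z * cnj (poly q z))"
proof (rule Bochner_Integration.integrable_bound)
  show "integrable M (\<lambda>z. (cmod (poly p z))\<^sup>2 + (cmod (poly q z))\<^sup>2)"
    using assms by (intro Bochner_Integration.integrable_add integrable_norm2)
  show "AE z in M. norm (poly p z * cnj (poly q z)) \<le> norm ((cmod (poly p z))\<^sup>2 + (cmod (poly q z))\<^sup>2)"
  proof (intro AE_I2)
    fix z
    have "2 * cmod (poly p z) * cmod (poly q z) \<le> (cmod (poly p z))\<^sup>2 + (cmod (poly q z))\<^sup>2"
      using sum_squares_bound by blast
    moreover have "0 \<le> cmod (poly p z) * cmod (poly q z)" by simp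
    ultimately have "cmod (poly p z) * cmod (poly q z) \<le> (cmod (poly p z))\<^sup>2 + (cmod (poly q z))\<^sup>2"
      by linarith
    then show "norm (poly p z * cnj (poly q z)) \<le> norm ((cmod (poly p z))\<^sup>2 + (cmod (poly q z))\<^sup>2)"
      by (simp add: norm_mult)
  qed
qed (intro borel_measurable_times measurable_compose[OF measurable_poly borel_measurable_continuous_onI] measurable_poly continuous_intros)

lemma ip_cnj: "ip p q = cnj (ip q p)"
  unfolding ip_def cnj_LINT_mult_cnj ..

lemma ip_add: "degree p \<le> N \<Longrightarrow> degree q \<le> N \<Longrightarrow> degree r \<le> N \<Longrightarrow> ip (p + q) r = ip p r + ip q r"
  unfolding ip_def by (simp add: distrib_right integrable_ip)

lemma ip_diff: "degree p \<le> N \<Longrightarrow> degree q \<le> N \<Longrightarrow> degree r \<le> N \<Longrightarrow> ip (p - q) r = ip p r - ip q r"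
  unfolding ip_def by (simp add: left_diff_distrib integrable_ip)

lemma ip_smult: "ip (smult a p) r = a * ip p r"
  unfolding ip_def by (simp add: mult.assoc)

lemma ip_sum:
  assumes "finite I" "\<And>i. i \<in> I \<Longrightarrow> degree (f i) \<le> N" "degree r \<le> N"
  shows "ip (\<Sum>i\<in>I. smult (a i) (f i)) r = (\<Sum>i\<in>I. a i * ip (f i) r)"
  using assms
proof (induction I rule: finite_induct)
  case empty
  then show ?case by (simp add: ip_def)
next
  case (insert x I)
  have "degree (\<Sum>i\<in>I. smult (a i) (f i)) \<le> N"
    using insert.prems by (intro degree_sum_le insert.hyps) (auto intro: order_trans[OF degree_smult_le])
  moreover have "degree (smult (a x) (f x)) \<le> N"
    using insert.prems by (auto intro: order_trans[OF degree_smult_le])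
  ultimately show ?case
    using insert by (simp add: ip_add ip_smult)
qed

lemma ip_self: "ip p p = of_real (LINT z|M. (cmod (poly p z))\<^sup>2)"
  unfolding ip_def complex_norm_square[symmetric] by (rule integral_complex_of_real)

lemma ip_sum_right:
  assumes "finite I" "\<And>i. i \<in> I \<Longrightarrow> degree (f i) \<le> N" "degree r \<le> N"
  shows "ip r (\<Sum>i\<in>I. smult (a i) (f i)) = (\<Sum>i\<in>I. cnj (a i) * ip r (f i))"
proof -
  have "ip r (\<Sum>i\<in>I. smult (a i) (f i)) = cnj (\<Sum>i\<in>I. a i * ip (f i) r)"
    by (subst ip_cnj, subst ip_sum) (use assms in simp_all)
  also have "\<dots> = (\<Sum>i\<in>I. cnj (a i) * cnj (ip (f i) r))" by simp
  finally show ?thesis unfolding ip_cnj[of r, symmetric] .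
qed

text \<open>Gram--Schmidt, phrased through the reproducing property alone, so that the orthonormality
  of the system is never needed.\<close>

lemma ex_expansion:
  assumes "m \<le> Suc N"
  shows "\<exists>e. (\<forall>i<m. degree (e i) < m) \<and>
    (\<forall>p. p = 0 \<or> degree p < m \<longrightarrow> p = (\<Sum>i<m. smult (ip p (e i)) (e i)))"
  using assms
proof (induction m)
  case 0
  \<comment> \<open>The disjunct \<open>p = 0\<close> matters here: the zero polynomial has degree
    0, which is not below 0.\<close>
  show ?case by simp
next
  case (Suc m)
  then obtain e where "(\<forall>i<m. degree (e i) < m) \<and>
      (\<forall>p. p = 0 \<or> degree p < m \<longrightarrow> p = (\<Sum>i<m. smult (ip p (e i)) (e i)))"
    using Suc_leD by blast
  then have e: "\<And>i. i < m \<Longrightarrow> degree (e i) < m"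
    "\<And>p. p = 0 \<or> degree p < m \<Longrightarrow> p = (\<Sum>i<m. smult (ip p (e i)) (e i))"
    by blast+
  have mN: "m \<le> N" using Suc.prems by simp
  have eN: "degree (e i) \<le> N" if "i < m" for i using e(1)[OF that] mN by simp
  define x where "x = monom (1::complex) m"
  define s where "s = (\<Sum>i<m. smult (ip x (e i)) (e i))"
  \<comment> \<open>The monomial minus its projection to lower degrees; it is monic of degree
    \<open>m\<close>, hence not zero.\<close>
  define q where "q = x - s"
  have x: "degree x = m" "coeff x m = 1" by (auto simp: x_def degree_monom_eq)
  have s: "s = 0 \<or> degree s < m"
  proof (cases "m = 0")
    case True then show ?thesis by (simp add: s_def)
  next
    case False
    have "degree s \<le> m - 1" unfolding s_def
      using e(1) by (intro degree_sum_le) (fastforce intro: order_trans[OF degree_smult_le])+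
    then show ?thesis using False by auto
  qed
  have sm: "coeff s m = 0" using s by (auto intro: coeff_eq_0)
  have sN: "degree s \<le> N" using s mN by auto
  have qm: "coeff q m = 1" using x sm by (simp add: q_def)
  have q0: "q \<noteq> 0" using qm by auto
  have qN: "degree q \<le> m" unfolding q_def using x s by (intro degree_diff_le) auto
  \<comment> \<open>Expanding \<open>p\<close> turns \<open>ip p x\<close> into the sum of
    \<open>ip p (e i)\<close> times \<open>ip (e i) x\<close>, which is also \<open>ip p s\<close>.
    So \<open>p\<close> is orthogonal to \<open>x - s\<close> without any relation among the
    \<open>e i\<close>.\<close>
  have orth: "ip p q = 0" if p: "p = 0 \<or> degree p < m" for p
  proof -
    have pN: "degree p \<le> N" using p mN by auto
    have "ip p x = ip (\<Sum>i<m. smult (ip p (e i)) (e i)) x"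
      using arg_cong[OF e(2)[OF p], of "\<lambda>y. ip y x"] .
    also have "\<dots> = (\<Sum>i<m. ip p (e i) * ip (e i) x)"
      using eN x mN by (intro ip_sum) auto
    also have "\<dots> = (\<Sum>i<m. cnj (ip x (e i)) * ip p (e i))"
      by (intro sum.cong refl) (subst ip_cnj[of x], simp add: mult.commute)
    also have "\<dots> = ip p s"
      unfolding s_def using eN pN by (intro ip_sum_right[symmetric]) auto
    finally have "ip x p = ip s p" using ip_cnj[of x p] ip_cnj[of s p] by simp
    then have "ip q p = 0"
      unfolding q_def using x mN sN pN by (subst ip_diff) auto
    then show ?thesis by (subst ip_cnj) simp
  qed
  define t where "t = (LINT z|M. (cmod (poly q z))\<^sup>2)"
  have t: "ip q q = of_real t" "t > 0"
    using definite[of q] q0 qN mN ip_self[of q] by (auto simp: t_def less_le)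
  define b where "b = 1 / sqrt t"
  have b: "b * (b * t) = 1" using t by (simp add: b_def field_simps)
  define e' where "e' = e(m := smult (of_real b) q)"
  have *: "p = (\<Sum>i<Suc m. smult (ip p (e' i)) (e' i))" if p: "p = 0 \<or> degree p < Suc m" for p
  proof -
    define a where "a = coeff p m"
    \<comment> \<open>As \<open>q\<close> is monic, this removes the top coefficient and leaves a
      polynomial to which the induction hypothesis applies.\<close>
    define p' where "p' = p - smult a q"
    have "degree p' \<le> m" unfolding p'_def using p qN
      by (intro degree_diff_le) (auto intro: order_trans[OF degree_smult_le])
    moreover have "coeff p' m = 0" by (simp add: p'_def a_def qm)
    ultimately have p': "p' = 0 \<or> degree p' < m"
      by (metis le_neq_implies_less leading_coeff_0_iff)
    have pN: "degree p' \<le> N" "degree (smult a q) \<le> N" using p' mN qN degree_smult_le[of a q] by auto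
    have peq: "p = smult a q + p'" by (simp add: p'_def)
    have "ip p q = a * of_real t" unfolding peq using pN qN mN t
      by (subst ip_add) (auto simp: ip_smult orth[OF p'])
    then have "ip p (smult (of_real b) q) = of_real b * (a * of_real t)"
      using ip_smult[of "of_real b" q p] ip_cnj[of p q]
      by (subst ip_cnj) (simp add: ip_smult)
    then have "smult (ip p (e' m)) (e' m) = smult (a * of_real (b * (b * t))) q"
      by (simp add: e'_def mult_ac)
    then have 1: "smult (ip p (e' m)) (e' m) = smult a q" by (simp add: b)
    have e'i: "e' i = e i" if "i < m" for i using that by (simp add: e'_def)
    \<comment> \<open>A multiple of \<open>q\<close> does not disturb the earlier coefficients,
      because \<open>q\<close> is orthogonal to every \<open>e i\<close>.\<close>
    have 2: "ip p (e i) = ip p' (e i)" if "i < m" for i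
    proof -
      have "ip q (e i) = 0" using orth[of "e i"] e(1)[OF that] ip_cnj[of q "e i"] by simp
      then show ?thesis unfolding peq using pN eN[OF that] that
        by (subst ip_add) (auto simp: ip_smult e'_def)
    qed
    have "(\<Sum>i<m. smult (ip p (e' i)) (e' i)) = (\<Sum>i<m. smult (ip p' (e i)) (e i))"
      by (intro sum.cong refl) (simp add: 2 e'i)
    also have "\<dots> = p'" by (rule e(2)[OF p', symmetric])
    finally have S: "(\<Sum>i<m. smult (ip p (e' i)) (e' i)) = p'" .
    show ?thesis unfolding sum.lessThan_Suc 1 S by (simp add: p'_def)
  qed
  have "degree (e' i) < Suc m" if "i < Suc m" for i
  proof (cases "i = m")
    case True
    have "degree (smult (of_real b) q) \<le> m" using qN degree_smult_le order_trans by blast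
    then show ?thesis using True by (simp add: e'_def)
  next
    case False
    then show ?thesis using that e(1)[of i] by (simp add: e'_def)
  qed
  then show ?case using * by (intro exI[of _ e'] conjI allI impI) (assumption | rule *)+
qed

text \<open>The expansion of \<open>p\<close> in the \<open>e i\<close>, evaluated at
  \<open>w\<close>, is the reproducing property. The \<open>e i\<close> stay visible because they
  make the diagonal a finite sum of squared moduli of polynomials, which is what its integrability
  rests on.\<close>

lemma ex_reproducing_kernel:
  "\<exists>e. (\<forall>i\<le>N. degree (e i) \<le> N) \<and>
    is_reproducing_kernel M (poly_space (Suc N)) (\<lambda>z w. \<Sum>i\<le>N. poly (e i) z * cnj (poly (e i) w))"
proof -
  obtain e where "(\<forall>i<Suc N. degree (e i) < Suc N) \<and>
      (\<forall>p. p = 0 \<or> degree p < Suc N \<longrightarrow> p = (\<Sum>i<Suc N. smult (ip p (e i)) (e i)))"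
    using ex_expansion[of "Suc N"] by blast
  then have e: "\<And>i. i \<le> N \<Longrightarrow> degree (e i) \<le> N"
    "\<And>p. degree p \<le> N \<Longrightarrow> p = (\<Sum>i\<le>N. smult (ip p (e i)) (e i))"
    unfolding less_Suc_eq_le lessThan_Suc_atMost by blast+
  have "is_reproducing_kernel M (poly_space (Suc N)) (\<lambda>z w. \<Sum>i\<le>N. poly (e i) z * cnj (poly (e i) w))"
    unfolding is_reproducing_kernel_def poly_space_def
  proof (intro conjI ballI allI; (elim CollectE exE conjE)?)
    fix f p assume "f = poly p" "degree (p :: complex poly) \<le> Suc N - 1"
    then show "integrable M (\<lambda>z. (cmod (f z))\<^sup>2)" using integrable_norm2[of p] by simp
  next
    fix w
    have "(\<lambda>z. \<Sum>i\<le>N. poly (e i) z * cnj (poly (e i) w)) = poly (\<Sum>i\<le>N. smult (cnj (poly (e i) w)) (e i))"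
      by (auto simp: poly_sum mult.commute)
    moreover have "degree (\<Sum>i\<le>N. smult (cnj (poly (e i) w)) (e i)) \<le> N"
      using e(1) by (intro degree_sum_le) (auto intro: order_trans[OF degree_smult_le])
    ultimately show "(\<lambda>z. \<Sum>i\<le>N. poly (e i) z * cnj (poly (e i) w)) \<in> {poly p |p. degree p \<le> Suc N - 1}"
      by auto
  next
    fix f p w assume f: "f = poly p" and p: "degree (p :: complex poly) \<le> Suc N - 1"
    have "(LINT z|M. f z * cnj (\<Sum>i\<le>N. poly (e i) z * cnj (poly (e i) w)))
      = (LINT z|M. (\<Sum>i\<le>N. (poly p z * cnj (poly (e i) z)) * poly (e i) w))"
      by (simp add: f sum_distrib_left mult_ac)
    also have "\<dots> = (\<Sum>i\<le>N. ip p (e i) * poly (e i) w)"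
    proof (subst Bochner_Integration.integral_sum)
      fix i assume "i \<in> {..N}"
      then show "integrable M (\<lambda>z. poly p z * cnj (poly (e i) z) * poly (e i) w)"
        using p e(1)[of i] by (intro integrable_mult_left integrable_ip) auto
    qed (simp add: ip_def)
    also have "\<dots> = poly (\<Sum>i\<le>N. smult (ip p (e i)) (e i)) w"
      by (simp only: poly_sum poly_smult)
    also have "\<dots> = poly p w"
      using p by (subst e(2)[of p, symmetric]) simp_all
    finally show "f w = (LINT z|M. f z * cnj (\<Sum>i\<le>N. poly (e i) z * cnj (poly (e i) w)))"
      by (simp add: f)
  qed
  then show ?thesis using e(1) by (intro exI[of _ e]) simp
qed

end

section \<open>Real-analytic functions with homogeneous Laplacian\<close>

text \<open>The condition in \<open>real_analytic_at f 0\<close> with coefficients and radius made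
  explicit, so that derivatives can be tracked coefficientwise on an unchanged disc.\<close>

definition dps :: "(nat \<times> nat \<Rightarrow> real) \<Rightarrow> real \<Rightarrow> (complex \<Rightarrow> real) \<Rightarrow> bool" where
  "dps b r f \<longleftrightarrow> (\<forall>w\<in>ball 0 r. ((\<lambda>(i, j). b (i, j) * Re w ^ i * Im w ^ j) has_sum f w) UNIV)"

lemma dps_abs_summable:
  assumes "dps b r f" "x\<^sup>2 + y\<^sup>2 < r\<^sup>2" "r > 0"
  shows "(\<lambda>(i, j). \<bar>b (i, j)\<bar> * \<bar>x\<bar> ^ i * \<bar>y\<bar> ^ j) summable_on UNIV"
proof -
  have "Complex x y \<in> ball 0 r"
    using assms(2,3) real_sqrt_less_mono[OF assms(2)] by (simp add: cmod_def)
  from bspec[OF assms(1)[unfolded dps_def] this]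
  have "(\<lambda>(i, j). b (i, j) * x ^ i * y ^ j) summable_on UNIV"
    unfolding summable_on_def by auto
  then have "(\<lambda>p. norm ((\<lambda>(i, j). b (i, j) * x ^ i * y ^ j) p)) summable_on UNIV"
    by (rule iffD1[OF summable_on_iff_abs_summable_on_real])
  then show ?thesis by (simp add: case_prod_unfold abs_mult power_abs)
qed

lemma has_sum_rows:
  fixes F :: "nat \<times> nat \<Rightarrow> real"
  assumes "(F has_sum S) UNIV"
  shows "(\<lambda>i. \<Sum>\<^sub>\<infinity>j. F (i, j)) sums S"
proof -
  have "F summable_on UNIV" using assms by (auto simp: summable_on_def)
  then have "(\<lambda>(i, j). (curry F) i j) summable_on (UNIV \<times> UNIV)" by simp
  from summable_on_SigmaD1[OF this] have s: "(\<lambda>j. F (i, j)) summable_on UNIV" for i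
    by (simp add: curry_def)
  have "((\<lambda>i. \<Sum>\<^sub>\<infinity>j. F (i, j)) has_sum S) UNIV"
  proof (rule has_sum_SigmaD[where B = "\<lambda>_. UNIV" and f = F])
    show "(F has_sum S) (UNIV \<times> UNIV)" using assms by simp
    show "((\<lambda>j. F (i, j)) has_sum (\<Sum>\<^sub>\<infinity>j. F (i, j))) UNIV" for i
      using s by simp
  qed
  then show ?thesis by (rule has_sum_imp_sums)
qed

text \<open>Since \<open>(i + 1) q^i\<close> is bounded for \<open>q < 1\<close>, the differentiated
  series at \<open>x\<close> is dominated by the original one at a larger radius.\<close>

lemma ex_power_deriv_bound:
  fixes x \<rho> :: real
  assumes "\<bar>x\<bar> < \<rho>"
  shows "\<exists>K. \<forall>i. real (Suc i) * \<bar>x\<bar> ^ i \<le> K * \<rho> ^ Suc i"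
proof -
  have \<rho>: "\<rho> > 0" using assms by linarith
  define q where "q = \<bar>x\<bar> / \<rho>"
  have q: "0 \<le> q" "q < 1" using assms \<rho> by (auto simp: q_def)
  have "(\<lambda>i. real (Suc i) * q ^ i) \<longlonglongrightarrow> 0"
    using geometric_deriv_sums[of q] q by (intro summable_LIMSEQ_zero) (auto simp: sums_iff)
  then have "Bseq (\<lambda>i. real (Suc i) * q ^ i)"
    using convergentI convergent_imp_Bseq by blast
  then obtain K where K: "\<And>i. \<bar>real (Suc i) * q ^ i\<bar> \<le> K"
    unfolding Bseq_def by auto
  show ?thesis
  proof (intro exI allI)
    fix i
    have "real (Suc i) * \<bar>x\<bar> ^ i = (real (Suc i) * q ^ i) * \<rho> ^ i"
      using \<rho> by (simp add: q_def power_divide)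
    also have "\<dots> \<le> K * \<rho> ^ i"
      using K[of i] \<rho> by (intro mult_right_mono) auto
    also have "\<dots> = (K / \<rho>) * \<rho> ^ Suc i" using \<rho> by simp
    finally show "real (Suc i) * \<bar>x\<bar> ^ i \<le> (K / \<rho>) * \<rho> ^ Suc i" .
  qed
qed

text \<open>For a fixed ordinate the row sums form a power series in one variable, which is
  differentiated termwise. The double series of derivatives is summable by comparison at a larger
  abscissa, and its row sums identify the value. The second claim records that the derivative
  exists: \<open>vector_derivative\<close> denotes something also where it does not.\<close>

lemma dps_deriv_x:
  assumes f: "dps b r f" and w: "w \<in> ball 0 r"
  shows "((\<lambda>(i, j). (real (Suc i) * b (Suc i, j)) * Re w ^ i * Im w ^ j) has_sum pdx f w) UNIV"
    and "((\<lambda>t. f (w + of_real t)) has_vector_derivative pdx f w) (at 0)"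
proof -
  define x y where "x = Re w" and "y = Im w"
  have r: "r > 0" using w by (auto intro: le_less_trans[OF norm_ge_zero])
  have "(cmod w)\<^sup>2 < r\<^sup>2" using w by (intro power_strict_mono) auto
  then have xy: "x\<^sup>2 + y\<^sup>2 < r\<^sup>2" by (simp add: x_def y_def cmod_power2)
  \<comment> \<open>Room beyond \<open>x\<close> on the horizontal line at height \<open>y\<close>,
    still inside the disc.\<close>
  obtain \<rho> where \<rho>: "\<bar>x\<bar> < \<rho>" "\<rho>\<^sup>2 + y\<^sup>2 < r\<^sup>2"
  proof -
    have "\<bar>x\<bar> < sqrt (r\<^sup>2 - y\<^sup>2)" using xy by (intro real_less_rsqrt) auto
    then obtain \<rho> where "\<bar>x\<bar> < \<rho>" "\<rho> < sqrt (r\<^sup>2 - y\<^sup>2)" using dense by blast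
    moreover from this have "\<rho>\<^sup>2 < (sqrt (r\<^sup>2 - y\<^sup>2))\<^sup>2" by (intro power_strict_mono) auto
    moreover have "(sqrt (r\<^sup>2 - y\<^sup>2))\<^sup>2 = r\<^sup>2 - y\<^sup>2" using xy zero_le_power2[of x] by (intro real_sqrt_pow2) linarith
    ultimately show ?thesis using that[of \<rho>] by simp
  qed
  have \<rho>0: "\<rho> > 0" using \<rho>(1) by linarith
  define c where "c i = (\<Sum>\<^sub>\<infinity>j. b (i, j) * y ^ j)" for i
  have ser: "(\<lambda>i. c i * s ^ i) sums f (Complex s y)" if "\<bar>s\<bar> \<le> \<rho>" for s
  proof -
    have "s\<^sup>2 \<le> \<rho>\<^sup>2" using that \<rho>0 abs_le_square_iff[of s \<rho>] by simp
    then have "s\<^sup>2 + y\<^sup>2 < r\<^sup>2" using \<rho>(2) by linarith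
    then have "Complex s y \<in> ball 0 r" using real_sqrt_less_mono[of "s\<^sup>2 + y\<^sup>2" "r\<^sup>2"] r by (simp add: cmod_def)
    from bspec[OF f[unfolded dps_def] this]
    have hs: "((\<lambda>(i, j). b (i, j) * s ^ i * y ^ j) has_sum f (Complex s y)) UNIV"
      by simp
    have "(\<lambda>i. \<Sum>\<^sub>\<infinity>j. b (i, j) * s ^ i * y ^ j) sums f (Complex s y)"
      using has_sum_rows[OF hs] by simp
    also have "(\<lambda>i. \<Sum>\<^sub>\<infinity>j. b (i, j) * s ^ i * y ^ j) = (\<lambda>i. \<Sum>\<^sub>\<infinity>j. b (i, j) * y ^ j * s ^ i)"
      by (simp only: mult_ac)
    also have "\<dots> = (\<lambda>i. c i * s ^ i)"
      unfolding c_def infsum_cmult_left' ..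
    finally show ?thesis .
  qed
  define D where "D = (\<Sum>i. diffs c i * x ^ i)"
  have der: "((\<lambda>s. \<Sum>i. c i * s ^ i) has_field_derivative D) (at x)"
    unfolding D_def
  proof (rule termdiffs_strong')
    show "norm x < \<rho>" using \<rho>(1) by simp
    show "summable (\<lambda>n. c n * z ^ n)" if "norm z < \<rho>" for z
      using ser[of z] that by (auto simp: sums_iff)
  qed
  have "((\<lambda>s. f (Complex s y)) has_field_derivative D) (at x)"
  proof (rule has_field_derivative_transform_within_open[OF der])
    show "open {-\<rho><..<\<rho>}" "x \<in> {-\<rho><..<\<rho>}" using \<rho>(1) by auto
    show "(\<Sum>i. c i * s ^ i) = f (Complex s y)" if "s \<in> {-\<rho><..<\<rho>}" for s
      using ser[of s] that by (auto simp: sums_iff)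
  qed
  then have "((\<lambda>t. f (Complex (x + t) y)) has_field_derivative D) (at 0)"
    using DERIV_shift[of "\<lambda>s. f (Complex s y)" D 0 x] by (simp add: add.commute)
  moreover have "Complex (x + t) y = w + of_real t" for t by (simp add: complex_eq_iff x_def y_def)
  ultimately have vd: "((\<lambda>t. f (w + of_real t)) has_vector_derivative D) (at 0)"
    by (simp add: has_real_derivative_iff_has_vector_derivative)
  then have pd: "pdx f w = D" unfolding pdx_def by (rule vector_derivative_at)
  then show "((\<lambda>t. f (w + of_real t)) has_vector_derivative pdx f w) (at 0)" using vd by simp
  let ?F = "\<lambda>(i, j). (real (Suc i) * b (Suc i, j)) * x ^ i * y ^ j"
  obtain K where K: "\<And>i. real (Suc i) * \<bar>x\<bar> ^ i \<le> K * \<rho> ^ Suc i"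
    using ex_power_deriv_bound[OF \<rho>(1)] by blast
  have "(\<lambda>(i, j). \<bar>b (i, j)\<bar> * \<bar>\<rho>\<bar> ^ i * \<bar>y\<bar> ^ j) summable_on UNIV"
    using dps_abs_summable[OF f \<rho>(2) r] .
  then have "(\<lambda>(i, j). \<bar>b (i, j)\<bar> * \<bar>\<rho>\<bar> ^ i * \<bar>y\<bar> ^ j) summable_on range (\<lambda>(i, j). (Suc i, j))"
    by (rule summable_on_subset_banach) auto
  then have "(\<lambda>(i, j). \<bar>b (Suc i, j)\<bar> * \<rho> ^ Suc i * \<bar>y\<bar> ^ j) summable_on UNIV"
    using \<rho>0 by (subst (asm) summable_on_reindex) (auto simp: inj_on_def o_def case_prod_unfold)
  then have "(\<lambda>p. K * (\<lambda>(i, j). \<bar>b (Suc i, j)\<bar> * \<rho> ^ Suc i * \<bar>y\<bar> ^ j) p) summable_on UNIV"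
    by (rule summable_on_cmult_right)
  then have "(\<lambda>p. norm (?F p)) summable_on UNIV"
  proof (rule summable_on_comparison_test)
    fix p :: "nat \<times> nat"
    obtain i j where p: "p = (i, j)" by fastforce
    have "norm (?F p) = (real (Suc i) * \<bar>x\<bar> ^ i) * (\<bar>b (Suc i, j)\<bar> * \<bar>y\<bar> ^ j)"
      by (simp add: p abs_mult power_abs)
    also have "\<dots> \<le> (K * \<rho> ^ Suc i) * (\<bar>b (Suc i, j)\<bar> * \<bar>y\<bar> ^ j)"
      by (intro mult_right_mono K) auto
    finally show "norm (?F p) \<le> K * (\<lambda>(i, j). \<bar>b (Suc i, j)\<bar> * \<rho> ^ Suc i * \<bar>y\<bar> ^ j) p"
      by (simp add: p mult_ac)
  qed simp
  then have "?F summable_on UNIV"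
    by (rule iffD2[OF summable_on_iff_abs_summable_on_real])
  then obtain S where S: "(?F has_sum S) UNIV"
    unfolding summable_on_def by blast
  have "(\<lambda>i. \<Sum>\<^sub>\<infinity>j. ?F (i, j)) sums S" by (rule has_sum_rows[OF S])
  moreover have "(\<Sum>\<^sub>\<infinity>j. ?F (i, j)) = diffs c i * x ^ i" for i
  proof -
    have "(\<Sum>\<^sub>\<infinity>j. ?F (i, j)) = (\<Sum>\<^sub>\<infinity>j. (real (Suc i) * x ^ i) * (b (Suc i, j) * y ^ j))"
      by (simp add: mult_ac)
    also have "\<dots> = (real (Suc i) * x ^ i) * c (Suc i)"
      unfolding c_def by (rule infsum_cmult_right')
    finally show ?thesis by (simp add: diffs_def)
  qed
  ultimately have "S = D" by (simp add: D_def sums_iff)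
  then show "((\<lambda>(i, j). (real (Suc i) * b (Suc i, j)) * Re w ^ i * Im w ^ j) has_sum pdx f w) UNIV"
    using S pd by (simp add: x_def y_def)
qed

lemma dps_pdx: "dps b r f \<Longrightarrow> dps (\<lambda>(i, j). real (Suc i) * b (Suc i, j)) r (pdx f)"
  using dps_deriv_x(1) unfolding dps_def by simp

text \<open>Reflection in the diagonal exchanges the two partial derivatives, which reduces the
  vertical one to the horizontal one.\<close>

lemma dps_swap:
  assumes "dps b r f"
  shows "dps (\<lambda>(i, j). b (j, i)) r (\<lambda>w. f (Complex (Im w) (Re w)))"
  unfolding dps_def
proof
  fix w :: complex assume "w \<in> ball 0 r"
  then have "Complex (Im w) (Re w) \<in> ball 0 r" by (simp add: cmod_def add.commute)
  from bspec[OF assms[unfolded dps_def] this]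
  have "((\<lambda>(i, j). b (i, j) * Im w ^ i * Re w ^ j) has_sum f (Complex (Im w) (Re w))) (range prod.swap)"
    by simp
  then show "((\<lambda>(i, j). (case (i, j) of (i, j) \<Rightarrow> b (j, i)) * Re w ^ i * Im w ^ j) has_sum f (Complex (Im w) (Re w))) UNIV"
    by (subst (asm) has_sum_reindex) (auto simp: o_def case_prod_unfold prod.swap_def mult_ac)
qed

lemma dps_deriv_y:
  assumes f: "dps b r f" and w: "w \<in> ball 0 r"
  shows "((\<lambda>(i, j). (real (Suc j) * b (i, Suc j)) * Re w ^ i * Im w ^ j) has_sum pdy f w) UNIV"
    and "((\<lambda>t. f (w + of_real t * \<i>)) has_vector_derivative pdy f w) (at 0)"
proof -
  let ?g = "\<lambda>w. f (Complex (Im w) (Re w))" and ?v = "Complex (Im w) (Re w)"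
  have v: "?v \<in> ball 0 r" using w by (simp add: cmod_def add.commute)
  have "Complex (Im (?v + complex_of_real t)) (Re (?v + complex_of_real t)) = w + of_real t * \<i>" for t
    by (simp add: complex_eq_iff)
  then have e: "(\<lambda>t. ?g (?v + of_real t)) = (\<lambda>t. f (w + of_real t * \<i>))" by simp
  then have pd: "pdx ?g ?v = pdy f w" by (simp add: pdx_def pdy_def)
  show "((\<lambda>t. f (w + of_real t * \<i>)) has_vector_derivative pdy f w) (at 0)"
    using dps_deriv_x(2)[OF dps_swap[OF f] v] unfolding e pd .
  have "((\<lambda>(i, j). (real (Suc i) * b (j, Suc i)) * Im w ^ i * Re w ^ j) has_sum pdy f w) (range prod.swap)"
    using dps_deriv_x(1)[OF dps_swap[OF f] v] unfolding pd by simp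
  then show "((\<lambda>(i, j). (real (Suc j) * b (i, Suc j)) * Re w ^ i * Im w ^ j) has_sum pdy f w) UNIV"
    by (subst (asm) has_sum_reindex) (auto simp: o_def case_prod_unfold prod.swap_def mult_ac)
qed

lemma dps_pdy: "dps b r f \<Longrightarrow> dps (\<lambda>(i, j). real (Suc j) * b (i, Suc j)) r (pdy f)"
  using dps_deriv_y(1) unfolding dps_def by simp

lemma dps_0:
  assumes "dps b r f" "r > 0"
  shows "f 0 = b (0, 0)"
proof -
  have "(0::complex) \<in> ball 0 r" using assms(2) by simp
  from bspec[OF assms(1)[unfolded dps_def] this]
  have 1: "((\<lambda>(i, j). b (i, j) * 0 ^ i * 0 ^ j) has_sum f 0) UNIV" by simp
  have 2: "((\<lambda>(i, j). b (i, j) * 0 ^ i * 0 ^ j) has_sum b (0, 0)) UNIV"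
    by (rule has_sum_finite_neutralI[of "{(0, 0)}"]) (auto simp: power_0_left split: if_splits)
  show ?thesis by (rule has_sum_unique[OF 1 2])
qed

lemma dps_pdy_funpow:
  "dps b r f \<Longrightarrow> dps (\<lambda>(i, j). fact (j + m) / fact j * b (i, j + m)) r ((pdy ^^ m) f)"
proof (induction m)
  case (Suc m)
  have "(\<lambda>(i, j). real (Suc j) * (\<lambda>(i, j). fact (j + m) / fact j * b (i, j + m)) (i, Suc j))
    = (\<lambda>(i, j). fact (j + Suc m) / fact j * b (i, j + Suc m))"
    by (auto simp: fun_eq_iff field_simps simp del: of_nat_Suc)
  then show ?case using dps_pdy[OF Suc.IH[OF Suc.prems]] by simp
qed (simp add: case_prod_unfold)

lemma dps_pdx_funpow:
  "dps b r f \<Longrightarrow> dps (\<lambda>(i, j). fact (i + m) / fact i * b (i + m, j)) r ((pdx ^^ m) f)"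
proof (induction m)
  case (Suc m)
  have "(\<lambda>(i, j). real (Suc i) * (\<lambda>(i, j). fact (i + m) / fact i * b (i + m, j)) (Suc i, j))
    = (\<lambda>(i, j). fact (i + Suc m) / fact i * b (i + Suc m, j))"
    by (auto simp: fun_eq_iff field_simps simp del: of_nat_Suc)
  then show ?case using dps_pdx[OF Suc.IH[OF Suc.prems]] by simp
qed (simp add: case_prod_unfold)

lemma taylor0_dps:
  assumes "dps b r f" "r > 0"
  shows "taylor0 m f w = (\<Sum>i\<le>m. \<Sum>j\<le>m - i. b (i, j) * Re w ^ i * Im w ^ j)"
proof -
  have "(pdx ^^ i) ((pdy ^^ j) f) 0 = fact i * fact j * b (i, j)" for i j
    using dps_0[OF dps_pdx_funpow[OF dps_pdy_funpow[OF assms(1)]] assms(2)] by simp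
  then show ?thesis by (simp add: taylor0_def)
qed

lemma has_vector_derivative_eventually_eq:
  assumes "(f has_vector_derivative D) (at x)" "eventually (\<lambda>t. f t = g t) (nhds x)"
  shows "(g has_vector_derivative D) (at x)"
proof -
  have "f x = g x" using assms(2) by (rule eventually_nhds_x_imp_x)
  with assms(2) have "(f has_vector_derivative D) (at x) = (g has_vector_derivative D) (at x)"
    by (intro has_vector_derivative_cong_ev) auto
  then show ?thesis using assms(1) by simp
qed

text \<open>The mixed second derivatives enter only the imaginary part of
  \<open>wirt (wirt_bar f)\<close>. Its real part is a quarter of the sum of the two pure second
  derivatives, without appeal to the symmetry of the mixed ones.\<close>

lemma lap_dps:
  assumes f: "dps b r f"
  shows "dps (\<lambda>(i, j). (real (Suc (Suc i)) * real (Suc i) * b (Suc (Suc i), j)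
    + real (Suc (Suc j)) * real (Suc j) * b (i, Suc (Suc j))) / 4) r (lap f)"
proof -
  let ?F = "\<lambda>w. complex_of_real (f w)"
  have fx: "dps (\<lambda>(i, j). real (Suc i) * b (Suc i, j)) r (pdx f)"
    and fy: "dps (\<lambda>(i, j). real (Suc j) * b (i, Suc j)) r (pdy f)"
    using dps_pdx[OF f] dps_pdy[OF f] .
  have ofr: "((\<lambda>t. complex_of_real (g t)) has_vector_derivative complex_of_real d) F"
    if "(g has_vector_derivative d) F" for g d F
    using bounded_linear.has_vector_derivative[OF bounded_linear_of_real that] .
  have wb: "wirt_bar ?F w = (of_real (pdx f w) + \<i> * of_real (pdy f w)) / 2" if w: "w \<in> ball 0 r" for w
    unfolding wirt_bar_def pdx_def[of ?F] pdy_def[of ?F]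
    by (simp add: vector_derivative_at[OF ofr[OF dps_deriv_x(2)[OF f w]]]
        vector_derivative_at[OF ofr[OF dps_deriv_y(2)[OF f w]]])
  let ?G = "\<lambda>w. (of_real (pdx f w) + \<i> * of_real (pdy f w)) / (2 :: complex)"
  have lap: "lap f w = (pdx (pdx f) w + pdy (pdy f) w) / 4" if w: "w \<in> ball 0 r" for w
  proof -
    \<comment> \<open>The formula for \<open>wirt_bar\<close> is known in the disc only; that
      suffices because a derivative at \<open>w\<close> depends on nearby points alone.\<close>
    have near: "eventually (\<lambda>t. w + of_real t * u \<in> ball 0 r) (nhds (0::real))" for u
    proof -
      have "open ((\<lambda>t::real. w + of_real t * u) -` ball 0 r)"
        by (intro open_vimage continuous_intros open_ball)
      from eventually_nhds_in_open[OF this, of 0] show ?thesis using w by simp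
    qed
    have "((\<lambda>t. ?G (w + of_real t)) has_vector_derivative
        (of_real (pdx (pdx f) w) + \<i> * of_real (pdx (pdy f) w)) / 2) (at 0)"
      by (intro derivative_intros has_vector_derivative_divide ofr dps_deriv_x(2)[OF fx w] dps_deriv_x(2)[OF fy w])
    moreover have "eventually (\<lambda>t. ?G (w + of_real t) = wirt_bar ?F (w + of_real t)) (nhds 0)"
      using near[of 1] by eventually_elim (simp add: wb)
    ultimately have "((\<lambda>t. wirt_bar ?F (w + of_real t)) has_vector_derivative
        (of_real (pdx (pdx f) w) + \<i> * of_real (pdx (pdy f) w)) / 2) (at 0)"
      by (rule has_vector_derivative_eventually_eq)
    then have 1: "pdx (wirt_bar ?F) w = (of_real (pdx (pdx f) w) + \<i> * of_real (pdx (pdy f) w)) / 2"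
      unfolding pdx_def[of "wirt_bar ?F"] by (rule vector_derivative_at)
    have "((\<lambda>t. ?G (w + of_real t * \<i>)) has_vector_derivative
        (of_real (pdy (pdx f) w) + \<i> * of_real (pdy (pdy f) w)) / 2) (at 0)"
      by (intro derivative_intros has_vector_derivative_divide ofr dps_deriv_y(2)[OF fx w] dps_deriv_y(2)[OF fy w])
    moreover have "eventually (\<lambda>t. ?G (w + of_real t * \<i>) = wirt_bar ?F (w + of_real t * \<i>)) (nhds 0)"
      using near[of \<i>] by eventually_elim (simp add: wb)
    ultimately have "((\<lambda>t. wirt_bar ?F (w + of_real t * \<i>)) has_vector_derivative
        (of_real (pdy (pdx f) w) + \<i> * of_real (pdy (pdy f) w)) / 2) (at 0)"
      by (rule has_vector_derivative_eventually_eq)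
    then have 2: "pdy (wirt_bar ?F) w = (of_real (pdy (pdx f) w) + \<i> * of_real (pdy (pdy f) w)) / 2"
      unfolding pdy_def[of "wirt_bar ?F"] by (rule vector_derivative_at)
    show ?thesis unfolding lap_def wirt_def 1 2 by simp
  qed
  show ?thesis
    unfolding dps_def
  proof
    fix w :: complex assume w: "w \<in> ball 0 r"
    have xx: "((\<lambda>(i, j). (real (Suc i) * (real (Suc (Suc i)) * b (Suc (Suc i), j))) * Re w ^ i * Im w ^ j) has_sum pdx (pdx f) w) UNIV"
      using dps_deriv_x(1)[OF fx w] by simp
    have yy: "((\<lambda>(i, j). (real (Suc j) * (real (Suc (Suc j)) * b (i, Suc (Suc j)))) * Re w ^ i * Im w ^ j) has_sum pdy (pdy f) w) UNIV"
      using dps_deriv_y(1)[OF fy w] by simp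
    have "((\<lambda>p. (1/4) * ((\<lambda>(i, j). (real (Suc i) * (real (Suc (Suc i)) * b (Suc (Suc i), j))) * Re w ^ i * Im w ^ j) p
      + (\<lambda>(i, j). (real (Suc j) * (real (Suc (Suc j)) * b (i, Suc (Suc j)))) * Re w ^ i * Im w ^ j) p))
      has_sum (1/4) * (pdx (pdx f) w + pdy (pdy f) w)) UNIV"
      by (intro has_sum_cmult_right has_sum_add xx yy)
    also have "(1/4) * (pdx (pdx f) w + pdy (pdy f) w) = lap f w" using lap[OF w] by simp
    finally show "((\<lambda>(i, j). (\<lambda>(i, j). (real (Suc (Suc i)) * real (Suc i) * b (Suc (Suc i), j)
        + real (Suc (Suc j)) * real (Suc j) * b (i, Suc (Suc j))) / 4) (i, j) * Re w ^ i * Im w ^ j) has_sum lap f w) UNIV"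
      by (rule has_sum_cong[THEN iffD1, rotated]) (auto simp: field_simps)
  qed
qed

section \<open>Homogeneous and harmonic forms\<close>

lemma sum_triangle: "(\<Sum>i\<le>m. \<Sum>j\<le>m - i. g i j) = (\<Sum>n\<le>m. \<Sum>i\<le>n. g i (n - i))" for m :: nat
proof -
  have "(\<Sum>i\<le>m. \<Sum>j\<le>m - i. g i j) = (\<Sum>(i, j)\<in>Sigma {..m} (\<lambda>i. {..m - i}). g i j)"
    by (simp add: sum.Sigma)
  also have "Sigma {..m} (\<lambda>i. {..m - i}) = {(i, j). i + j \<le> m}" by auto
  finally show ?thesis by (simp add: sum.triangle_reindex_eq)
qed

text \<open>Along a ray both sides of the homogeneity relation are polynomials in \<open>t\<close>;
  comparing coefficients kills every form of degree below \<open>m\<close>. Setting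
  \<open>y = 1\<close> turns such a form into a polynomial in \<open>x\<close> that vanishes
  identically.\<close>

lemma homogeneous_coeffs_eq_0:
  assumes hom: "homogeneous m (\<lambda>w. \<Sum>i\<le>m. \<Sum>j\<le>m - i. d (i, j) * Re w ^ i * Im w ^ j)"
    and ij: "i + j < m"
  shows "d (i, j) = 0"
proof -
  define A where "A n x y = (\<Sum>i\<le>n. d (i, n - i) * x ^ i * y ^ (n - i))" for n and x y :: real
  define f where "f = (\<lambda>w. \<Sum>i\<le>m. \<Sum>j\<le>m - i. d (i, j) * Re w ^ i * Im w ^ j)"
  have f: "f w = (\<Sum>n\<le>m. A n (Re w) (Im w))" for w
    unfolding f_def sum_triangle A_def ..
  have scale: "A n (t * x) (t * y) = A n x y * t ^ n" for n t x y
    unfolding A_def sum_distrib_right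
    by (intro sum.cong refl) (auto simp: power_mult_distrib mult_ac simp flip: power_add)
  have z: "A n x y = 0" if n: "n < m" for n x y
  proof -
    define B where "B n = (if n = m then f (Complex x y) else 0)" for n
    have "(\<Sum>n\<le>m. A n x y * t ^ n) = (\<Sum>n\<le>m. B n * t ^ n)" for t
    proof -
      have "(\<Sum>n\<le>m. A n x y * t ^ n) = f (of_real t * Complex x y)"
        by (simp add: f scale)
      also have "\<dots> = t ^ m * f (Complex x y)"
        using hom unfolding homogeneous_def f_def by blast
      also have "\<dots> = (\<Sum>n\<le>m. B n * t ^ n)"
        unfolding B_def by (simp add: if_distrib[of "\<lambda>x. x * _"] cong: if_cong)
      finally show ?thesis .
    qed
    then have "\<forall>n\<le>m. A n x y = B n"
      using polyfun_eq_coeffs[of "\<lambda>n. A n x y" m B] by blast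
    then show ?thesis using n by (simp add: B_def)
  qed
  have "(\<Sum>l\<le>i + j. d (l, i + j - l) * x ^ l) = 0" for x
    using z[OF ij, of x 1] by (simp add: A_def)
  then have "\<forall>l\<le>i + j. d (l, i + j - l) = 0"
    using Transcendental.polyfun_eq_0[of "\<lambda>l. d (l, i + j - l)" "i + j"] by blast
  then show ?thesis by (metis add_diff_cancel_left' le_add1)
qed

text \<open>Laplace's equation ties coefficients two places apart, so a harmonic form is fixed by
  those of \<open>x^n\<close> and \<open>x^(n-1) y\<close>. The real and imaginary part of
  \<open>g\<close> fit these two, and \<open>Re (g w^n)\<close> obeys the same recursion.\<close>

lemma harmonic_form_eq_Re:
  fixes b :: "nat \<times> nat \<Rightarrow> real"
  assumes harm: "\<And>i j. i + j + 2 = n \<Longrightarrow>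
    real (Suc (Suc i)) * real (Suc i) * b (Suc (Suc i), j) + real (Suc (Suc j)) * real (Suc j) * b (i, Suc (Suc j)) = 0"
  shows "\<exists>g. \<forall>w. (\<Sum>i\<le>n. b (i, n - i) * Re w ^ i * Im w ^ (n - i)) = Re (g * w ^ n)"
proof (cases "n = 0")
  case True
  then show ?thesis by (intro exI[of _ "of_real (b (0, 0))"]) simp
next
  case False
  \<comment> \<open>The coefficient of \<open>x^(n-j) y^j\<close> in \<open>Re (g w^n)\<close> is
    \<open>n choose j\<close> times \<open>Re (g \<i>^j)\<close>; for \<open>j = 0\<close> and
    \<open>j = 1\<close> this is \<open>Re g\<close> and \<open>- n Im g\<close>.\<close>
  define g where "g = Complex (b (n, 0)) (- b (n - 1, 1) / real n)"
  have coef: "real (n choose j) * Re (g * \<i> ^ j) = b (n - j, j)" if "j \<le> n" for j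
    using that
  proof (induction j rule: induct_nat_012)
    case 0
    show ?case by (simp add: g_def)
  next
    case 1
    then show ?case using False by (simp add: g_def)
  next
    case (ge2 j)
    define i where "i = n - Suc (Suc j)"
    have n: "n = i + j + 2" using ge2.prems by (simp add: i_def)
    have IH: "real (n choose j) * Re (g * \<i> ^ j) = b (Suc (Suc i), j)"
      using ge2.IH(1) ge2.prems n by simp
    \<comment> \<open>From \<open>j\<close> to \<open>j + 2\<close> the binomial coefficient changes
      by the ratio that Laplace's equation prescribes; the sign is supplied by
      \<open>\<i>^2 = -1\<close>.\<close>
    have ch: "real (Suc (Suc j)) * real (Suc j) * real (n choose Suc (Suc j)) = real (Suc (Suc i)) * real (Suc i) * real (n choose j)"
    proof -
      have "Suc j * (n choose Suc j) = (n - j) * (n choose j)"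
        by (metis binomial_absorb_comp binomial_absorption mult.commute)
      moreover have "Suc (Suc j) * (n choose Suc (Suc j)) = (n - Suc j) * (n choose Suc j)"
        by (metis binomial_absorb_comp binomial_absorption mult.commute)
      moreover have "n - j = Suc (Suc i)" "n - Suc j = Suc i" using n by auto
      ultimately have "Suc (Suc j) * Suc j * (n choose Suc (Suc j)) = Suc (Suc i) * Suc i * (n choose j)"
        by (metis (no_types, opaque_lifting) mult.assoc mult.commute)
      then show ?thesis by (metis of_nat_mult)
    qed
    have "real (Suc (Suc j)) * real (Suc j) * (real (n choose Suc (Suc j)) * Re (g * \<i> ^ Suc (Suc j)))
      = - (real (Suc (Suc i)) * real (Suc i) * (real (n choose j) * Re (g * \<i> ^ j)))"
      using ch by (simp add: algebra_simps del: of_nat_Suc)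
    also have "\<dots> = real (Suc (Suc j)) * real (Suc j) * b (i, Suc (Suc j))"
      unfolding IH using harm[of i j] n by (simp del: of_nat_Suc)
    finally have "real (n choose Suc (Suc j)) * Re (g * \<i> ^ Suc (Suc j)) = b (i, Suc (Suc j))"
      by (simp del: of_nat_Suc power_Suc)
    then show ?case by (simp add: i_def)
  qed
  show ?thesis
  proof (intro exI allI)
    fix w :: complex
    have ofr: "Re (complex_of_real r * z) = r * Re z" for r z by simp
    have "w ^ n = (\<i> * of_real (Im w) + of_real (Re w)) ^ n"
      by (simp add: complex_eq[of w, symmetric] add.commute)
    also have "\<dots> = (\<Sum>j\<le>n. of_nat (n choose j) * (\<i> * of_real (Im w)) ^ j * of_real (Re w) ^ (n - j))"
      by (rule binomial_ring)
    finally have "g * w ^ n = (\<Sum>j\<le>n. of_real (real (n choose j) * Im w ^ j * Re w ^ (n - j)) * (g * \<i> ^ j))"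
      by (simp add: sum_distrib_left power_mult_distrib mult_ac)
    then have "Re (g * w ^ n) = (\<Sum>j\<le>n. Re (of_real (real (n choose j) * Im w ^ j * Re w ^ (n - j)) * (g * \<i> ^ j)))"
      by simp
    also have "\<dots> = (\<Sum>j\<le>n. (real (n choose j) * Re (g * \<i> ^ j)) * Im w ^ j * Re w ^ (n - j))"
      by (intro sum.cong refl) (subst ofr, simp only: mult_ac)
    also have "\<dots> = (\<Sum>j\<le>n. b (n - j, j) * Im w ^ j * Re w ^ (n - j))"
      by (intro sum.cong refl) (simp only: coef atMost_iff)
    also have "\<dots> = (\<Sum>i\<le>n. b (i, n - i) * Re w ^ i * Im w ^ (n - i))"
      by (rule sum.reindex_bij_witness[of _ "\<lambda>i. n - i" "\<lambda>i. n - i"]) (auto simp: mult_ac)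
    finally show "(\<Sum>i\<le>n. b (i, n - i) * Re w ^ i * Im w ^ (n - i)) = Re (g * w ^ n)" ..
  qed
qed

text \<open>A monomial of degree at least \<open>m + 1\<close> at \<open>w\<close> is at most
  \<open>(|w| / \<delta>)^(m+1)\<close> times its value at the point
  \<open>(\<delta>, \<delta>)\<close>, where the series converges absolutely.\<close>

lemma dps_tail_bound:
  assumes f: "dps b r f" and r: "r > 0"
  obtains C \<delta> where "\<delta> > 0" "C \<ge> 0" "\<delta> \<le> r"
    "\<And>w. cmod w < \<delta> \<Longrightarrow> \<bar>f w - (\<Sum>i\<le>m. \<Sum>j\<le>m - i. b (i, j) * Re w ^ i * Im w ^ j)\<bar> \<le> C * cmod w ^ Suc m"
proof -
  \<comment> \<open>With half the radius, \<open>2 \<delta>^2 < r^2\<close> keeps the corner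
    \<open>(\<delta>, \<delta>)\<close> inside the disc.\<close>
  define \<delta> where "\<delta> = r / 2"
  have \<delta>: "\<delta> > 0" using r by (simp add: \<delta>_def)
  have "\<delta>\<^sup>2 + \<delta>\<^sup>2 < r\<^sup>2" using r by (simp add: \<delta>_def power2_eq_square)
  then have summ: "(\<lambda>(i, j). \<bar>b (i, j)\<bar> * \<delta> ^ i * \<delta> ^ j) summable_on UNIV"
    using dps_abs_summable[OF f _ r, of \<delta> \<delta>] \<delta> by simp
  define I where "I = {(i, j). i + j \<le> m}"
  define S where "S = (\<Sum>\<^sub>\<infinity>(i, j)\<in>-I. \<bar>b (i, j)\<bar> * \<delta> ^ i * \<delta> ^ j)"
  have summI: "(\<lambda>(i, j). \<bar>b (i, j)\<bar> * \<delta> ^ i * \<delta> ^ j) summable_on - I"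
    by (rule summable_on_subset_banach[OF summ]) simp
  have "S \<ge> 0" unfolding S_def using \<delta> by (intro infsum_nonneg) auto
  have Sig: "Sigma {..m} (\<lambda>i. {..m - i}) = I" by (auto simp: I_def)
  then have finI: "finite I" by (metis finite_SigmaI finite_atMost)
  show ?thesis
  proof (rule that[of \<delta> "S / \<delta> ^ Suc m"])
    fix w :: complex assume w: "cmod w < \<delta>"
    let ?F = "\<lambda>(i, j). b (i, j) * Re w ^ i * Im w ^ j"
    have "w \<in> ball 0 r" using w r by (simp add: \<delta>_def)
    from bspec[OF f[unfolded dps_def] this] have hs: "(?F has_sum f w) UNIV" .
    have "(?F has_sum (\<Sum>p\<in>I. ?F p)) I" using finI by (rule has_sum_finite)
    from has_sum_Diff[OF hs this] have d: "(?F has_sum (f w - (\<Sum>p\<in>I. ?F p))) (- I)"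
      by (simp add: Compl_eq_Diff_UNIV)
    have le: "norm (?F p) \<le> (cmod w / \<delta>) ^ Suc m * (\<lambda>(i, j). \<bar>b (i, j)\<bar> * \<delta> ^ i * \<delta> ^ j) p" if "p \<in> - I" for p
    proof -
      obtain i j where p: "p = (i, j)" by fastforce
      have ij: "Suc m \<le> i + j" using that by (simp add: p I_def)
      have q: "0 \<le> cmod w / \<delta>" "cmod w / \<delta> \<le> 1" using w \<delta> by auto
      have "norm (?F p) = \<bar>b (i, j)\<bar> * (\<bar>Re w\<bar> ^ i * \<bar>Im w\<bar> ^ j)"
        by (simp add: p abs_mult power_abs)
      also have "\<dots> \<le> \<bar>b (i, j)\<bar> * (cmod w ^ i * cmod w ^ j)"
        by (intro mult_left_mono mult_mono power_mono abs_Re_le_cmod abs_Im_le_cmod) auto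
      also have "\<dots> = (cmod w / \<delta>) ^ (i + j) * (\<bar>b (i, j)\<bar> * \<delta> ^ i * \<delta> ^ j)"
        using \<delta> by (simp add: power_add power_divide)
      also have "\<dots> \<le> (cmod w / \<delta>) ^ Suc m * (\<bar>b (i, j)\<bar> * \<delta> ^ i * \<delta> ^ j)"
        using \<delta> by (intro mult_right_mono power_decreasing ij q) auto
      finally show ?thesis by (simp add: p)
    qed
    have "norm (f w - (\<Sum>p\<in>I. ?F p)) \<le> (cmod w / \<delta>) ^ Suc m * S"
    proof -
      have hsS: "((\<lambda>p. (cmod w / \<delta>) ^ Suc m * (\<lambda>(i, j). \<bar>b (i, j)\<bar> * \<delta> ^ i * \<delta> ^ j) p)
          has_sum ((cmod w / \<delta>) ^ Suc m * S)) (- I)"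
        unfolding S_def by (intro has_sum_cmult_right has_sum_infsum summI)
      have d': "((\<lambda>p. - ?F p) has_sum - (f w - (\<Sum>p\<in>I. ?F p))) (- I)"
        by (rule has_sum_uminus[THEN iffD2]) (simp only: minus_minus d)
      have "f w - (\<Sum>p\<in>I. ?F p) \<le> (cmod w / \<delta>) ^ Suc m * S"
        by (rule has_sum_mono[OF d hsS]) (use le in \<open>force simp: abs_le_iff\<close>)
      moreover have "- (f w - (\<Sum>p\<in>I. ?F p)) \<le> (cmod w / \<delta>) ^ Suc m * S"
        by (rule has_sum_mono[OF d' hsS]) (use le in \<open>force simp: abs_le_iff\<close>)
      ultimately show ?thesis by (simp add: abs_le_iff)
    qed
    then show "\<bar>f w - (\<Sum>i\<le>m. \<Sum>j\<le>m - i. b (i, j) * Re w ^ i * Im w ^ j)\<bar> \<le> S / \<delta> ^ Suc m * cmod w ^ Suc m"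
      by (simp add: sum.Sigma Sig power_divide mult_ac)
  qed (use \<delta> \<open>S \<ge> 0\<close> r in \<open>auto simp: \<delta>_def\<close>)
qed

text \<open>\<open>T\<close> is the whole form of degree 2k, harmonic part included, so it may
  differ from \<open>Q0_part\<close> by the real part of a monomial. Continuity and homogeneity of
  \<open>T\<close> are all that the scaling argument asks for, and \<open>G\<close> stops at degree
  2k - 1.\<close>

lemma analytic_local_expansion:
  assumes Q: "real_analytic_at Q 0" and k: "k \<ge> 1"
    and hom: "homogeneous (2*k - 2) (taylor0 (2*k - 2) (lap Q))"
  obtains G :: "complex poly" and T :: "complex \<Rightarrow> real" and C \<delta> where
    "\<delta> > 0" "C \<ge> 0" "continuous_on UNIV T" "\<And>t z. T (of_real t * z) = t ^ (2*k) * T z"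
    "\<And>w. cmod w < \<delta> \<Longrightarrow> \<bar>Q w - Re (poly G w) - T w\<bar> \<le> C * cmod w ^ Suc (2*k)"
proof -
  obtain b r where r: "r > 0" and b: "dps b r Q"
    using Q unfolding real_analytic_at_def dps_def by auto
  define d where "d = (\<lambda>(i, j). (real (Suc (Suc i)) * real (Suc i) * b (Suc (Suc i), j)
    + real (Suc (Suc j)) * real (Suc j) * b (i, Suc (Suc j))) / 4)"
  have "dps d r (lap Q)" unfolding d_def by (rule lap_dps[OF b])
  then have tay: "taylor0 (2*k - 2) (lap Q) = (\<lambda>w. \<Sum>i\<le>2*k - 2. \<Sum>j\<le>2*k - 2 - i. d (i, j) * Re w ^ i * Im w ^ j)"
    using r by (intro ext taylor0_dps)
  have d0: "d (i, j) = 0" if "i + j < 2*k - 2" for i j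
    by (rule homogeneous_coeffs_eq_0[OF hom[unfolded tay] that])
  have "\<exists>g. \<forall>w. (\<Sum>i\<le>n. b (i, n - i) * Re w ^ i * Im w ^ (n - i)) = Re (g * w ^ n)" if "n < 2*k" for n
  proof (rule harmonic_form_eq_Re)
    fix i j assume "i + j + 2 = n"
    then have "d (i, j) = 0" using that k by (intro d0) simp
    then show "real (Suc (Suc i)) * real (Suc i) * b (Suc (Suc i), j) + real (Suc (Suc j)) * real (Suc j) * b (i, Suc (Suc j)) = 0"
      by (simp add: d_def)
  qed
  then obtain g where g: "\<And>n w. n < 2*k \<Longrightarrow> (\<Sum>i\<le>n. b (i, n - i) * Re w ^ i * Im w ^ (n - i)) = Re (g n * w ^ n)"
    by metis
  define G where "G = (\<Sum>n<2*k. monom (g n) n)"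
  define T where "T = (\<lambda>w. \<Sum>i\<le>2*k. b (i, 2*k - i) * Re w ^ i * Im w ^ (2*k - i))"
  have exp: "(\<Sum>i\<le>2*k. \<Sum>j\<le>2*k - i. b (i, j) * Re w ^ i * Im w ^ j) = Re (poly G w) + T w" for w
  proof -
    have split: "sum f {..m} = sum f {..<m} + f m" for f :: "nat \<Rightarrow> real" and m
      by (simp add: lessThan_Suc_atMost[symmetric])
    have "(\<Sum>i\<le>2*k. \<Sum>j\<le>2*k - i. b (i, j) * Re w ^ i * Im w ^ j)
      = (\<Sum>n\<le>2*k. \<Sum>i\<le>n. b (i, n - i) * Re w ^ i * Im w ^ (n - i))"
      by (rule sum_triangle)
    also have "\<dots> = (\<Sum>n<2*k. \<Sum>i\<le>n. b (i, n - i) * Re w ^ i * Im w ^ (n - i)) + T w"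
      unfolding T_def by (rule split)
    also have "(\<Sum>n<2*k. \<Sum>i\<le>n. b (i, n - i) * Re w ^ i * Im w ^ (n - i)) = (\<Sum>n<2*k. Re (g n * w ^ n))"
      by (intro sum.cong refl g) simp
    also have "\<dots> = Re (poly G w)" by (simp add: G_def poly_sum poly_monom)
    finally show ?thesis .
  qed
  obtain C \<delta> where C: "\<delta> > 0" "C \<ge> 0" "\<delta> \<le> r"
    "\<And>w. cmod w < \<delta> \<Longrightarrow> \<bar>Q w - (\<Sum>i\<le>2*k. \<Sum>j\<le>2*k - i. b (i, j) * Re w ^ i * Im w ^ j)\<bar> \<le> C * cmod w ^ Suc (2*k)"
    by (rule dps_tail_bound[OF b r, of "2*k"]) blast
  show ?thesis
  proof (rule that[of \<delta> C T G])
    show "continuous_on UNIV T" unfolding T_def by (intro continuous_intros)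
    show "T (of_real t * z) = t ^ (2*k) * T z" for t z
      unfolding T_def sum_distrib_left
      by (intro sum.cong refl) (auto simp: power_mult_distrib mult_ac simp flip: power_add)
    show "\<bar>Q w - Re (poly G w) - T w\<bar> \<le> C * cmod w ^ Suc (2*k)" if "cmod w < \<delta>" for w
      using C(4)[OF that] unfolding exp by (simp add: algebra_simps)
  qed (use C in auto)
qed

section \<open>Integrability of polynomials against the weight\<close>

lemma nn_integral_compact_finite:
  fixes f :: "'a::euclidean_space \<Rightarrow> ennreal"
  assumes K: "compact K" and f [measurable]: "f \<in> borel_measurable borel"
    and loc: "\<And>x. x \<in> K \<Longrightarrow> \<exists>r>0. (\<integral>\<^sup>+z\<in>ball x r. f z \<partial>lborel) < \<infinity>"
  shows "(\<integral>\<^sup>+z\<in>K. f z \<partial>lborel) < \<infinity>"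
proof -
  obtain r where r: "\<And>x. x \<in> K \<Longrightarrow> r x > 0" "\<And>x. x \<in> K \<Longrightarrow> (\<integral>\<^sup>+z\<in>ball x (r x). f z \<partial>lborel) < \<infinity>"
    using loc by metis
  obtain D where D: "D \<subseteq> K" "finite D" "K \<subseteq> (\<Union>x\<in>D. ball x (r x))"
  proof (rule compactE_image[OF K, of K "\<lambda>x. ball x (r x)"])
    show "K \<subseteq> (\<Union>x\<in>K. ball x (r x))" using r(1) by force
  qed auto
  have "(\<integral>\<^sup>+z\<in>K. f z \<partial>lborel) \<le> (\<integral>\<^sup>+z. (\<Sum>x\<in>D. f z * indicator (ball x (r x)) z) \<partial>lborel)"
  proof (intro nn_integral_mono)
    fix z
    show "f z * indicator K z \<le> (\<Sum>x\<in>D. f z * indicator (ball x (r x)) z)"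
    proof (cases "z \<in> K")
      case True
      then obtain x where x: "x \<in> D" "z \<in> ball x (r x)" using D(3) by blast
      have "f z * indicator (ball x (r x)) z \<le> (\<Sum>x\<in>D. f z * indicator (ball x (r x)) z)"
        using D(2) x(1) by (intro member_le_sum) auto
      then show ?thesis using x(2) True by simp
    qed simp
  qed
  also have "\<dots> = (\<Sum>x\<in>D. \<integral>\<^sup>+z\<in>ball x (r x). f z \<partial>lborel)"
    using f by (intro nn_integral_sum borel_measurable_times_ennreal borel_measurable_indicator) auto
  also have "\<dots> < \<infinity>" using D r(2) by (simp add: subset_iff)
  finally show ?thesis .
qed

text \<open>The points are distinct, so at most one charge sits at \<open>x\<close>. It supplies the
  exponent \<open>g\<close>, with \<open>g = 0\<close> if there is none, and the other logarithms
  are continuous at \<open>x\<close>.\<close>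

lemma log_sum_local_bound:
  fixes b :: "nat \<Rightarrow> complex"
  assumes inj: "inj_on b {..s}" and \<gamma>: "\<And>j. j \<le> s \<Longrightarrow> \<gamma> j > -1"
  shows "\<exists>g>-1. \<exists>C. \<forall>\<^sub>F z in at x. (\<Sum>j\<le>s. 2 * \<gamma> j * ln (cmod (z - b j))) \<le> 2 * g * ln (cmod (z - x)) + C"
proof -
  define J where "J = {j\<in>{..s}. b j \<noteq> x}"
  define L where "L = (\<lambda>z. \<Sum>j\<in>J. 2 * \<gamma> j * ln (cmod (z - b j)))"
  have "(L \<longlongrightarrow> L x) (at x)"
    unfolding L_def by (intro tendsto_intros) (auto simp: J_def)
  then have ev: "\<forall>\<^sub>F z in at x. L z < L x + 1"
    by (rule order_tendstoD) simp
  have split: "(\<Sum>j\<le>s. 2 * \<gamma> j * ln (cmod (z - b j))) = L z + (\<Sum>j\<in>{j\<in>{..s}. b j = x}. 2 * \<gamma> j * ln (cmod (z - b j)))" for z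
    unfolding L_def J_def
    by (subst sum.union_disjoint[symmetric]) (auto intro!: sum.cong)
  show ?thesis
  proof (cases "\<exists>i\<le>s. b i = x")
    case True
    then obtain i where i: "i \<le> s" "b i = x" by blast
    then have "{j\<in>{..s}. b j = x} = {i}" using inj by (auto simp: inj_on_def)
    then show ?thesis
      using \<gamma>[OF i(1)] ev i(2)
      by (intro exI[of _ "\<gamma> i"] conjI exI[of _ "L x + 1"]) (auto simp: split elim!: eventually_mono)
  next
    case False
    then have "{j\<in>{..s}. b j = x} = {}" by auto
    then show ?thesis
      using ev by (intro exI[of _ 0] conjI exI[of _ "L x + 1"]) (auto simp: split elim!: eventually_mono simp del: Collect_empty_eq)
  qed
qed

text \<open>Crude on purpose: charges of either sign are replaced by their absolute values, because
  any finite \<open>A\<close> is outweighed by \<open>Q\<close> for large \<open>n\<close>.\<close>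

lemma log_sum_bound_at_infinity:
  fixes b :: "nat \<Rightarrow> complex"
  shows "\<exists>A R. \<forall>z. cmod z \<ge> R \<longrightarrow> (\<Sum>j\<le>s. 2 * \<gamma> j * ln (cmod (z - b j))) \<le> A * ln (cmod z)"
proof -
  define m where "m = (\<Sum>j\<le>s. cmod (b j))"
  have m: "cmod (b j) \<le> m" if "j \<le> s" for j
    unfolding m_def using that by (intro member_le_sum) auto
  \<comment> \<open>From radius \<open>2 + 2m\<close> on, each distance is at least 1, so its
    logarithm is not negative, and at most \<open>2 |z| \<le> |z|^2\<close>.\<close>
  have "(\<Sum>j\<le>s. 2 * \<gamma> j * ln (cmod (z - b j))) \<le> (\<Sum>j\<le>s. 4 * \<bar>\<gamma> j\<bar>) * ln (cmod z)"
    if z: "cmod z \<ge> 2 + 2 * m" for z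
    unfolding sum_distrib_right
  proof (intro sum_mono)
    fix j assume j: "j \<in> {..s}"
    have m0: "m \<ge> 0" unfolding m_def by (intro sum_nonneg) auto
    have 1: "1 \<le> cmod (z - b j)" using m[of j] j z m0 norm_triangle_ineq2[of z "b j"] by auto
    have "cmod (z - b j) \<le> cmod z * 2" using m[of j] j z m0 norm_triangle_ineq4[of z "b j"] by auto
    also have "\<dots> \<le> cmod z * cmod z" using z m0 by (intro mult_left_mono) auto
    finally have "ln (cmod (z - b j)) \<le> ln (cmod z * cmod z)" using 1 z m0 by (subst ln_le_cancel_iff) auto
    also have "\<dots> = 2 * ln (cmod z)" using z m0 by (subst ln_mult) auto
    finally have 2: "ln (cmod (z - b j)) \<le> 2 * ln (cmod z)" .
    have "2 * \<gamma> j * ln (cmod (z - b j)) \<le> 2 * \<bar>\<gamma> j\<bar> * ln (cmod (z - b j))"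
      using 1 by (intro mult_right_mono) auto
    also have "\<dots> \<le> 2 * \<bar>\<gamma> j\<bar> * (2 * ln (cmod z))"
      by (intro mult_left_mono 2) auto
    finally show "2 * \<gamma> j * ln (cmod (z - b j)) \<le> 4 * \<bar>\<gamma> j\<bar> * ln (cmod z)" by simp
  qed
  then show ?thesis by blast
qed

lemma norm_poly_le_power:
  assumes "degree p \<le> N"
  shows "\<exists>C\<ge>0. \<forall>z::complex. cmod z \<ge> 1 \<longrightarrow> cmod (poly p z) \<le> C * cmod z ^ N"
proof (intro exI conjI allI impI)
  fix z :: complex assume z: "cmod z \<ge> 1"
  have "cmod (poly p z) \<le> (\<Sum>i\<le>degree p. cmod (coeff p i * z ^ i))"
    unfolding poly_altdef by (rule norm_sum)
  also have "\<dots> \<le> (\<Sum>i\<le>degree p. cmod (coeff p i) * cmod z ^ N)"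
    using z assms by (intro sum_mono) (auto simp: norm_mult norm_power intro!: mult_left_mono power_increasing)
  finally show "cmod (poly p z) \<le> (\<Sum>i\<le>degree p. cmod (coeff p i)) * cmod z ^ N"
    by (simp add: sum_distrib_right)
qed (auto intro: sum_nonneg)

section \<open>The weight near its singularities and at infinity\<close>

locale point_charge_potential =
  fixes k s :: nat and c :: real
    and Q h0 h :: "complex \<Rightarrow> real"
    and a :: "nat \<Rightarrow> complex" and cs :: "nat \<Rightarrow> real"
  assumes k: "k \<ge> 1" and c: "c > -1"
    and lsc: "lower_semicont Q"
    and growth: "Liminf at_infinity (\<lambda>z. ereal (Q z / ln (cmod z))) > 2"
    and analytic: "real_analytic_at Q 0"
    and homog: "homogeneous (2*k - 2) (taylor0 (2*k - 2) (lap Q))"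
    and inj: "inj_on a {1..s}" and charges: "\<forall>j\<in>{1..s}. a j \<noteq> 0 \<and> cs j > -1"
    and C11: "C11 h0"
    and h0_le: "\<exists>C::real. \<forall>z. h0 z \<le> C * (1 + ln (1 + (cmod z)\<^sup>2))"
    and h_eq: "h = perturbation h0 s a cs"
begin

lemma Q_measurable [measurable]: "Q \<in> borel_measurable borel"
  using lsc unfolding lower_semicont_def borel_measurable_iff_greater by auto

lemma h0_continuous: "continuous_on UNIV h0"
  using C11 unfolding C11_def by (simp add: differentiable_imp_continuous_on)

lemma h_measurable [measurable]: "h \<in> borel_measurable borel"
proof -
  have [measurable]: "h0 \<in> borel_measurable borel"
    by (intro borel_measurable_continuous_onI h0_continuous)
  show ?thesis unfolding h_eq perturbation_def by measurable
qed

definition W :: "nat \<Rightarrow> complex \<Rightarrow> real" where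
  "W n z = exp (- real n * V_pot Q c h n z)"

lemma W_measurable [measurable]: "W n \<in> borel_measurable borel"
  unfolding W_def[abs_def] V_pot_def by measurable

lemma W_pos: "W n z > 0"
  by (simp add: W_def)

lemma W_eq: "n \<ge> 1 \<Longrightarrow> W n z = exp (- real n * Q z + h z) * exp (2 * c * ln (cmod z))"
  unfolding W_def V_pot_def by (simp add: exp_add[symmetric] algebra_simps)

lemma mu_n_eq: "mu_n Q c h n = density lborel (\<lambda>z. ennreal (W n z / pi))"
  unfolding mu_n_def dA_def W_def[symmetric]
  by (subst density_density_eq) (auto simp: ennreal_mult[symmetric] less_imp_le[OF W_pos])

text \<open>The charge at the origin is listed together with the others, with index 0.\<close>

definition b :: "nat \<Rightarrow> complex" where "b j = (if j = 0 then 0 else a j)"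
definition \<gamma> :: "nat \<Rightarrow> real" where "\<gamma> j = (if j = 0 then c else cs j)"

lemma inj_b: "inj_on b {..s}"
proof (rule inj_onI)
  fix i j assume ij: "i \<in> {..s}" "j \<in> {..s}" "b i = b j"
  show "i = j"
  proof (cases "i = 0 \<or> j = 0")
    case True then show ?thesis using ij charges by (auto simp: b_def split: if_splits)
  next
    case False then show ?thesis using ij inj_onD[OF inj, of i j] by (simp add: b_def)
  qed
qed

lemma \<gamma>_gt: "j \<le> s \<Longrightarrow> \<gamma> j > -1"
  using c charges by (auto simp: \<gamma>_def)

lemma W_eq_log_sum: "n \<ge> 1 \<Longrightarrow> W n z = exp (- real n * Q z + h0 z + (\<Sum>j\<le>s. 2 * \<gamma> j * ln (cmod (z - b j))))"
proof -
  assume n: "n \<ge> 1"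
  have "(\<Sum>j\<le>s. 2 * \<gamma> j * ln (cmod (z - b j))) = 2 * c * ln (cmod z) + (\<Sum>j=1..s. 2 * cs j * ln (cmod (z - a j)))"
    unfolding atMost_atLeast0 by (subst sum.atLeast_Suc_atMost) (auto simp: \<gamma>_def b_def)
  moreover have "h z = h0 z + (\<Sum>j=1..s. 2 * cs j * ln (cmod (z - a j)))"
    by (simp add: h_eq perturbation_def)
  ultimately show ?thesis
    unfolding W_eq[OF n] exp_add[symmetric] by (simp only: add_ac)
qed

text \<open>Semicontinuity comes from the useful side: a lower bound for \<open>Q\<close> near
  \<open>x\<close> is an upper bound for the weight. Only a charge at \<open>x\<close> can make the
  weight singular there.\<close>

lemma W_local_bound:
  assumes n: "n \<ge> 1"
  shows "\<exists>g>-1. \<exists>C\<ge>0. \<exists>r>0. \<forall>z\<in>ball x r - {x}. W n z \<le> C * exp (2 * g * ln (cmod (z - x)))"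
proof -
  obtain g C where g: "g > -1"
    "\<forall>\<^sub>F z in at x. (\<Sum>j\<le>s. 2 * \<gamma> j * ln (cmod (z - b j))) \<le> 2 * g * ln (cmod (z - x)) + C"
    using log_sum_local_bound[where \<gamma> = \<gamma> and x = x, OF inj_b \<gamma>_gt] by blast
  have "open {z. Q x - 1 < Q z}" using lsc unfolding lower_semicont_def by blast
  then have Q: "\<forall>\<^sub>F z in at x. Q x - 1 < Q z"
    using eventually_nhds_in_open[of "{z. Q x - 1 < Q z}" x] by (auto simp: eventually_at_filter elim: eventually_mono)
  have "(h0 \<longlongrightarrow> h0 x) (at x)"
    using h0_continuous by (simp add: continuous_on_def)
  then have h0: "\<forall>\<^sub>F z in at x. h0 z < h0 x + 1"
    by (rule order_tendstoD) simp
  have "\<forall>\<^sub>F z in at x. W n z \<le> exp (- real n * (Q x - 1) + h0 x + 1 + C) * exp (2 * g * ln (cmod (z - x)))"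
    using g(2) Q h0
  proof eventually_elim
    case (elim z)
    have "real n * (Q x - 1) \<le> real n * Q z" using elim n by (intro mult_left_mono) auto
    then show ?case unfolding W_eq_log_sum[OF n] exp_add[symmetric] using elim by auto
  qed
  then obtain r where "r > 0" "\<forall>z. z \<noteq> x \<and> dist z x < r \<longrightarrow>
      W n z \<le> exp (- real n * (Q x - 1) + h0 x + 1 + C) * exp (2 * g * ln (cmod (z - x)))"
    unfolding eventually_at by blast
  then show ?thesis
    using g(1) by (intro exI[of _ g] conjI exI[of _ "exp (- real n * (Q x - 1) + h0 x + 1 + C)"] exI[of _ r])
      (auto simp: dist_commute)
qed

text \<open>The constants do not depend on \<open>n\<close>: the growth of \<open>Q\<close> gives
  the part that scales with \<open>n\<close>, while \<open>A\<close> collects the charges and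
  \<open>h0\<close>.\<close>

lemma W_bound_at_infinity:
  "\<exists>\<epsilon>>0. \<exists>A R. R \<ge> 1 \<and> (\<forall>n\<ge>1. \<forall>z. cmod z \<ge> R \<longrightarrow> W n z \<le> exp ((A - real n * (2 + \<epsilon>)) * ln (cmod z)))"
proof -
  obtain A R1 where A: "\<And>z. cmod z \<ge> R1 \<Longrightarrow> (\<Sum>j\<le>s. 2 * \<gamma> j * ln (cmod (z - b j))) \<le> A * ln (cmod z)"
    using log_sum_bound_at_infinity by metis
  obtain q where q: "ereal q > 2" "ereal q < Liminf at_infinity (\<lambda>z. ereal (Q z / ln (cmod z)))"
    using ereal_dense2[OF growth] by auto
  have "\<forall>\<^sub>F z in at_infinity. ereal q < ereal (Q z / ln (cmod z))"
    using q(2) by (rule less_LiminfD)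
  then obtain R2 where R2: "\<And>z. cmod z \<ge> R2 \<Longrightarrow> q < Q z / ln (cmod z)"
    by (auto simp: eventually_at_infinity)
  obtain C where C: "\<And>z. h0 z \<le> C * (1 + ln (1 + (cmod z)\<^sup>2))" using h0_le by blast
  have q2: "q > 2" using q(1) ereal_less(1) by (cases "q > 2") (auto simp: not_less)
  \<comment> \<open>Beyond radius 3, \<open>ln |z| \<ge> 1\<close> absorbs the additive constant,
    and \<open>1 + |z|^2 \<le> |z|^3\<close>; together they give the factor \<open>4 = 1 + 3\<close>
    in front of \<open>|C|\<close>.\<close>
  have "W n z \<le> exp ((A + 4 * \<bar>C\<bar> - real n * (2 + (q - 2))) * ln (cmod z))"
    if n: "n \<ge> 1" and z: "cmod z \<ge> max 3 (max R1 R2)" for n z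
  proof -
    have z3: "cmod z \<ge> 3" using z by simp
    have "ln (3::real) \<ge> 1" using exp_le ln_ge_iff by (simp add: ln_ge_iff)
    then have ln1: "ln (cmod z) \<ge> 1" using z3 by (meson ln_le_cancel_iff order_trans less_le_trans zero_less_numeral)
    have "q * ln (cmod z) \<le> Q z" using R2[of z] z ln1 by (simp add: field_simps less_imp_le)
    then have 1: "real n * (q * ln (cmod z)) \<le> real n * Q z" by (intro mult_left_mono) auto
    have "1 + (cmod z)\<^sup>2 \<le> (cmod z)\<^sup>2 * cmod z"
    proof -
      have "1 \<le> (cmod z)\<^sup>2" using z3 by (simp add: one_le_power)
      then have "1 + (cmod z)\<^sup>2 \<le> (cmod z)\<^sup>2 * 3" by simp
      also have "\<dots> \<le> (cmod z)\<^sup>2 * cmod z" using z3 by (intro mult_left_mono) auto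
      finally show ?thesis .
    qed
    then have "1 + (cmod z)\<^sup>2 \<le> cmod z ^ 3" by (simp add: power2_eq_square power3_eq_cube)
    then have "ln (1 + (cmod z)\<^sup>2) \<le> ln (cmod z ^ 3)"
      by (subst ln_le_cancel_iff) (use z3 in \<open>auto intro: add_pos_nonneg\<close>)
    also have "\<dots> = 3 * ln (cmod z)" using z3 by (simp add: ln_realpow)
    finally have l: "1 + ln (1 + (cmod z)\<^sup>2) \<le> 4 * ln (cmod z)" using ln1 by linarith
    have l0: "0 \<le> 1 + ln (1 + (cmod z)\<^sup>2)" by (simp add: add_nonneg_nonneg)
    have "h0 z \<le> \<bar>C\<bar> * (1 + ln (1 + (cmod z)\<^sup>2))"
      using C[of z] mult_right_mono[OF abs_ge_self[of C] l0] by linarith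
    also have "\<dots> \<le> \<bar>C\<bar> * (4 * ln (cmod z))" by (intro mult_left_mono l) auto
    finally have 2: "h0 z \<le> 4 * \<bar>C\<bar> * ln (cmod z)" by simp
    have 3: "(\<Sum>j\<le>s. 2 * \<gamma> j * ln (cmod (z - b j))) \<le> A * ln (cmod z)" using A z by simp
    show ?thesis unfolding W_eq_log_sum[OF n] using 1 2 3 by (simp add: algebra_simps)
  qed
  then show ?thesis using q2
    by (intro exI[of _ "q - 2"] conjI exI[of _ "A + 4 * \<bar>C\<bar>"] exI[of _ "max 3 (max R1 R2)"]) auto
qed

lemma nn_integral_poly_W_compact:
  assumes n: "n \<ge> 1" and K: "compact K"
  shows "(\<integral>\<^sup>+z\<in>K. ennreal ((cmod (poly p z))\<^sup>2 * W n z) \<partial>lborel) < \<infinity>"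
proof (rule nn_integral_compact_finite[OF K])
  have [measurable]: "poly p \<in> borel_measurable borel"
    by (intro borel_measurable_continuous_onI continuous_intros)
  show "(\<lambda>z. ennreal ((cmod (poly p z))\<^sup>2 * W n z)) \<in> borel_measurable borel" by measurable
  fix x assume "x \<in> K"
  obtain g C r where g: "g > -1" "C \<ge> 0" "r > 0" "\<And>z. z \<in> ball x r - {x} \<Longrightarrow> W n z \<le> C * exp (2 * g * ln (cmod (z - x)))"
    using W_local_bound[OF n, of x] by blast
  have "bounded (poly p ` cball x r)"
    by (intro compact_imp_bounded compact_continuous_image continuous_intros) auto
  then obtain B where "\<forall>y\<in>poly p ` cball x r. cmod y \<le> B" unfolding bounded_iff by blast
  then have B: "\<And>z. z \<in> cball x r \<Longrightarrow> cmod (poly p z) \<le> B" by blast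
  have "(\<integral>\<^sup>+z\<in>ball x r. ennreal ((cmod (poly p z))\<^sup>2 * W n z) \<partial>lborel)
    \<le> (\<integral>\<^sup>+z. ennreal (B\<^sup>2 * C) * (ennreal (exp (2 * g * ln (cmod (z - x)))) * indicator (ball x r - {x}) z) \<partial>lborel)"
  proof (rule nn_integral_mono_AE)
    show "AE z in lborel. ennreal ((cmod (poly p z))\<^sup>2 * W n z) * indicator (ball x r) z
      \<le> ennreal (B\<^sup>2 * C) * (ennreal (exp (2 * g * ln (cmod (z - x)))) * indicator (ball x r - {x}) z)"
      using AE_lborel_singleton[of x]
    proof eventually_elim
      case (elim z)
      show ?case
      proof (cases "z \<in> ball x r")
        case True
        have "(cmod (poly p z))\<^sup>2 * W n z \<le> B\<^sup>2 * (C * exp (2 * g * ln (cmod (z - x))))"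
          using B[of z] g(4)[of z] True elim W_pos[of n z] by (intro mult_mono power_mono) auto
        then show ?thesis using True elim g(2)
          by (auto simp: ennreal_mult[symmetric] mult_ac intro!: ennreal_leI)
      qed simp
    qed
  qed
  also have "\<dots> = ennreal (B\<^sup>2 * C) * (\<integral>\<^sup>+z\<in>ball x r - {x}. ennreal (exp (2 * g * ln (cmod (z - x)))) \<partial>lborel)"
    by (intro nn_integral_cmult borel_measurable_times_ennreal borel_measurable_indicator) auto
  also have "\<dots> < \<infinity>"
    using nn_integral_powr_ball[OF g(1), of x r] by (simp add: ennreal_mult_less_top)
  finally show "\<exists>r>0. (\<integral>\<^sup>+z\<in>ball x r. ennreal ((cmod (poly p z))\<^sup>2 * W n z) \<partial>lborel) < \<infinity>"
    using g(3) by blast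
qed

text \<open>Growth meets degree here: \<open>|p|^2\<close> grows at most like
  \<open>|z|^(2n-2)\<close> and the weight is at most \<open>|z|^(A - n(2 + \<epsilon>))\<close>,
  which leaves the exponent \<open>A - 2 - n \<epsilon>\<close>.\<close>

lemma eventually_nn_integral_poly_W:
  "\<forall>\<^sub>F n in sequentially. \<forall>p. degree p \<le> n - 1 \<longrightarrow>
    (\<integral>\<^sup>+z. ennreal ((cmod (poly p z))\<^sup>2 * W n z) \<partial>lborel) < \<infinity>"
proof -
  obtain \<epsilon> A R where A: "\<epsilon> > 0" "R \<ge> 1"
    "\<And>n z. n \<ge> 1 \<Longrightarrow> cmod z \<ge> R \<Longrightarrow> W n z \<le> exp ((A - real n * (2 + \<epsilon>)) * ln (cmod z))"
    using W_bound_at_infinity by metis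
  \<comment> \<open>From this \<open>N\<close> on the exponent is at most -4, which is integrable at
    infinity; the threshold is the same for all \<open>p\<close>.\<close>
  obtain N where N: "real N \<ge> (A + 2) / \<epsilon>" using real_arch_simple by blast
  show ?thesis
  proof (rule eventually_sequentiallyI[of "max 1 N"], intro allI impI)
    fix n and p :: "complex poly" assume nn: "n \<ge> max 1 N" and p: "degree p \<le> n - 1"
    then have n: "n \<ge> 1" "real n \<ge> (A + 2) / \<epsilon>" using N by auto
    have [measurable]: "poly p \<in> borel_measurable borel"
      by (intro borel_measurable_continuous_onI continuous_intros)
    obtain C where C: "C \<ge> 0" "\<And>z. cmod z \<ge> 1 \<Longrightarrow> cmod (poly p z) \<le> C * cmod z ^ (n - 1)"
      using norm_poly_le_power[OF p] by blast
    let ?f = "\<lambda>z. ennreal ((cmod (poly p z))\<^sup>2 * W n z)"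
    have fm: "?f \<in> borel_measurable borel" by measurable
    have far: "(cmod (poly p z))\<^sup>2 * W n z \<le> C\<^sup>2 * (1 / cmod z ^ 4)" if z: "R \<le> cmod z" for z
    proof -
      have z1: "cmod z \<ge> 1" using z A(2) by simp
      have pw: "cmod z ^ m = exp (real m * ln (cmod z))" for m
      proof -
        have "exp (ln (cmod z)) = cmod z" using z1 by (intro exp_ln) linarith
        then show ?thesis by (simp only: exp_of_nat_mult)
      qed
      have "(cmod (poly p z))\<^sup>2 * W n z \<le> (C * cmod z ^ (n - 1))\<^sup>2 * exp ((A - real n * (2 + \<epsilon>)) * ln (cmod z))"
        using C(2)[OF z1] A(3)[OF n(1) z] W_pos[of n z] by (intro mult_mono power_mono) auto
      also have "\<dots> = C\<^sup>2 * exp ((2 * real (n - 1) + (A - real n * (2 + \<epsilon>))) * ln (cmod z))"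
        unfolding power_mult_distrib pw by (simp add: exp_double[symmetric] exp_add[symmetric] algebra_simps)
      also have "\<dots> \<le> C\<^sup>2 * exp (- 4 * ln (cmod z))"
      proof -
        have "A + 2 \<le> real n * \<epsilon>" using n(2) A(1) by (simp add: field_simps)
        then have "2 * real (n - 1) + (A - real n * (2 + \<epsilon>)) \<le> - 4" using n(1) by (simp add: algebra_simps of_nat_diff)
        then have "(2 * real (n - 1) + (A - real n * (2 + \<epsilon>))) * ln (cmod z) \<le> - 4 * ln (cmod z)"
          using z1 by (intro mult_right_mono) auto
        then show ?thesis by (intro mult_left_mono) auto
      qed
      also have "exp (- 4 * ln (cmod z)) = 1 / cmod z ^ 4"
        unfolding pw by (simp add: exp_minus inverse_eq_divide)
      finally show ?thesis .
    qed
    have "(\<integral>\<^sup>+z. ?f z \<partial>lborel) \<le> (\<integral>\<^sup>+z. (?f z * indicator (cball 0 R) z)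
        + ennreal (C\<^sup>2) * (ennreal (1 / cmod z ^ 4) * indicator {z. R \<le> cmod z} z) \<partial>lborel)"
    proof (intro nn_integral_mono)
      fix z
      show "?f z \<le> (?f z * indicator (cball 0 R) z)
        + ennreal (C\<^sup>2) * (ennreal (1 / cmod z ^ 4) * indicator {z. R \<le> cmod z} z)"
        using ennreal_leI[OF far[of z]] by (cases "R \<le> cmod z") (auto simp: ennreal_mult[symmetric] indicator_def intro: add_increasing)
    qed
    also have "\<dots> = (\<integral>\<^sup>+z\<in>cball 0 R. ?f z \<partial>lborel)
      + ennreal (C\<^sup>2) * (\<integral>\<^sup>+z\<in>{z. R \<le> cmod z}. ennreal (1 / cmod z ^ 4) \<partial>lborel)"
      by (subst nn_integral_add)
        (auto simp: nn_integral_cmult intro!: borel_measurable_times_ennreal borel_measurable_indicator fm)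
    also have "\<dots> < \<infinity>"
      using nn_integral_poly_W_compact[OF n(1), of "cball 0 R" p] nn_integral_norm_power_at_infinity[OF A(2)]
      by (simp add: ennreal_mult_less_top)
    finally show "(\<integral>\<^sup>+z. ?f z \<partial>lborel) < \<infinity>" .
  qed
qed

text \<open>For definiteness: \<open>W n\<close> is positive everywhere, so a polynomial of norm 0
  vanishes almost everywhere, whereas a nonzero one has finitely many roots.\<close>

lemma eventually_poly_inner: "\<forall>\<^sub>F n in sequentially. poly_inner (mu_n Q c h n) (n - 1)"
  using eventually_nn_integral_poly_W
proof eventually_elim
  case (elim n)
  show ?case
  proof
    show "sets (mu_n Q c h n) = sets borel" by (simp add: mu_n_eq)
    fix p :: "complex poly" assume p: "degree p \<le> n - 1"
    have [measurable]: "poly p \<in> borel_measurable borel"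
      by (intro borel_measurable_continuous_onI continuous_intros)
    show int: "integrable (mu_n Q c h n) (\<lambda>z. (cmod (poly p z))\<^sup>2)"
    proof (rule integrableI_bounded)
      show "(\<lambda>z. (cmod (poly p z))\<^sup>2) \<in> borel_measurable (mu_n Q c h n)"
        by (simp add: mu_n_eq)
      have "(\<integral>\<^sup>+z. ennreal (norm ((cmod (poly p z))\<^sup>2)) \<partial>mu_n Q c h n)
        = (\<integral>\<^sup>+z. ennreal (1 / pi) * ennreal ((cmod (poly p z))\<^sup>2 * W n z) \<partial>lborel)"
        unfolding mu_n_eq using W_pos[of n]
        by (subst nn_integral_density) (auto intro!: nn_integral_cong simp: ennreal_mult[symmetric] less_imp_le mult_ac)
      also have "\<dots> = ennreal (1 / pi) * (\<integral>\<^sup>+z. ennreal ((cmod (poly p z))\<^sup>2 * W n z) \<partial>lborel)"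
        by (intro nn_integral_cmult) measurable
      also have "\<dots> < \<infinity>" using elim p by (simp add: ennreal_mult_less_top)
      finally show "(\<integral>\<^sup>+z. ennreal (norm ((cmod (poly p z))\<^sup>2)) \<partial>mu_n Q c h n) < \<infinity>" .
    qed
    assume "(LINT z|mu_n Q c h n. (cmod (poly p z))\<^sup>2) = 0"
    then have "AE z in mu_n Q c h n. (cmod (poly p z))\<^sup>2 = 0"
      using integral_nonneg_eq_0_iff_AE[OF int] by simp
    then have ae: "AE z in lborel. poly p z = 0"
      unfolding mu_n_eq using W_pos[of n] by (subst (asm) AE_density) auto
    show "p = 0"
    proof (rule ccontr)
      assume "p \<noteq> 0"
      then have "finite {z. poly p z = 0}" by (rule poly_roots_finite)
      then have "{z. poly p z = 0} \<in> null_sets lborel"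
        by (intro finite_imp_null_set_lborel)
      then have "AE z in lborel. z \<notin> {z. poly p z = 0}" by (rule AE_not_in)
      with ae have "AE z::complex in lborel. False" by eventually_elim simp
      then show False
        using AE_iff_measurable[of UNIV "lborel :: complex measure" "\<lambda>_. False"] by simp
    qed
  qed
qed

end

section \<open>Compactness, holomorphic estimates and changes of variables\<close>

text \<open>The constants and the starting index may all depend on the disc; a diagonal sequence
  serves every disc at once.\<close>

lemma Arzela_Ascoli_diagonal:
  fixes F :: "nat \<Rightarrow> complex \<Rightarrow> real"
  assumes bnd: "\<And>M::nat. \<exists>B L N. \<forall>n\<ge>N. \<forall>z\<in>cball 0 (real M). \<bar>F n z\<bar> \<le> B \<and>
      (\<forall>w\<in>cball 0 (real M). \<bar>F n z - F n w\<bar> \<le> L * cmod (z - w))"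
  shows "\<exists>\<psi> g. strict_mono (\<psi> :: nat \<Rightarrow> nat) \<and>
    (\<forall>M::nat. uniform_limit (cball 0 (real M)) (\<lambda>j. F (\<psi> j)) g sequentially)"
proof -
  let ?P = "\<lambda>M s. \<exists>g. uniform_limit (cball 0 (real M)) (\<lambda>j. F (s j)) g sequentially"
  interpret subseqs ?P
  proof
    fix M and s :: "nat \<Rightarrow> nat" assume s: "strict_mono s"
    obtain B L N where N: "\<And>n z. n \<ge> N \<Longrightarrow> z \<in> cball 0 (real M) \<Longrightarrow> \<bar>F n z\<bar> \<le> B"
      "\<And>n z w. n \<ge> N \<Longrightarrow> z \<in> cball 0 (real M) \<Longrightarrow> w \<in> cball 0 (real M) \<Longrightarrow> \<bar>F n z - F n w\<bar> \<le> L * cmod (z - w)"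
      using bnd[of M] by blast
    \<comment> \<open>The shift by \<open>N\<close> skips the terms for which the bounds may
      fail.\<close>
    have sN: "s (j + N) \<ge> N" for j using seq_suble[OF s, of "j + N"] by simp
    have equi: "\<exists>d>0. \<forall>n y. y \<in> cball 0 (real M) \<and> norm (x - y) < d \<longrightarrow> norm (F (s (n + N)) x - F (s (n + N)) y) < e"
      if x: "x \<in> cball 0 (real M)" and e: "0 < e" for x e
    proof (intro exI[of _ "e / (\<bar>L\<bar> + 1)"] conjI allI impI)
      show "0 < e / (\<bar>L\<bar> + 1)" using e by (intro divide_pos_pos) auto
      fix n y assume y: "y \<in> cball 0 (real M) \<and> norm (x - y) < e / (\<bar>L\<bar> + 1)"
      have "\<bar>F (s (n + N)) x - F (s (n + N)) y\<bar> \<le> L * cmod (x - y)"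
        using N(2)[OF sN x] y by blast
      also have "\<dots> \<le> (\<bar>L\<bar> + 1) * cmod (x - y)" by (intro mult_right_mono) auto
      also have "\<dots> < e" using y by (simp add: field_simps)
      finally show "norm (F (s (n + N)) x - F (s (n + N)) y) < e" by simp
    qed
    have "\<exists>g k. strict_mono (k :: nat \<Rightarrow> nat) \<and>
      (\<forall>e>0. \<exists>N'. \<forall>n\<ge>N'. \<forall>x\<in>cball 0 (real M). dist (F (s (k n + N)) x) (g x) < e)"
    proof (rule Arzela_Ascoli[of "cball 0 (real M)" "\<lambda>j. F (s (j + N))" B])
      show "norm (F (s (n + N)) x) \<le> B" if "x \<in> cball 0 (real M)" for n x
        using N(1)[OF sN that] by simp
      fix g k assume "strict_mono (k :: nat \<Rightarrow> nat)"
        and lim: "\<And>e. 0 < e \<Longrightarrow> \<exists>N'. \<forall>n x. N' \<le> n \<and> x \<in> cball 0 (real M) \<longrightarrow> norm (F (s (k n + N)) x - g x) < e"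
      moreover have "\<forall>e>0. \<exists>N'. \<forall>n\<ge>N'. \<forall>x\<in>cball 0 (real M). dist (F (s (k n + N)) x) (g x) < e"
        using lim unfolding dist_norm by blast
      ultimately show "\<exists>g k. strict_mono (k :: nat \<Rightarrow> nat) \<and>
          (\<forall>e>0. \<exists>N'. \<forall>n\<ge>N'. \<forall>x\<in>cball 0 (real M). dist (F (s (k n + N)) x) (g x) < e)"
        by blast
    qed (simp, rule equi)
    then obtain g k where gk: "strict_mono (k :: nat \<Rightarrow> nat)"
      "\<forall>e>0. \<exists>N'. \<forall>n\<ge>N'. \<forall>x\<in>cball 0 (real M). dist (F (s (k n + N)) x) (g x) < e"
      by blast
    have "uniform_limit (cball 0 (real M)) (\<lambda>j. F ((s \<circ> (\<lambda>j. k j + N)) j)) g sequentially"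
      unfolding uniform_limit_sequentially_iff
      using gk(2) by simp
    moreover have "strict_mono (\<lambda>j. k j + N)" using gk(1) by (simp add: strict_mono_def)
    ultimately show "\<exists>r'. strict_mono r' \<and> ?P M (s \<circ> r')" by blast
  qed
  have sub: "?P n (s \<circ> r)" if r: "strict_mono r" and Pn: "?P n s" for n and s r :: "nat \<Rightarrow> nat"
  proof -
    obtain g where g: "uniform_limit (cball 0 (real n)) (\<lambda>j. F (s j)) g sequentially" using Pn by blast
    have "uniform_limit (cball 0 (real n)) (\<lambda>j. F ((s \<circ> r) j)) g sequentially"
      using filterlim_compose[OF g filterlim_subseq[OF r]] by (simp add: o_def)
    then show ?thesis by blast
  qed
  define d where "d = diagseq"
  have dm: "strict_mono d" unfolding d_def by (rule subseq_diagseq)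
  \<comment> \<open>From index \<open>Suc M\<close> on, the diagonal sequence is a subsequence of
    the one chosen for disc \<open>M\<close>; the earlier terms do not affect the limit.\<close>
  have dh: "?P M (d \<circ> ((+) (Suc M)))" for M
    unfolding d_def by (rule diagseq_holds) (rule sub)
  have ex: "?P M d" for M
  proof -
    obtain g where g: "uniform_limit (cball 0 (real M)) (\<lambda>j. F (d (Suc M + j))) g sequentially"
      using dh[of M] unfolding o_def by blast
    have key: "\<exists>N. \<forall>n\<ge>N. \<forall>x\<in>cball 0 (real M). dist (F (d n) x) (g x) < e" if e: "e > 0" for e
    proof -
      obtain N where "\<forall>n\<ge>N. \<forall>x\<in>cball 0 (real M). dist (F (d (Suc M + n)) x) (g x) < e"
        using g e unfolding uniform_limit_sequentially_iff by blast
      then have N: "\<And>n x. N \<le> n \<Longrightarrow> x \<in> cball 0 (real M) \<Longrightarrow> dist (F (d (Suc M + n)) x) (g x) < e"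
        by blast
      have "dist (F (d n) x) (g x) < e" if "n \<ge> Suc M + N" "x \<in> cball 0 (real M)" for n x
      proof -
        have "Suc M + (n - Suc M) = n" "N \<le> n - Suc M" using that(1) by simp_all
        then show ?thesis using N[of "n - Suc M" x] that(2) by simp
      qed
      then show "\<exists>N. \<forall>n\<ge>N. \<forall>x\<in>cball 0 (real M). dist (F (d n) x) (g x) < e" by blast
    qed
    show ?thesis using key by (intro exI[of _ g]) (simp add: uniform_limit_sequentially_iff)
  qed
  \<comment> \<open>The limits on the various discs are all the pointwise limit, which glues them to
    one function.\<close>
  define g where "g z = lim (\<lambda>j. F (d j) z)" for z
  have "uniform_limit (cball 0 (real M)) (\<lambda>j. F (d j)) g sequentially" for M
  proof -
    obtain g' where g': "uniform_limit (cball 0 (real M)) (\<lambda>j. F (d j)) g' sequentially" using ex by blast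
    have "g z = g' z" if "z \<in> cball 0 (real M)" for z
      unfolding g_def using tendsto_uniform_limitI[OF g' that] by (rule limI)
    then show ?thesis using uniform_limit_cong'[of "cball 0 (real M)" "\<lambda>j. F (d j)" "\<lambda>j. F (d j)" g g' sequentially] g' by simp
  qed
  then show ?thesis using dm by blast
qed

text \<open>Cauchy's estimate on circles of radius 1, which stay in the disc of radius
  \<open>M + 1\<close>; the unit margin makes \<open>B\<close> itself the Lipschitz
  constant.\<close>

lemma holomorphic_bounded_lipschitz:
  assumes hol: "f holomorphic_on UNIV" and B: "\<And>z. cmod z \<le> M + 1 \<Longrightarrow> cmod (f z) \<le> B"
    and z: "cmod z \<le> M" "cmod w \<le> M"
  shows "cmod (f z - f w) \<le> B * cmod (z - w)"
proof (rule field_differentiable_bound[where f' = "deriv f"])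
  show "convex (cball 0 M :: complex set)" by simp
  fix x :: complex assume x: "x \<in> cball 0 M"
  show "(f has_field_derivative deriv f x) (at x within cball 0 M)"
    using holomorphic_derivI[OF hol] by (auto intro: has_field_derivative_at_within)
  have "cmod ((deriv ^^ 1) f x) \<le> fact 1 * B / 1 ^ 1"
  proof (rule Cauchy_inequality)
    show "f holomorphic_on ball x 1" using hol holomorphic_on_subset by blast
    show "continuous_on (cball x 1) f" using hol holomorphic_on_imp_continuous_on continuous_on_subset by blast
    fix y assume "cmod (x - y) = 1"
    then have "cmod y \<le> M + 1" using x norm_triangle_ineq2[of y x] by (simp add: norm_minus_commute)
    then show "cmod (f y) \<le> B" by (rule B)
  qed simp
  then show "cmod (deriv f x) \<le> B" by simp
qed (use z in auto)

lemma integrable_lborel_scale: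
  fixes f :: "complex \<Rightarrow> real"
  assumes f: "integrable lborel f" and r: "r \<noteq> 0"
  shows "integrable lborel (\<lambda>z. f (of_real r * z))"
proof -
  have [measurable]: "f \<in> borel_measurable borel" using borel_measurable_integrable[OF f] by simp
  have "integrable (density (distr lborel borel (\<lambda>x. 0 + r *\<^sub>R x)) (\<lambda>_. ennreal (\<bar>r\<bar> ^ DIM(complex)))) f"
    using f lborel_affine[OF r, of "0::complex"] by (simp add: ennreal_power)
  then have "integrable (distr lborel borel (\<lambda>x. 0 + r *\<^sub>R x)) (\<lambda>x. (\<bar>r\<bar> ^ DIM(complex)) *\<^sub>R f x)"
    by (subst (asm) integrable_density) auto
  then have "integrable (distr lborel borel (\<lambda>x. 0 + r *\<^sub>R x)) f"
    using r by simp
  then show ?thesis by (subst (asm) integrable_distr_eq) (auto simp: scaleR_conv_of_real)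
qed

lemma
  fixes f :: "complex \<Rightarrow> real"
  assumes f: "f \<in> borel_measurable borel"
  shows integrable_dA_iff: "integrable dA f \<longleftrightarrow> integrable lborel f"
    and integral_dA: "(LINT z|dA. f z) = (LINT z|lborel. f z) / pi"
proof -
  show "integrable dA f \<longleftrightarrow> integrable lborel f"
  proof -
    have "integrable dA f \<longleftrightarrow> integrable lborel (\<lambda>z. (1 / pi) * f z)"
      unfolding dA_def using f by (subst integrable_density) auto
    also have "\<dots> \<longleftrightarrow> integrable lborel f"
    proof
      assume "integrable lborel (\<lambda>z. (1 / pi) * f z)"
      then have "integrable lborel (\<lambda>z. pi * ((1 / pi) * f z))" by (rule integrable_mult_right)
      then show "integrable lborel f" by simp
    qed (rule integrable_mult_right)
    finally show ?thesis .
  qed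
  show "(LINT z|dA. f z) = (LINT z|lborel. f z) / pi"
    unfolding dA_def using f by (subst integral_density) auto
qed

lemma set_integrable_powr_compact:
  assumes K: "compact (K :: complex set)" and c: "c > -1"
  shows "set_integrable lborel K (\<lambda>z. exp (2 * c * ln (cmod z)))"
proof -
  obtain r where r: "K \<subseteq> ball 0 r"
    using bounded_subset_ballD[OF compact_imp_bounded[OF K], of 0] by blast
  have [measurable]: "K \<in> sets borel" by (intro borel_closed compact_imp_closed K)
  have "(\<integral>\<^sup>+z. ennreal (norm (indicator K z *\<^sub>R exp (2 * c * ln (cmod z)))) \<partial>lborel)
    \<le> (\<integral>\<^sup>+z\<in>ball 0 r - {0}. ennreal (exp (2 * c * ln (cmod (z - 0)))) \<partial>lborel)"
    by (rule nn_integral_mono_AE, rule AE_mp[OF AE_lborel_singleton[of 0]], rule AE_I2, rule impI)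
      (use r in \<open>auto simp: indicator_def subset_iff\<close>)
  also have "\<dots> < \<infinity>" by (rule nn_integral_powr_ball[OF c])
  finally show ?thesis unfolding set_integrable_def
    by (intro integrableI_bounded borel_measurable_scaleR borel_measurable_indicator) auto
qed

section \<open>Rescaled kernels\<close>

lemma r_scale_pos: "n \<ge> 1 \<Longrightarrow> r_scale k n > 0"
  by (simp add: r_scale_def)

lemma r_scale_power: "n \<ge> 1 \<Longrightarrow> k \<ge> 1 \<Longrightarrow> real n * r_scale k n ^ (2 * k) = 1"
proof -
  assume n: "n \<ge> 1" and k: "k \<ge> 1"
  have "r_scale k n ^ (2 * k) = r_scale k n powr (2 * real k)"
    using r_scale_pos[OF n, of k] by (simp add: powr_realpow[symmetric])
  also have "\<dots> = real n powr (-1)"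
    using k by (simp add: r_scale_def powr_powr)
  finally show ?thesis using n by (simp add: powr_minus)
qed

lemma r_scale_tendsto_0: "k \<ge> 1 \<Longrightarrow> (\<lambda>n. r_scale k n) \<longlonglongrightarrow> 0"
  unfolding r_scale_def
  by (rule tendsto_neg_powr[OF _ filterlim_real_sequentially]) simp

context point_charge_potential
begin

lemma h_tendsto_0: "(h \<longlongrightarrow> h 0) (at 0)"
proof -
  have "(h0 \<longlongrightarrow> h0 0) (at 0)" using h0_continuous by (simp add: continuous_on_def)
  then show ?thesis unfolding h_eq perturbation_def
    by (intro tendsto_intros) (use charges in auto)
qed

text \<open>Makes the definite description in \<open>kernel_n\<close> usable: a kernel exists by
  orthogonalisation, and it is unique.\<close>

lemma eventually_kernel:
  "\<forall>\<^sub>F n in sequentially. n \<ge> 1 \<and>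
    is_reproducing_kernel (mu_n Q c h n) (poly_space n) (kernel_n Q c h n) \<and>
    (\<exists>e. (\<forall>i\<le>n - 1. degree (e i) \<le> n - 1) \<and>
      kernel_n Q c h n = (\<lambda>z w. \<Sum>i\<le>n - 1. poly (e i) z * cnj (poly (e i) w)))"
  using eventually_poly_inner eventually_ge_at_top[of 1]
proof eventually_elim
  case (elim n)
  from elim(1) interpret poly_inner "mu_n Q c h n" "n - 1" .
  have sn: "Suc (n - 1) = n" using elim(2) by simp
  obtain e where e: "\<forall>i\<le>n - 1. degree (e i) \<le> n - 1"
    "is_reproducing_kernel (mu_n Q c h n) (poly_space n) (\<lambda>z w. \<Sum>i\<le>n - 1. poly (e i) z * cnj (poly (e i) w))"
    using ex_reproducing_kernel unfolding sn by blast
  have "kernel_n Q c h n = (\<lambda>z w. \<Sum>i\<le>n - 1. poly (e i) z * cnj (poly (e i) w))"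
    unfolding kernel_n_def by (intro the_equality e(2) reproducing_kernel_unique[OF _ e(2)])
  then show ?case using e elim(2) by auto
qed

lemma integrable_mu_n_iff:
  "integrable (mu_n Q c h n) (\<lambda>z. (cmod (poly p z))\<^sup>2) \<longleftrightarrow>
    integrable lborel (\<lambda>z. W n z / pi * (cmod (poly p z))\<^sup>2)"
  and integral_mu_n:
  "(LINT z|mu_n Q c h n. (cmod (poly p z))\<^sup>2) = (LINT z|lborel. W n z / pi * (cmod (poly p z))\<^sup>2)"
proof -
  have [measurable]: "poly p \<in> borel_measurable borel"
    by (intro borel_measurable_continuous_onI continuous_intros)
  show "integrable (mu_n Q c h n) (\<lambda>z. (cmod (poly p z))\<^sup>2) \<longleftrightarrow>
    integrable lborel (\<lambda>z. W n z / pi * (cmod (poly p z))\<^sup>2)"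
    unfolding mu_n_eq using W_pos[of n] by (subst integrable_density) (auto simp: less_imp_le)
  show "(LINT z|mu_n Q c h n. (cmod (poly p z))\<^sup>2) = (LINT z|lborel. W n z / pi * (cmod (poly p z))\<^sup>2)"
    unfolding mu_n_eq using W_pos[of n] by (subst integral_density) (auto simp: less_imp_le)
qed

end

section \<open>The weight at the microscopic scale\<close>

locale expanded_potential = point_charge_potential +
  fixes G :: "complex poly" and T :: "complex \<Rightarrow> real" and C0 \<delta> :: real
  assumes \<delta>: "\<delta> > 0" and C0: "C0 \<ge> 0" and T_cont: "continuous_on UNIV T"
    and T_hom: "\<And>t z. T (of_real t * z) = t ^ (2*k) * T z"
    and expand: "\<And>w. cmod w < \<delta> \<Longrightarrow> \<bar>Q w - Re (poly G w) - T w\<bar> \<le> C0 * cmod w ^ Suc (2*k)"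
begin

abbreviation r :: "nat \<Rightarrow> real" where "r n \<equiv> r_scale k n"

abbreviation sc :: "nat \<Rightarrow> complex \<Rightarrow> complex" where "sc n z \<equiv> of_real (r n) * z"

text \<open>\<open>Re G\<close> is the harmonic part of the Taylor polynomial of \<open>Q\<close> below degree \<open>2 k\<close>. It does not scale, but it
  is absorbed into the polynomials, and only the remainder \<open>U\<close> has to converge.\<close>

definition U :: "nat \<Rightarrow> complex \<Rightarrow> real" where
  "U n z = - real n * (Q (sc n z) - Re (poly G (sc n z))) + h (sc n z)"

lemma eventually_scale_small:
  assumes "\<eta> > 0"
  shows "\<forall>\<^sub>F n in sequentially. \<forall>z\<in>cball 0 M. cmod (sc n z) < \<eta>"
proof -
  have "(\<lambda>n. r n * (\<bar>M\<bar> + 1)) \<longlonglongrightarrow> 0"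
    using tendsto_mult_right[OF r_scale_tendsto_0[OF k]] by simp
  then have "\<forall>\<^sub>F n in sequentially. r n * (\<bar>M\<bar> + 1) < \<eta>"
    by (rule order_tendstoD) (rule assms)
  then show ?thesis using eventually_ge_at_top[of 1]
  proof eventually_elim
    case (elim n)
    have rn: "r n > 0" using r_scale_pos[OF elim(2)] .
    show ?case
    proof
      fix z :: complex assume "z \<in> cball 0 M"
      then have "cmod z \<le> \<bar>M\<bar> + 1" by auto
      then have "cmod (sc n z) \<le> r n * (\<bar>M\<bar> + 1)" using rn by (simp add: norm_mult)
      then show "cmod (sc n z) < \<eta>" using elim by simp
    qed
  qed
qed

text \<open>The expansion error is of order \<open>n (r |z|)^(2k+1) = r |z|^(2k+1)\<close>: the
  factor \<open>n\<close> cancels all but one power of \<open>r\<close>. The perturbation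
  contributes its value at 0, where it is continuous because no \<open>a j\<close> is 0.\<close>

lemma U_limit: "uniform_limit (cball 0 M) U (\<lambda>z. - T z + h 0) sequentially"
  unfolding uniform_limit_iff
proof (intro allI impI)
  fix e :: real assume e: "e > 0"
  have "\<forall>\<^sub>F z in at 0. dist (h z) (h 0) < e / 2"
    using h_tendsto_0 e by (intro tendstoD) auto
  then obtain \<eta> where \<eta>: "\<eta> > 0" "\<And>z. z \<noteq> 0 \<Longrightarrow> cmod z < \<eta> \<Longrightarrow> dist (h z) (h 0) < e / 2"
    unfolding eventually_at by auto
  have "(\<lambda>n. C0 * \<bar>M\<bar> ^ Suc (2*k) * r n) \<longlonglongrightarrow> 0"
    using tendsto_mult_left[OF r_scale_tendsto_0[OF k]] by simp
  then have "\<forall>\<^sub>F n in sequentially. C0 * \<bar>M\<bar> ^ Suc (2*k) * r n < e / 2"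
    by (rule order_tendstoD) (use e in simp)
  then show "\<forall>\<^sub>F n in sequentially. \<forall>z\<in>cball 0 M. dist (U n z) (- T z + h 0) < e"
    using eventually_scale_small[OF \<eta>(1), of M] eventually_scale_small[OF \<delta>, of M] eventually_ge_at_top[of 1]
  proof eventually_elim
    case (elim n)
    note n = elim(4)
    have rn: "r n > 0" using r_scale_pos[OF n] .
    show ?case
    proof
      fix z :: complex assume z: "z \<in> cball 0 M"
      have 1: "dist (h (sc n z)) (h 0) < e / 2"
        using \<eta>(2)[of "sc n z"] elim(2) z e by (cases "sc n z = 0") auto
      have "T (sc n z) = r n ^ (2*k) * T z" by (rule T_hom)
      then have "real n * T (sc n z) = (real n * r n ^ (2*k)) * T z" by simp
      then have T: "real n * T (sc n z) = T z" using r_scale_power[OF n k] by simp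
      have "\<bar>real n * (Q (sc n z) - Re (poly G (sc n z))) - T z\<bar> = real n * \<bar>Q (sc n z) - Re (poly G (sc n z)) - T (sc n z)\<bar>"
        unfolding T[symmetric] right_diff_distrib[symmetric] abs_mult by simp
      also have "\<dots> \<le> real n * (C0 * cmod (sc n z) ^ Suc (2*k))"
        by (intro mult_left_mono expand) (use elim(3) z in auto)
      also have "\<dots> = (real n * r n ^ (2*k)) * (C0 * cmod z ^ Suc (2*k) * r n)"
        using rn by (simp add: norm_mult power_mult_distrib mult_ac)
      also have "\<dots> = C0 * cmod z ^ Suc (2*k) * r n" using r_scale_power[OF n k] by simp
      also have "\<dots> \<le> C0 * \<bar>M\<bar> ^ Suc (2*k) * r n"
        using z rn C0 by (intro mult_right_mono mult_left_mono power_mono) auto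
      finally have "\<bar>real n * (Q (sc n z) - Re (poly G (sc n z))) - T z\<bar> < e / 2" using elim(1) by simp
      with 1 show "dist (U n z) (- T z + h 0) < e"
        unfolding U_def dist_real_def by linarith
    qed
  qed
qed

lemma U_limit_bounded: "\<exists>B. \<forall>z\<in>cball 0 M. \<bar>- T z + h 0\<bar> \<le> B"
proof -
  have "continuous_on (cball 0 M) (\<lambda>z. - T z + h 0)"
    by (intro continuous_intros continuous_on_subset[OF T_cont]) simp
  then have "bounded ((\<lambda>z. - T z + h 0) ` cball 0 M)"
    by (intro compact_imp_bounded compact_continuous_image) auto
  then show ?thesis unfolding bounded_iff by auto
qed

lemma U_bounded: "\<exists>B. \<forall>\<^sub>F n in sequentially. \<forall>z\<in>cball 0 M. \<bar>U n z\<bar> \<le> B"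
proof -
  obtain B where B: "\<And>z. z \<in> cball 0 M \<Longrightarrow> \<bar>- T z + h 0\<bar> \<le> B" using U_limit_bounded by blast
  have "\<forall>\<^sub>F n in sequentially. \<forall>z\<in>cball 0 M. dist (U n z) (- T z + h 0) < 1"
    using U_limit[of M] unfolding uniform_limit_iff by simp
  then have "\<forall>\<^sub>F n in sequentially. \<forall>z\<in>cball 0 M. \<bar>U n z\<bar> \<le> B + 1"
  proof eventually_elim
    case (elim n)
    show ?case
    proof
      fix z :: complex assume z: "z \<in> cball 0 M"
      then show "\<bar>U n z\<bar> \<le> B + 1"
        using B[OF z] bspec[OF elim z] unfolding dist_real_def by linarith
    qed
  qed
  then show ?thesis by blast
qed

text \<open>The origin is excluded because \<open>ln 0 = 0\<close> would lose the factor
  \<open>r n powr (2 * c)\<close> there.\<close>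

lemma W_scaled:
  assumes n: "n \<ge> 1" and z: "z \<noteq> 0"
  shows "W n (sc n z) = r n powr (2 * c) * exp (- real n * Re (poly G (sc n z))) * exp (U n z) * exp (2 * c * ln (cmod z))"
proof -
  have rn: "r n > 0" using r_scale_pos[OF n] .
  have "ln (cmod (sc n z)) = ln (r n) + ln (cmod z)"
    using rn z by (simp add: norm_mult ln_mult)
  moreover have "r n powr (2 * c) = exp (2 * c * ln (r n))" using rn by (simp add: powr_def)
  ultimately show ?thesis
    unfolding W_eq[OF n] U_def by (simp add: exp_add[symmetric] algebra_simps)
qed

text \<open>The weight is singular at the origin, so the area mean value property is applied only on discs of
  radius \<open>r n\<close> centred on a circle around the origin; the maximum principle then gives the bound
  inside that circle.\<close>

lemma poly_bound:
  assumes M: "M \<ge> 1"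
  shows "\<exists>C\<ge>0. \<forall>\<^sub>F n in sequentially. \<forall>p z. degree p \<le> n - 1 \<longrightarrow> cmod z \<le> M \<longrightarrow>
    r n powr (2 + 2 * c) * (cmod (poly p (sc n z)))\<^sup>2 * exp (- real n * Re (poly G (sc n z)))
      \<le> C * (LINT z|mu_n Q c h n. (cmod (poly p z))\<^sup>2)"
proof -
  obtain B where B: "\<forall>\<^sub>F n in sequentially. \<forall>z\<in>cball 0 (M + 2). \<bar>U n z\<bar> \<le> B" using U_bounded by blast
  \<comment> \<open>Absorbs the worst case of \<open>- U n v\<close> and of
    \<open>- 2 c ln |v|\<close> on the annulus \<open>1 \<le> |v| \<le> M + 2\<close>.\<close>
  define D where "D = B + 2 * \<bar>c\<bar> * ln (M + 2)"
  have ev: "\<forall>\<^sub>F n in sequentially. \<forall>p z. degree p \<le> n - 1 \<longrightarrow> cmod z \<le> M \<longrightarrow>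
    r n powr (2 + 2 * c) * (cmod (poly p (sc n z)))\<^sup>2 * exp (- real n * Re (poly G (sc n z)))
      \<le> exp D * (LINT z|mu_n Q c h n. (cmod (poly p z))\<^sup>2)"
    using B eventually_ge_at_top[of 1] eventually_poly_inner
  proof eventually_elim
    case (elim n)
    note n = elim(2)
    from elim(3) interpret poly_inner "mu_n Q c h n" "n - 1" .
    define \<rho> where "\<rho> = r n"
    have \<rho>: "\<rho> > 0" using r_scale_pos[OF n] by (simp add: \<rho>_def)
    show ?case
    proof (intro allI impI)
      fix p :: "complex poly" and z :: complex
      assume p: "degree p \<le> n - 1" and z: "cmod z \<le> M"
      define I where "I = (LINT z|mu_n Q c h n. (cmod (poly p z))\<^sup>2)"
      have int: "integrable lborel (\<lambda>z. W n z / pi * (cmod (poly p z))\<^sup>2)"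
        using integrable_norm2[OF p] unfolding integrable_mu_n_iff .
      have I_eq: "I = (LINT z|lborel. W n z / pi * (cmod (poly p z))\<^sup>2)"
        unfolding I_def by (rule integral_mu_n)
      have I0: "I \<ge> 0" unfolding I_def by simp
      \<comment> \<open>Half of the exponent, since the squared modulus doubles it; thus the
        harmonic part of the weight sits in an entire function.\<close>
      define f where "f w = poly p w * exp (- of_nat n * poly G w / 2)" for w
      have hol: "f holomorphic_on S" for S unfolding f_def by (intro holomorphic_intros) auto
      have f2: "(cmod (f w))\<^sup>2 = (cmod (poly p w))\<^sup>2 * exp (- real n * Re (poly G w))" for w
        by (simp add: f_def norm_mult power_mult_distrib exp_double[symmetric])
      \<comment> \<open>Around points of scaled radius \<open>M + 1\<close>, discs of scaled radius
        1 stay between the radii \<open>M \<ge> 1\<close> and \<open>M + 2\<close>: away from the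
        singularity and within the disc where \<open>U\<close> is bounded.\<close>
      have circ: "(cmod (f \<zeta>))\<^sup>2 \<le> exp D * I / \<rho> powr (2 + 2 * c)" if \<zeta>: "cmod \<zeta> = (M + 1) * \<rho>" for \<zeta>
      proof -
        have le: "(cmod (f w))\<^sup>2 \<le> (exp D * \<rho> powr (- 2 * c) * pi) * (W n w / pi * (cmod (poly p w))\<^sup>2)"
          if w: "w \<in> ball \<zeta> \<rho>" for w
        proof -
          define v where "v = w / of_real \<rho>"
          have wv: "w = sc n v" using \<rho> by (simp add: v_def \<rho>_def)
          have d: "cmod (\<zeta> - w) < \<rho>" using w by (simp add: dist_norm)
          have "cmod w \<le> (M + 2) * \<rho>" using norm_triangle_ineq2[of w \<zeta>] d \<zeta> by (simp add: norm_minus_commute algebra_simps)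
          then have v1: "cmod v \<le> M + 2" using \<rho> by (simp add: v_def norm_divide field_simps)
          have "cmod w \<ge> M * \<rho>" using norm_triangle_ineq2[of \<zeta> w] d \<zeta> by (simp add: algebra_simps)
          then have "cmod v \<ge> M" using \<rho> by (simp add: v_def norm_divide field_simps)
          then have v2: "cmod v \<ge> 1" using M by simp
          then have v0: "v \<noteq> 0" by auto
          have lnv: "0 \<le> ln (cmod v)" "ln (cmod v) \<le> ln (M + 2)"
            using v1 v2 v0 M by (auto simp: ln_ge_zero)
          have "- (c * ln (cmod v)) \<le> \<bar>c\<bar> * ln (M + 2)"
            using lnv by (smt (verit) mult_mono mult_minus_left abs_ge_zero mult_right_mono)
          moreover have "- U n v \<le> B" using elim(1) v1 by (auto simp: abs_le_iff)
          ultimately have "0 \<le> D + U n v + 2 * c * ln (cmod v)" unfolding D_def by linarith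
          then have "1 \<le> exp (D + U n v + 2 * c * ln (cmod v))" by simp
          then have "exp (- real n * Re (poly G w)) * 1 \<le> exp (- real n * Re (poly G w)) * exp (D + U n v + 2 * c * ln (cmod v))"
            by (intro mult_left_mono) auto
          also have "\<dots> = exp D * \<rho> powr (- 2 * c) * W n w"
            unfolding wv W_scaled[OF n v0] using \<rho>
            by (simp add: exp_add \<rho>_def powr_minus field_simps)
          finally have "(cmod (poly p w))\<^sup>2 * exp (- real n * Re (poly G w)) \<le> (cmod (poly p w))\<^sup>2 * (exp D * \<rho> powr (- 2 * c) * W n w)"
            by (intro mult_left_mono) auto
          then show ?thesis unfolding f2 by (simp add: mult_ac)
        qed
        have "pi * \<rho>\<^sup>2 * (cmod (f \<zeta>))\<^sup>2 \<le> (LINT w:ball \<zeta> \<rho>|lborel. (cmod (f w))\<^sup>2)"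
          by (rule holomorphic_area_submean[OF hol[of "ball \<zeta> (2 * \<rho>)"]]) (use \<rho> in auto)
        also have "\<dots> \<le> (LINT w|lborel. (exp D * \<rho> powr (- 2 * c) * pi) * (W n w / pi * (cmod (poly p w))\<^sup>2))"
          unfolding set_lebesgue_integral_def
        proof (rule integral_mono')
          show "integrable lborel (\<lambda>w. (exp D * \<rho> powr (- 2 * c) * pi) * (W n w / pi * (cmod (poly p w))\<^sup>2))"
            by (intro integrable_mult_right int)
          fix w
          have "0 \<le> (exp D * \<rho> powr (- 2 * c) * pi) * (W n w / pi * (cmod (poly p w))\<^sup>2)"
            using W_pos[of n w] by simp
          then show "indicator (ball \<zeta> \<rho>) w *\<^sub>R (cmod (f w))\<^sup>2 \<le> (exp D * \<rho> powr (- 2 * c) * pi) * (W n w / pi * (cmod (poly p w))\<^sup>2)"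
            using le[of w] by (cases "w \<in> ball \<zeta> \<rho>") (simp_all del: mem_ball)
        qed (use W_pos[of n] in \<open>simp add: less_imp_le\<close>)
        also have "\<dots> = exp D * \<rho> powr (- 2 * c) * pi * I"
          unfolding I_eq by (rule integral_mult_right_zero)
        finally have "\<rho>\<^sup>2 * (cmod (f \<zeta>))\<^sup>2 \<le> exp D * \<rho> powr (- 2 * c) * I"
          by (simp add: field_simps)
        \<comment> \<open>The origin of the normalisation: \<open>\<rho>^2\<close> is the area of
          the averaging disc up to \<open>pi\<close>, and \<open>\<rho> powr (2 * c)\<close> is the
          scaling of the weight.\<close>
        moreover have "\<rho> powr (2 + 2 * c) = \<rho>\<^sup>2 * \<rho> powr (2 * c)"
          using \<rho> by (simp add: powr_add powr_numeral)
        ultimately show ?thesis using \<rho> by (simp add: powr_minus field_simps)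
      qed
      define E where "E = exp D * I / \<rho> powr (2 + 2 * c)"
      have E0: "E \<ge> 0" unfolding E_def using I0 by simp
      have "cmod (f (sc n z)) \<le> sqrt E"
      proof (rule maximum_modulus_frontier[of f "cball 0 ((M + 1) * \<rho>)"])
        fix \<zeta> :: complex assume "\<zeta> \<in> frontier (cball 0 ((M + 1) * \<rho>))"
        then have "cmod \<zeta> = (M + 1) * \<rho>" using \<rho> M by (simp add: frontier_cball)
        then have "(cmod (f \<zeta>))\<^sup>2 \<le> E" unfolding E_def by (rule circ)
        then show "cmod (f \<zeta>) \<le> sqrt E" by (rule real_le_rsqrt)
      next
        show "sc n z \<in> cball 0 ((M + 1) * \<rho>)"
          using z \<rho> by (simp add: norm_mult \<rho>_def mult.commute)
      qed (auto intro: hol holomorphic_on_imp_continuous_on)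
      then have "(cmod (f (sc n z)))\<^sup>2 \<le> E"
        using E0 by (metis norm_ge_zero power_mono real_sqrt_pow2)
      then have "(cmod (poly p (sc n z)))\<^sup>2 * exp (- real n * Re (poly G (sc n z))) * \<rho> powr (2 + 2 * c) \<le> exp D * I"
        unfolding f2 E_def using \<rho> by (simp add: field_simps)
      then show "r n powr (2 + 2 * c) * (cmod (poly p (sc n z)))\<^sup>2 * exp (- real n * Re (poly G (sc n z)))
        \<le> exp D * (LINT z|mu_n Q c h n. (cmod (poly p z))\<^sup>2)"
        unfolding I_def \<rho>_def by (simp add: mult_ac)
    qed
  qed
  then show ?thesis by (intro exI[of _ "exp D"]) auto
qed


section \<open>The scaled kernel: local bounds and equicontinuity\<close>

definition E :: "nat \<Rightarrow> complex \<Rightarrow> complex" where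
  "E n z = exp (- of_nat n * poly G (sc n z) / 2)"

text \<open>The factors \<open>E\<close> and \<open>cnj E\<close> turn the scaled kernel into a function that is holomorphic in \<open>z\<close>, hermitian
  and locally bounded.\<close>

definition L :: "nat \<Rightarrow> complex \<Rightarrow> complex \<Rightarrow> complex" where
  "L n z w = of_real (r n powr (2 + 2 * c)) * kernel_n Q c h n (sc n z) (sc n w) * E n z * cnj (E n w)"

definition F :: "nat \<Rightarrow> complex \<Rightarrow> real" where
  "F n z = Re (L n z z)"

lemma norm_E: "(cmod (E n z))\<^sup>2 = exp (- real n * Re (poly G (sc n z)))"
  by (simp add: E_def exp_double[symmetric])

text \<open>The polynomial bound feeds on itself: the squared norm of a kernel section is its own
  diagonal value, so \<open>|L n z w|^2 \<le> C |L n w w|\<close>. With \<open>z = w\<close> this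
  bounds the diagonal by \<open>C\<close>, and reinserting that gives \<open>C\<close> off the
  diagonal too.\<close>

lemma L_bounded:
  assumes M: "M \<ge> 1"
  shows "\<exists>C. \<forall>\<^sub>F n in sequentially. \<forall>z w. cmod z \<le> M \<longrightarrow> cmod w \<le> M \<longrightarrow> cmod (L n z w) \<le> C"
proof -
  obtain C where C: "C \<ge> 0" and ev: "\<forall>\<^sub>F n in sequentially. \<forall>p z. degree p \<le> n - 1 \<longrightarrow> cmod z \<le> M \<longrightarrow>
    r n powr (2 + 2 * c) * (cmod (poly p (sc n z)))\<^sup>2 * exp (- real n * Re (poly G (sc n z)))
      \<le> C * (LINT z|mu_n Q c h n. (cmod (poly p z))\<^sup>2)"
    using poly_bound[OF M] by blast
  have "\<forall>\<^sub>F n in sequentially. \<forall>z w. cmod z \<le> M \<longrightarrow> cmod w \<le> M \<longrightarrow> cmod (L n z w) \<le> C"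
    using ev eventually_kernel
  proof eventually_elim
    case (elim n)
    define X where "X = r n powr (2 + 2 * c)"
    have X: "X \<ge> 0" by (simp add: X_def)
    have rk: "is_reproducing_kernel (mu_n Q c h n) (poly_space n) (kernel_n Q c h n)" using elim(2) by blast
    have sq: "(cmod (L n z w))\<^sup>2 \<le> C * cmod (L n w w)" if z: "cmod z \<le> M" for z w
    proof -
      obtain p where p: "(\<lambda>v. kernel_n Q c h n v (sc n w)) = poly p" "degree p \<le> n - 1"
        using reproducing_kernelD(1)[OF rk, of "sc n w"] unfolding poly_space_def by blast
      define \<kappa> where "\<kappa> = (LINT v|mu_n Q c h n. (cmod (poly p v))\<^sup>2)"
      have Kp: "kernel_n Q c h n v (sc n w) = poly p v" for v using p(1) by (rule fun_cong)
      have \<kappa>0: "\<kappa> \<ge> 0" unfolding \<kappa>_def by simp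
      have "kernel_n Q c h n (sc n w) (sc n w) = of_real (LINT v|mu_n Q c h n. (cmod (kernel_n Q c h n v (sc n w)))\<^sup>2)"
        by (rule reproducing_kernel_diag[OF rk])
      then have diag: "kernel_n Q c h n (sc n w) (sc n w) = of_real \<kappa>" by (simp only: Kp \<kappa>_def)
      have Lww: "cmod (L n w w) = X * \<kappa> * (cmod (E n w))\<^sup>2"
        unfolding L_def diag using X \<kappa>0 by (simp add: norm_mult X_def power2_eq_square)
      have "X * (cmod (poly p (sc n z)))\<^sup>2 * (cmod (E n z))\<^sup>2 \<le> C * \<kappa>"
        using elim(1)[rule_format, OF p(2) z] unfolding norm_E X_def \<kappa>_def .
      then have "(X * (cmod (poly p (sc n z)))\<^sup>2 * (cmod (E n z))\<^sup>2) * (X * (cmod (E n w))\<^sup>2) \<le> (C * \<kappa>) * (X * (cmod (E n w))\<^sup>2)"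
        using X by (intro mult_right_mono) auto
      moreover have "(cmod (L n z w))\<^sup>2 = (X * (cmod (poly p (sc n z)))\<^sup>2 * (cmod (E n z))\<^sup>2) * (X * (cmod (E n w))\<^sup>2)"
        unfolding L_def Kp X_def by (simp add: norm_mult power_mult_distrib power2_eq_square mult_ac)
      ultimately show ?thesis unfolding Lww by (simp add: mult_ac)
    qed
    have diag: "cmod (L n w w) \<le> C" if "cmod w \<le> M" for w
    proof (cases "cmod (L n w w) = 0")
      case False
      then show ?thesis using sq[OF that, of w] by (simp add: power2_eq_square)
    qed (simp add: C)
    show ?case
    proof (intro allI impI)
      fix z w assume zw: "cmod z \<le> M" "cmod w \<le> M"
      have "(cmod (L n z w))\<^sup>2 \<le> C * C"
        using sq[OF zw(1), of w] mult_left_mono[OF diag[OF zw(2)] C] by linarith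
      then show "cmod (L n z w) \<le> C"
        unfolding power2_eq_square[of C, symmetric] by (rule power2_le_imp_le[OF _ C])
    qed
  qed
  then show ?thesis by blast
qed

lemma eventually_L_holomorphic: "\<forall>\<^sub>F n in sequentially. (\<forall>w. (\<lambda>z. L n z w) holomorphic_on UNIV) \<and> (\<forall>z w. L n z w = cnj (L n w z))"
  using eventually_kernel
proof eventually_elim
  case (elim n)
  have rk: "is_reproducing_kernel (mu_n Q c h n) (poly_space n) (kernel_n Q c h n)" using elim by blast
  show ?case
  proof (intro conjI allI)
    fix w
    obtain p where p: "(\<lambda>v. kernel_n Q c h n v (sc n w)) = poly p"
      using reproducing_kernelD(1)[OF rk, of "sc n w"] unfolding poly_space_def by blast
    have Kp: "kernel_n Q c h n v (sc n w) = poly p v" for v using p(1) by (rule fun_cong)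
    show "(\<lambda>z. L n z w) holomorphic_on UNIV"
      unfolding L_def E_def Kp by (intro holomorphic_intros) auto
  next
    fix z w
    have "kernel_n Q c h n (sc n z) (sc n w) = cnj (kernel_n Q c h n (sc n w) (sc n z))"
      by (rule reproducing_kernel_hermitian[OF rk rk])
    then show "L n z w = cnj (L n w z)" unfolding L_def by (simp add: mult_ac)
  qed
qed

text \<open>The difference of diagonal values is split at \<open>L n w z\<close>. The first half
  varies in the holomorphic argument; the second is, by hermitian symmetry, the conjugate of such a
  variation. Hence the factor 2.\<close>

lemma F_bounded_lipschitz:
  "\<exists>B N. \<forall>n\<ge>N. \<forall>z\<in>cball 0 (real M). \<bar>F n z\<bar> \<le> B \<and>
      (\<forall>w\<in>cball 0 (real M). \<bar>F n z - F n w\<bar> \<le> 2 * B * cmod (z - w))"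
proof -
  \<comment> \<open>The extra 1 in the radius is spent on Cauchy's estimate.\<close>
  obtain B where B: "\<forall>\<^sub>F n in sequentially. \<forall>z w. cmod z \<le> real M + 1 \<longrightarrow> cmod w \<le> real M + 1 \<longrightarrow> cmod (L n z w) \<le> B"
    using L_bounded[of "real M + 1"] by auto
  have "\<forall>\<^sub>F n in sequentially. \<forall>z\<in>cball 0 (real M). \<bar>F n z\<bar> \<le> B \<and>
      (\<forall>w\<in>cball 0 (real M). \<bar>F n z - F n w\<bar> \<le> 2 * B * cmod (z - w))"
    using B eventually_L_holomorphic
  proof eventually_elim
    case (elim n)
    have hol: "(\<lambda>z. L n z w) holomorphic_on UNIV" for w using elim(2) by blast
    have herm: "L n z w = cnj (L n w z)" for z w using elim(2) by blast
    have lip: "cmod (L n z v - L n w v) \<le> B * cmod (z - w)"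
      if "cmod z \<le> real M" "cmod w \<le> real M" "cmod v \<le> real M" for z w v
      by (rule holomorphic_bounded_lipschitz[OF hol[of v], of "real M"]) (use elim(1) that in auto)
    show ?case
    proof (intro ballI conjI)
      fix z :: complex assume z: "z \<in> cball 0 (real M)"
      show "\<bar>F n z\<bar> \<le> B"
        using elim(1)[rule_format, of z z] z abs_Re_le_cmod[of "L n z z"] unfolding F_def by auto
      fix w :: complex assume w: "w \<in> cball 0 (real M)"
      have "L n w z - L n w w = cnj (L n z w - L n w w)"
        using herm[of w z] herm[of w w] by (metis complex_cnj_diff)
      then have "cmod (L n w z - L n w w) = cmod (L n z w - L n w w)" by (metis complex_mod_cnj)
      then have "cmod ((L n z z - L n w z) + (L n w z - L n w w)) \<le> B * cmod (z - w) + B * cmod (z - w)"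
        using lip[of z w z] lip[of z w w] z w by (intro norm_triangle_mono) auto
      then have "cmod (L n z z - L n w w) \<le> 2 * B * cmod (z - w)" by simp
      then show "\<bar>F n z - F n w\<bar> \<le> 2 * B * cmod (z - w)"
        unfolding F_def using abs_Re_le_cmod[of "L n z z - L n w w"] by simp
    qed
  qed
  then show ?thesis unfolding eventually_sequentially by blast
qed

text \<open>The power \<open>2 + 2c\<close> in \<open>L\<close> splits into \<open>r^2\<close> from
  rescaling the one-point function and \<open>r^(2c)\<close> from the weight.\<close>

lemma rescaled_eq:
  assumes n: "n \<ge> 1" and z: "z \<noteq> 0"
  shows "rescaled_one_point k Q c h n z = F n z * exp (U n z) * exp (2 * c * ln (cmod z))"
proof -
  have rn: "r n > 0" using r_scale_pos[OF n] .
  have "E n z * cnj (E n z) = of_real (exp (- real n * Re (poly G (sc n z))))"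
    unfolding norm_E[symmetric] complex_norm_square ..
  then have "L n z z = of_real (r n powr (2 + 2 * c) * exp (- real n * Re (poly G (sc n z)))) * kernel_n Q c h n (sc n z) (sc n z)"
    unfolding L_def by (simp add: mult_ac)
  then have F: "F n z = r n powr (2 + 2 * c) * exp (- real n * Re (poly G (sc n z))) * Re (kernel_n Q c h n (sc n z) (sc n z))"
    unfolding F_def by simp
  have "r n powr (2 + 2 * c) = (r n)\<^sup>2 * r n powr (2 * c)"
    using rn by (simp add: powr_add powr_numeral)
  then show ?thesis
    unfolding rescaled_one_point_def one_point_def W_def[symmetric] W_scaled[OF n z] F
    by (simp add: mult_ac)
qed

text \<open>On the diagonal the kernel is a finite sum of squared moduli, each integrable against
  the weight on the whole plane; a dilation preserves this.\<close>

lemma eventually_rescaled_integrable: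
  "\<forall>\<^sub>F n in sequentially. integrable lborel (rescaled_one_point k Q c h n)"
  using eventually_kernel eventually_poly_inner
proof eventually_elim
  case (elim n)
  then have n: "n \<ge> 1" by blast
  from elim(2) interpret poly_inner "mu_n Q c h n" "n - 1" .
  obtain e where e: "\<And>i. i \<le> n - 1 \<Longrightarrow> degree (e i) \<le> n - 1"
    and K: "kernel_n Q c h n = (\<lambda>z w. \<Sum>i\<le>n - 1. poly (e i) z * cnj (poly (e i) w))"
    using elim(1) by blast
  define f where "f \<zeta> = (\<Sum>i\<le>n - 1. W n \<zeta> / pi * (cmod (poly (e i) \<zeta>))\<^sup>2)" for \<zeta>
  have "integrable lborel f"
    unfolding f_def using integrable_norm2[OF e] unfolding integrable_mu_n_iff
    by (intro Bochner_Integration.integrable_sum) simp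
  then have "integrable lborel (\<lambda>z. f (sc n z))"
    by (rule integrable_lborel_scale) (use r_scale_pos[OF n, of k] in simp)
  then have int: "integrable lborel (\<lambda>z. ((r n)\<^sup>2 * pi) * f (sc n z))"
    by (rule integrable_mult_right)
  have "rescaled_one_point k Q c h n = (\<lambda>z. ((r n)\<^sup>2 * pi) * f (sc n z))"
  proof
    fix z
    have "Re (kernel_n Q c h n \<zeta> \<zeta>) = (\<Sum>i\<le>n - 1. (cmod (poly (e i) \<zeta>))\<^sup>2)" for \<zeta>
      unfolding K complex_norm_square[symmetric] by simp
    then show "rescaled_one_point k Q c h n z = ((r n)\<^sup>2 * pi) * f (sc n z)"
      unfolding rescaled_one_point_def one_point_def W_def[symmetric] f_def
      by (simp add: sum_distrib_left sum_distrib_right mult_ac)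
  qed
  then show ?case using int by (simp only:)
qed


section \<open>Passage to the limit\<close>

theorem subsequence_converges:
  assumes \<phi>: "strict_mono (\<phi> :: nat \<Rightarrow> nat)"
  shows "\<exists>\<psi> R. strict_mono (\<psi> :: nat \<Rightarrow> nat) \<and>
    converges_L1_loc (\<lambda>j. rescaled_one_point k Q c h (\<phi> (\<psi> j))) R \<and>
    converges_loc_unif (- {0}) (\<lambda>j. rescaled_one_point k Q c h (\<phi> (\<psi> j))) R"
proof -
  have "\<exists>\<psi> g. strict_mono (\<psi> :: nat \<Rightarrow> nat) \<and>
    (\<forall>M::nat. uniform_limit (cball 0 (real M)) (\<lambda>j. F (\<phi> (\<psi> j))) g sequentially)"
  proof (rule Arzela_Ascoli_diagonal)
    fix M :: nat
    obtain B N where BN: "\<forall>n\<ge>N. \<forall>z\<in>cball 0 (real M). \<bar>F n z\<bar> \<le> B \<and>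
      (\<forall>w\<in>cball 0 (real M). \<bar>F n z - F n w\<bar> \<le> 2 * B * cmod (z - w))"
      using F_bounded_lipschitz by blast
    have "\<forall>n\<ge>N. \<forall>z\<in>cball 0 (real M). \<bar>F (\<phi> n) z\<bar> \<le> B \<and>
      (\<forall>w\<in>cball 0 (real M). \<bar>F (\<phi> n) z - F (\<phi> n) w\<bar> \<le> 2 * B * cmod (z - w))"
    proof (intro allI impI)
      fix n assume "N \<le> n"
      then have "N \<le> \<phi> n" using seq_suble[OF \<phi>, of n] by simp
      then show "\<forall>z\<in>cball 0 (real M). \<bar>F (\<phi> n) z\<bar> \<le> B \<and>
        (\<forall>w\<in>cball 0 (real M). \<bar>F (\<phi> n) z - F (\<phi> n) w\<bar> \<le> 2 * B * cmod (z - w))"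
        using BN by blast
    qed
    then show "\<exists>B L N. \<forall>n\<ge>N. \<forall>z\<in>cball 0 (real M). \<bar>F (\<phi> n) z\<bar> \<le> B \<and>
      (\<forall>w\<in>cball 0 (real M). \<bar>F (\<phi> n) z - F (\<phi> n) w\<bar> \<le> L * cmod (z - w))"
      by blast
  qed
  then obtain \<psi> g where \<psi>: "strict_mono (\<psi> :: nat \<Rightarrow> nat)"
    and g: "\<And>M::nat. uniform_limit (cball 0 (real M)) (\<lambda>j. F (\<phi> (\<psi> j))) g sequentially"
    by blast
  define m where "m j = \<phi> (\<psi> j)" for j
  have m: "filterlim m sequentially sequentially"
    using filterlim_subseq[OF strict_mono_o[OF \<phi> \<psi>]] by (simp add: m_def[abs_def] o_def)
  note ev_m = eventually_compose_filterlim[OF _ m]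
  let ?R = "\<lambda>j. rescaled_one_point k Q c h (m j)"
  \<comment> \<open>\<open>A\<close> will converge uniformly on every disc, the origin included; the
    fixed factor \<open>p\<close> carries the possible singularity at 0.\<close>
  define A where "A j z = F (m j) z * exp (U (m j) z)" for j z
  define A' where "A' z = g z * exp (- T z + h 0)" for z
  define p where "p z = exp (2 * c * ln (cmod z))" for z :: complex
  define R where "R z = A' z * p z" for z

  \<comment> \<open>Continuity makes the limit bounded on discs, as products of uniform limits
    require, and measurable there.\<close>
  have g_cont: "continuous_on (cball 0 (real M)) g" for M
  proof (rule uniform_limit_theorem[OF _ g])
    obtain B N where BN: "\<forall>n\<ge>N. \<forall>z\<in>cball 0 (real M). \<bar>F n z\<bar> \<le> B \<and>
      (\<forall>w\<in>cball 0 (real M). \<bar>F n z - F n w\<bar> \<le> 2 * B * cmod (z - w))"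
      using F_bounded_lipschitz by blast
    have "continuous_on (cball 0 (real M)) (F n)" if n: "n \<ge> N" for n
    proof (rule lipschitz_on_continuous_on)
      show "(2 * \<bar>B\<bar>)-lipschitz_on (cball 0 (real M)) (F n)"
      proof (rule lipschitz_onI)
        fix z w :: complex assume zw: "z \<in> cball 0 (real M)" "w \<in> cball 0 (real M)"
        have "\<bar>F n z - F n w\<bar> \<le> 2 * B * cmod (z - w)" using BN n zw by blast
        also have "\<dots> \<le> 2 * \<bar>B\<bar> * cmod (z - w)" by (intro mult_right_mono) auto
        finally show "dist (F n z) (F n w) \<le> 2 * \<bar>B\<bar> * dist z w" by (simp add: dist_norm)
      qed simp
    qed
    then have "\<forall>\<^sub>F n in sequentially. continuous_on (cball 0 (real M)) (F n)"
      unfolding eventually_sequentially by blast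
    from ev_m[OF this] show "\<forall>\<^sub>F j in sequentially. continuous_on (cball 0 (real M)) (F (\<phi> (\<psi> j)))"
      by (simp add: m_def)
  qed simp
  have A'_cont: "continuous_on (cball 0 (real M)) A'" for M
    unfolding A'_def by (intro continuous_intros g_cont continuous_on_subset[OF T_cont]) simp

  have A_lim: "uniform_limit (cball 0 (real M)) A A' sequentially" for M
  proof -
    \<comment> \<open>The exponential is uniformly continuous on bounded sets only, so the
      \<open>U (m j)\<close> need a common bound.\<close>
    obtain B where B: "\<forall>\<^sub>F n in sequentially. \<forall>z\<in>cball 0 (real M). \<bar>U n z\<bar> \<le> B" using U_bounded by blast
    have U: "uniform_limit (cball 0 (real M)) (\<lambda>j. U (m j)) (\<lambda>z. - T z + h 0) sequentially"
      using filterlim_compose[OF U_limit m] .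
    have exp: "uniform_limit (cball 0 (real M)) (\<lambda>j z. exp (U (m j) z)) (\<lambda>z. exp (- T z + h 0)) sequentially"
    proof (rule uniform_limit_compose_uniformly_continuous_on[OF U, of "{-B..B}" exp])
      show "uniformly_continuous_on {-B..B} (exp :: real \<Rightarrow> real)"
        by (intro compact_uniformly_continuous continuous_intros) simp
      show "\<forall>\<^sub>F j in sequentially. \<forall>z\<in>cball 0 (real M). U (m j) z \<in> {-B..B}"
        using ev_m[OF B] by eventually_elim (auto simp: abs_le_iff)
    qed simp
    have "continuous_on (cball 0 (real M)) (\<lambda>z. exp (- T z + h 0))"
      by (intro continuous_intros continuous_on_subset[OF T_cont]) simp
    then have b1: "bounded ((\<lambda>z. exp (- T z + h 0)) ` cball 0 (real M))"
      by (intro compact_imp_bounded compact_continuous_image) auto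
    have b2: "bounded (g ` cball 0 (real M))"
      by (intro compact_imp_bounded compact_continuous_image g_cont) auto
    show ?thesis
      using uniform_lim_mult[OF g[of M, folded m_def] exp b2 b1] unfolding A_def[abs_def] A'_def[abs_def] .
  qed
  \<comment> \<open>The exception \<open>z = 0\<close> is harmless: it is a null set for the
    integrals and lies outside the compact sets on which uniform convergence is claimed.\<close>
  have R_eq: "\<forall>\<^sub>F j in sequentially. \<forall>z. z \<noteq> 0 \<longrightarrow> ?R j z = A j z * p z"
    using ev_m[OF eventually_ge_at_top[of 1]]
    by eventually_elim (simp add: rescaled_eq A_def p_def)
  have ball: "\<exists>M::nat. K \<subseteq> cball 0 (real M)" if K: "compact K" for K :: "complex set"
  proof -
    obtain b where "K \<subseteq> ball 0 b"
      using bounded_subset_ballD[OF compact_imp_bounded[OF K], of 0] by blast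
    moreover obtain M :: nat where "b \<le> real M" using real_arch_simple by blast
    ultimately show ?thesis by (intro exI[of _ M]) force
  qed

  have unif: "converges_loc_unif (- {0}) ?R R"
    unfolding converges_loc_unif_def
  proof (intro allI impI)
    fix K :: "complex set" assume K: "compact K" "K \<subseteq> - {0}"
    have K0: "z \<noteq> 0" if "z \<in> K" for z using K(2) that by auto
    obtain M :: nat where M: "K \<subseteq> cball 0 (real M)" using ball[OF K(1)] by blast
    have "continuous_on K p" unfolding p_def by (intro continuous_intros) (use K0 in auto)
    then have b1: "bounded (p ` K)" by (intro compact_imp_bounded compact_continuous_image K)
    have "bounded (A' ` cball 0 (real M))"
      by (intro compact_imp_bounded compact_continuous_image A'_cont) auto
    then have b2: "bounded (A' ` K)" by (rule bounded_subset) (use M in auto)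
    have "uniform_limit K (\<lambda>j z. A j z * p z) (\<lambda>z. A' z * p z) sequentially"
      using uniform_lim_mult[OF uniform_limit_on_subset[OF A_lim M] uniform_limit_const b2 b1] .
    moreover have "\<forall>\<^sub>F j in sequentially. \<forall>z\<in>K. A j z * p z = ?R j z"
      using R_eq by eventually_elim (simp add: K0)
    ultimately show "uniform_limit K ?R R sequentially"
      unfolding R_def[abs_def] by (subst (asm) uniform_limit_cong) auto
  qed

  have R_int: "set_integrable lborel K R" if K: "compact K" for K
  proof -
    obtain M :: nat where M: "K \<subseteq> cball 0 (real M)" using ball[OF K] by blast
    have Kb: "K \<in> sets borel" by (intro borel_closed compact_imp_closed K)
    have "bounded (A' ` cball 0 (real M))"
      by (intro compact_imp_bounded compact_continuous_image A'_cont) auto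
    then obtain B where "\<forall>y\<in>A' ` cball 0 (real M). norm y \<le> B" unfolding bounded_iff by blast
    then have B: "\<bar>A' z\<bar> \<le> B" if "z \<in> K" for z using M that by auto
    have pint: "integrable lborel (\<lambda>z. indicator K z *\<^sub>R p z)"
      using set_integrable_powr_compact[OF K c] unfolding set_integrable_def p_def .
    have mA: "(\<lambda>z. indicator K z *\<^sub>R A' z) \<in> borel_measurable borel"
      by (intro borel_measurable_continuous_on_indicator Kb continuous_on_subset[OF A'_cont M])
    have mp: "p \<in> borel_measurable borel" unfolding p_def by measurable
    show ?thesis unfolding set_integrable_def
    proof (rule Bochner_Integration.integrable_bound)
      show "integrable lborel (\<lambda>z. B * (indicator K z *\<^sub>R p z))"
        by (intro integrable_mult_right pint)
      have "(\<lambda>z. indicator K z *\<^sub>R R z) = (\<lambda>z. (indicator K z *\<^sub>R A' z) * p z)"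
        by (simp add: R_def mult_ac)
      then show "(\<lambda>z. indicator K z *\<^sub>R R z) \<in> borel_measurable lborel"
        using borel_measurable_times[OF mA mp] by simp
      show "AE z in lborel. norm (indicator K z *\<^sub>R R z) \<le> norm (B * (indicator K z *\<^sub>R p z))"
      proof (intro AE_I2)
        fix z
        show "norm (indicator K z *\<^sub>R R z) \<le> norm (B * (indicator K z *\<^sub>R p z))"
        proof (cases "z \<in> K")
          case True
          have "\<bar>A' z\<bar> * p z \<le> \<bar>B\<bar> * p z" using B[OF True] by (intro mult_right_mono) (auto simp: p_def)
          then show ?thesis using True by (simp add: R_def abs_mult p_def)
        qed simp
      qed
    qed
  qed
  have Rj_int: "\<forall>\<^sub>F j in sequentially. integrable lborel (?R j)"
    using ev_m[OF eventually_rescaled_integrable] .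
  have set_dA: "set_integrable dA K f" if "set_integrable lborel K f" for K and f :: "complex \<Rightarrow> real"
    using that borel_measurable_integrable[of lborel "\<lambda>z. indicator K z *\<^sub>R f z"]
    unfolding set_integrable_def by (subst integrable_dA_iff) auto

  have "converges_L1_loc ?R R"
    unfolding converges_L1_loc_def
  proof (intro conjI allI impI)
    show "L1_loc R" unfolding L1_loc_def using R_int set_dA by blast
    show "\<forall>\<^sub>F j in sequentially. L1_loc (?R j)"
      using Rj_int
    proof eventually_elim
      case (elim j)
      have "set_integrable lborel K (?R j)" if "compact K" for K
        unfolding set_integrable_def
        by (rule integrable_mult_indicator[OF _ elim]) (use that in \<open>simp add: borel_closed compact_imp_closed\<close>)
      then show ?case unfolding L1_loc_def using set_dA by blast
    qed
  next
    fix K :: "complex set" assume K: "compact K"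
    obtain M :: nat where M: "K \<subseteq> cball 0 (real M)" using ball[OF K] by blast
    have Kb: "K \<in> sets lborel" by (simp add: borel_closed compact_imp_closed K)
    have pint: "integrable lborel (\<lambda>z. indicator K z *\<^sub>R p z)"
      using set_integrable_powr_compact[OF K c] unfolding set_integrable_def p_def .
    define I where "I = (LINT z|lborel. indicator K z *\<^sub>R p z)"
    have I0: "I \<ge> 0" unfolding I_def by (intro integral_nonneg_AE AE_I2) (simp add: p_def)
    show "(\<lambda>j. LINT z:K|dA. \<bar>?R j z - R z\<bar>) \<longlonglongrightarrow> 0"
    proof (rule tendstoI)
      fix e :: real assume e: "e > 0"
      \<comment> \<open>\<open>I + 1\<close> instead of \<open>I\<close>, because \<open>I\<close>
        is 0 when \<open>K\<close> is a null set.\<close>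
      define \<epsilon> where "\<epsilon> = e / (I + 1)"
      have \<epsilon>: "\<epsilon> > 0" using e I0 by (simp add: \<epsilon>_def)
      have "\<forall>\<^sub>F j in sequentially. \<forall>z\<in>K. dist (A j z) (A' z) < \<epsilon>"
        using uniform_limit_on_subset[OF A_lim M] \<epsilon> unfolding uniform_limit_iff by blast
      then show "\<forall>\<^sub>F j in sequentially. dist (LINT z:K|dA. \<bar>?R j z - R z\<bar>) 0 < e"
        using R_eq Rj_int
      proof eventually_elim
        case (elim j)
        let ?f = "\<lambda>z. indicator K z *\<^sub>R \<bar>?R j z - R z\<bar>"
        have "integrable lborel (\<lambda>z. indicator K z *\<^sub>R ?R j z - indicator K z *\<^sub>R R z)"
          using R_int[OF K] integrable_mult_indicator[OF Kb elim(3)] unfolding set_integrable_def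
          by (intro Bochner_Integration.integrable_diff)
        then have "integrable lborel (\<lambda>z. \<bar>indicator K z *\<^sub>R ?R j z - indicator K z *\<^sub>R R z\<bar>)"
          by (rule integrable_abs)
        also have "(\<lambda>z. \<bar>indicator K z *\<^sub>R ?R j z - indicator K z *\<^sub>R R z\<bar>) = ?f"
          by (auto simp: indicator_def)
        finally have fint: "integrable lborel ?f" .
        \<comment> \<open>The uniform distance between \<open>A j\<close> and \<open>A'\<close>
          comes out of the integral; what remains is the integral of \<open>p\<close> over
          \<open>K\<close>, finite because \<open>c > -1\<close>.\<close>
        have "(LINT z|lborel. ?f z) \<le> (LINT z|lborel. \<epsilon> * (indicator K z *\<^sub>R p z))"
        proof (rule integral_mono_AE[OF fint integrable_mult_right[OF pint]])
          show "AE z in lborel. ?f z \<le> \<epsilon> * (indicator K z *\<^sub>R p z)"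
            using AE_lborel_singleton[of "0::complex"]
          proof eventually_elim
            case (elim z)
            show ?case
            proof (cases "z \<in> K")
              case True
              have "\<bar>?R j z - R z\<bar> = \<bar>A j z - A' z\<bar> * p z"
                using \<open>\<forall>z. z \<noteq> 0 \<longrightarrow> ?R j z = A j z * p z\<close> elim
                by (simp add: R_def p_def abs_mult flip: left_diff_distrib)
              also have "\<dots> \<le> \<epsilon> * p z"
                using \<open>\<forall>z\<in>K. dist (A j z) (A' z) < \<epsilon>\<close> True
                by (intro mult_right_mono) (auto simp: dist_real_def p_def less_imp_le)
              finally show ?thesis using True by simp
            qed simp
          qed
        qed
        also have "\<dots> = \<epsilon> * I" unfolding I_def by (rule integral_mult_right_zero)
        finally have le: "(LINT z|lborel. ?f z) \<le> \<epsilon> * I" .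
        have ge: "0 \<le> (LINT z|lborel. ?f z)" by (intro integral_nonneg_AE AE_I2) simp
        have "(LINT z:K|dA. \<bar>?R j z - R z\<bar>) = (LINT z|lborel. ?f z) / pi"
          unfolding set_lebesgue_integral_def using borel_measurable_integrable[OF fint]
          by (intro integral_dA) simp
        moreover have "(LINT z|lborel. ?f z) / pi \<le> (LINT z|lborel. ?f z) / 1"
          using ge pi_ge_two by (intro divide_left_mono) auto
        moreover have "\<epsilon> * I < e" using e I0 by (simp add: \<epsilon>_def field_simps)
        ultimately show ?case using le ge by (simp add: dist_real_def)
      qed
    qed
  qed
  with unif \<psi> show ?thesis unfolding m_def by blast
qed

end

theorem theorem2:
  fixes k s :: nat and c :: real
    and Q h0 h :: "complex \<Rightarrow> real" and \<sigma> :: "complex measure"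
    and a :: "nat \<Rightarrow> complex" and cs :: "nat \<Rightarrow> real"
  assumes "k \<ge> 1" and "c > -1"
    and "lower_semicont Q"
    and "Liminf at_infinity (\<lambda>z. ereal (Q z / ln (cmod z))) > 2"
    and "equilibrium_measure Q \<sigma>"
    and "\<exists>U. open U \<and> msupport \<sigma> \<subseteq> U \<and> C2_on U Q"
    and "0 \<in> interior (msupport \<sigma>)"
    and "real_analytic_at Q 0"
    and "homogeneous (2*k - 2) (taylor0 (2*k - 2) (lap Q))"
    and "\<forall>z. z \<noteq> 0 \<longrightarrow> taylor0 (2*k - 2) (lap Q) z > 0"
    and "inj_on a {1..s}" and "\<forall>j\<in>{1..s}. a j \<noteq> 0 \<and> cs j > -1"
    and "C11 h0"
    and "\<exists>C::real. (\<forall>z. h0 z \<le> C * (1 + ln (1 + (cmod z)\<^sup>2))) \<and>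
           (AE z in lborel. lap h0 z \<le> C * (1 + (cmod z)\<^sup>2) powi (-2))"
    and "h = perturbation h0 s a cs"
    and "Q 0 = 0" and "H_part k Q 0 = 0" and "h 0 = 0"
    and "(lap ^^ k) (Q0_part k Q) 0 / (real k * (fact (k - 1))\<^sup>2) = 1 + c"
  shows "\<forall>\<phi>::nat \<Rightarrow> nat. strict_mono \<phi> \<longrightarrow>
           (\<exists>\<psi>::nat \<Rightarrow> nat. \<exists>R::complex \<Rightarrow> real. strict_mono \<psi> \<and>
             converges_L1_loc (\<lambda>j. rescaled_one_point k Q c h (\<phi> (\<psi> j))) R \<and>
             converges_loc_unif (- {0}) (\<lambda>j. rescaled_one_point k Q c h (\<phi> (\<psi> j))) R)"
proof (intro allI impI)
  fix \<phi> :: "nat \<Rightarrow> nat" assume \<phi>: "strict_mono \<phi>"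
  \<comment> \<open>These data come from \<open>Q\<close> alone; they involve neither
    \<open>n\<close> nor the subsequence.\<close>
  obtain G T C0 \<delta> where "\<delta> > 0" "C0 \<ge> 0" "continuous_on UNIV T" "\<And>t z. T (of_real t * z) = t ^ (2*k) * T z"
    "\<And>w. cmod w < \<delta> \<Longrightarrow> \<bar>Q w - Re (poly G w) - T w\<bar> \<le> C0 * cmod w ^ Suc (2*k)"
    by (rule analytic_local_expansion[OF assms(8,1,9)]) blast
  with assms interpret expanded_potential k s c Q h0 h a cs G T C0 \<delta>
    by unfold_locales blast+
  show "\<exists>\<psi>::nat \<Rightarrow> nat. \<exists>R::complex \<Rightarrow> real. strict_mono \<psi> \<and>
      converges_L1_loc (\<lambda>j. rescaled_one_point k Q c h (\<phi> (\<psi> j))) R \<and>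
      converges_loc_unif (- {0}) (\<lambda>j. rescaled_one_point k Q c h (\<phi> (\<psi> j))) R"
    by (rule subsequence_converges[OF \<phi>])
qed

end
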